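(* Let $n\in\mathbb{N}$ (positive) and $f_{\mathsf{A}_n}(\boldsymbol{X})=\prod_{1\leq i<j\leq n+1}(X_i-X_j)$. For all compact discrete valuation rings $\mathfrak{o}$ with residue field cardinality $q$, the Igusa local zeta function associated with $f_{\mathsf{A}_n}$ over $\mathfrak{o}$ is $$\mathsf{Z}_{f_{\mathsf{A}_n},\mathfrak{o}}(s)=\frac{1}{1-q^{-n-\binom{n+1}{2}s}}\sum_{\tau\in\mathrm{UTP}_{n+1}}\frac{(n+1)!}{|\mathrm{Aut}(\tau)|}\,\pi_\tau(-q^{-1})\prod_{u\in V_\circ(\tau)}\frac{q^{1-\mathsf{dl}(\tau,u)-\binom{\mathsf{dl}(\tau,u)}{2}s}}{1-q^{1-\mathsf{dl}(\tau,u)-\binom{\mathsf{dl}(\tau,u)}{2}s}}.$$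
   Context: The Igusa local zeta function is $\mathsf{Z}_{f,\mathfrak{o}}(s)=\int_{\mathfrak{o}^{n+1}}|f(\boldsymbol{X})|^s\,|\mathrm{d}\boldsymbol{X}|$, where $s$ is a complex variable, $|\cdot|$ is the absolute value on $\mathfrak{o}$ giving a uniformizer absolute value $q^{-1}$, and $|\mathrm{d}\boldsymbol{X}|$ is the additive Haar measure normalized so that $\mathfrak{o}^{n+1}$ has measure 1. (The identity holds for $s$ with nonnegative real part, equivalently as rational functions in $q^{-s}$.) $\mathrm{UTP}_{n+1}$ is the set of isomorphism classes of unlabeled (non-plane) rooted trees with $n+1$ leaves in which every parent (non-leaf vertex) has at least two children. For $\tau\in\mathrm{UTP}_{n+1}$: $\mathrm{Aut}(\tau)$ is the group of graph automorphisms of $\tau$ fixing the root; $P(\tau)$ is the set of parents; $V_\circ(\tau)$ is the set of parents other than the root; $\mathsf{dl}(\tau,u)$ is the number of descendants of $u$ (including $u$ itself) that are leaves; $\mathsf{c}(\tau,u)$ is the number of children of $u$; and $\pi_\tau(Y)=\prod_{u\in P(\tau)}\prod_{i=1}^{\mathsf{c}(\tau,u)-1}(1+iY)$. *)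

theory Defs
  imports
    "HOL-Analysis.Analysis"
    "HOL-Combinatorics.Permutations"
    "HOL-Algebra.Ring_Divisibility"
    "HOL-Algebra.QuotRing"
    "HOL-Algebra.Ideal_Product"
    "HOL-Algebra.Product_Groups"
begin

section \<open>Compact discrete valuation rings\<close>

definition discrete_valuation_ring :: "('a, 'b) ring_scheme \<Rightarrow> bool" where
  "discrete_valuation_ring R \<longleftrightarrow>
     principal_domain R \<and> (\<exists>!I. maximalideal I R) \<and> \<not> Ring.field R"

definition max_ideal :: "('a, 'b) ring_scheme \<Rightarrow> 'a set" where
  "max_ideal R = (THE I. maximalideal I R)"

definition residue_card :: "('a, 'b) ring_scheme \<Rightarrow> nat" where
  "residue_card R = card (carrier (R Quot (max_ideal R)))"

definition ideal_power :: "('a, 'b) ring_scheme \<Rightarrow> 'a set \<Rightarrow> nat \<Rightarrow> 'a set" where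
  "ideal_power R I k = ((\<lambda>J. I \<cdot>\<^bsub>R\<^esub> J) ^^ k) (carrier R)"

definition adic_topology :: "('a, 'b) ring_scheme \<Rightarrow> 'a topology" where
  "adic_topology R = topology (\<lambda>U. U \<subseteq> carrier R \<and>
     (\<forall>x\<in>U. \<exists>k. ideal_power R (max_ideal R) k +>\<^bsub>R\<^esub> x \<subseteq> U))"

definition compact_dvr :: "('a, 'b) ring_scheme \<Rightarrow> bool" where
  "compact_dvr R \<longleftrightarrow> discrete_valuation_ring R \<and> compact_space (adic_topology R)"

text \<open>The valuation is meaningful for nonzero elements only.\<close>

definition valuation :: "('a, 'b) ring_scheme \<Rightarrow> 'a \<Rightarrow> nat" where
  "valuation R x = (GREATEST k. x \<in> ideal_power R (max_ideal R) k)"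

definition dvr_abs :: "('a, 'b) ring_scheme \<Rightarrow> 'a \<Rightarrow> real" where
  "dvr_abs R x = (if x = \<zero>\<^bsub>R\<^esub> then 0 else (1 / real (residue_card R)) ^ valuation R x)"


section \<open>Haar measure and the Igusa local zeta function\<close>

text \<open>
  For a compact group \<open>G\<close> with topology \<open>X\<close>: translation-invariant Borel measures of total mass 1.
  Regularity is not part of the definition; it is automatic for finite Borel measures when
  \<open>X\<close> is compact and metrizable, as for the groups used here.
\<close>

definition normalized_haar_measure ::
    "('a, 'b) monoid_scheme \<Rightarrow> 'a topology \<Rightarrow> 'a measure \<Rightarrow> bool" where
  "normalized_haar_measure G X M \<longleftrightarrow>
     space M = topspace X \<and>
     sets M = sigma_sets (topspace X) {U. openin X U} \<and>
     emeasure M (space M) = 1 \<and>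
     (\<forall>a\<in>carrier G. \<forall>A\<in>sets M. emeasure M (a <#\<^bsub>G\<^esub> A) = emeasure M A)"

text \<open>
  Points of \<open>R\<^sup>I\<close> are functions on \<open>I\<close> that are extensional, i.e. elements of
  \<open>I \<rightarrow>\<^sub>E carrier R\<close>; this set is both the carrier of the product group and the
  underlying space of the product topology.
\<close>

definition power_haar_measure ::
    "('a, 'b) ring_scheme \<Rightarrow> 'i set \<Rightarrow> ('i \<Rightarrow> 'a) measure \<Rightarrow> bool" where
  "power_haar_measure R I M \<longleftrightarrow>
     normalized_haar_measure (product_group I (\<lambda>_. add_monoid R))
       (product_topology (\<lambda>_. adic_topology R) I) M"

text \<open>
  Since \<open>0 powr s = 0\<close> for every \<open>s\<close>, the integrand vanishes on the zero locus of \<open>f\<close>.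
\<close>

definition igusa_zeta ::
    "('a, 'b) ring_scheme \<Rightarrow> ('i \<Rightarrow> 'a) measure \<Rightarrow> (('i \<Rightarrow> 'a) \<Rightarrow> 'a) \<Rightarrow> complex \<Rightarrow> complex" where
  "igusa_zeta R M f s = (\<integral>x. complex_of_real (dvr_abs R (f x)) powr s \<partial>M)"

definition f_A :: "('a, 'b) ring_scheme \<Rightarrow> nat \<Rightarrow> (nat \<Rightarrow> 'a) \<Rightarrow> 'a" where
  "f_A R n x = finprod R (\<lambda>(i, j). x i \<ominus>\<^bsub>R\<^esub> x j) {(i, j). 1 \<le> i \<and> i < j \<and> j \<le> n + 1}"


section \<open>Rooted trees\<close>

text \<open>The edges of a rooted tree are stored as arcs directed from parent to child.
  Isomorphisms and automorphisms are those of the underlying undirected graph that respect the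
  root; these preserve the arcs automatically.\<close>

record 'v rooted_graph =
  rt_verts :: "'v set"
  rt_arcs :: "('v \<times> 'v) set"
  rt_root :: 'v

definition rooted_tree :: "'v rooted_graph \<Rightarrow> bool" where
  "rooted_tree T \<longleftrightarrow>
     finite (rt_verts T) \<and>
     rt_root T \<in> rt_verts T \<and>
     rt_arcs T \<subseteq> rt_verts T \<times> rt_verts T \<and>
     (\<forall>u. (u, rt_root T) \<notin> rt_arcs T) \<and>
     (\<forall>v\<in>rt_verts T - {rt_root T}. \<exists>!u. (u, v) \<in> rt_arcs T) \<and>
     (\<forall>v\<in>rt_verts T. (rt_root T, v) \<in> (rt_arcs T)\<^sup>*)"

definition rt_adj :: "'v rooted_graph \<Rightarrow> 'v \<Rightarrow> 'v \<Rightarrow> bool" where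
  "rt_adj T u v \<longleftrightarrow> (u, v) \<in> rt_arcs T \<or> (v, u) \<in> rt_arcs T"

definition children :: "'v rooted_graph \<Rightarrow> 'v \<Rightarrow> 'v set" where
  "children T u = {v. (u, v) \<in> rt_arcs T}"

definition leaves :: "'v rooted_graph \<Rightarrow> 'v set" where
  "leaves T = {u \<in> rt_verts T. children T u = {}}"

definition parents :: "'v rooted_graph \<Rightarrow> 'v set" where
  "parents T = rt_verts T - leaves T"

definition nonroot_parents :: "'v rooted_graph \<Rightarrow> 'v set" where
  "nonroot_parents T = parents T - {rt_root T}"

definition descendants :: "'v rooted_graph \<Rightarrow> 'v \<Rightarrow> 'v set" where
  "descendants T u = {v. (u, v) \<in> (rt_arcs T)\<^sup>*}"

definition dl :: "'v rooted_graph \<Rightarrow> 'v \<Rightarrow> nat" where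
  "dl T u = card (descendants T u \<inter> leaves T)"

definition num_children :: "'v rooted_graph \<Rightarrow> 'v \<Rightarrow> nat" where
  "num_children T u = card (children T u)"

definition rt_isomorphic :: "'v rooted_graph \<Rightarrow> 'v rooted_graph \<Rightarrow> bool" where
  "rt_isomorphic T T' \<longleftrightarrow> (\<exists>\<phi>. bij_betw \<phi> (rt_verts T) (rt_verts T') \<and>
     \<phi> (rt_root T) = rt_root T' \<and>
     (\<forall>u\<in>rt_verts T. \<forall>v\<in>rt_verts T. rt_adj T u v \<longleftrightarrow> rt_adj T' (\<phi> u) (\<phi> v)))"

definition rt_Aut :: "'v rooted_graph \<Rightarrow> ('v \<Rightarrow> 'v) set" where
  "rt_Aut T = {\<phi>. \<phi> permutes rt_verts T \<and> \<phi> (rt_root T) = rt_root T \<and>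
     (\<forall>u\<in>rt_verts T. \<forall>v\<in>rt_verts T. rt_adj T u v \<longleftrightarrow> rt_adj T (\<phi> u) (\<phi> v))}"

text \<open>
  Every finite tree is isomorphic to one with vertices in \<open>nat\<close>, so the isomorphism classes
  can be formed among those trees.
\<close>

definition branching_trees :: "nat \<Rightarrow> nat rooted_graph set" where
  "branching_trees m = {T. rooted_tree T \<and> card (leaves T) = m \<and>
     (\<forall>u\<in>parents T. num_children T u \<ge> 2)}"

definition UTP :: "nat \<Rightarrow> nat rooted_graph set set" where
  "UTP m = branching_trees m //
     {(T, T'). T \<in> branching_trees m \<and> T' \<in> branching_trees m \<and> rt_isomorphic T T'}"

text \<open>
  Isomorphism invariants of a class are read off from an arbitrary member.
\<close>

definition rep :: "nat rooted_graph set \<Rightarrow> nat rooted_graph" where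
  "rep \<tau> = (SOME T. T \<in> \<tau>)"

definition pi_poly :: "'v rooted_graph \<Rightarrow> complex \<Rightarrow> complex" where
  "pi_poly T Y = (\<Prod>u\<in>parents T. \<Prod>i = 1..num_children T u - 1. 1 + of_nat i * Y)"

end

theory Submission
  imports Defs
begin


text \<open>
  Write \<open>u = q\<^bsup>-s\<^esup>\<close>. Once residue representatives and a uniformizer are chosen, every ring element has a
  digit expansion, and for \<open>x \<noteq> y\<close> the value \<open>\<bar>x - y\<bar>\<^sup>s\<close> is \<open>u\<^sup>k\<close>, where \<open>k\<close> is the number of leading
  digits that \<open>x\<close> and \<open>y\<close> share.
  The integrand therefore only depends on the digit words of the coordinates: it is the product, over
  the pairs of coordinates, of \<open>u\<close> to the length of the common prefix. Points with prescribed first \<open>N\<close>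
  digits form open sets that are translates of one another, so they all have the same Haar measure. By
  dominated convergence the zeta function is the limit of finite averages over tuples of words of
  length \<open>N\<close> (\<open>integral_eq_limit\<close>).

  These averages obey a recursion in \<open>N\<close>. The first digits sort the set \<open>A\<close> of coordinates into a
  partition. Pairs in different blocks contribute 1; a block \<open>B\<close> contributes \<open>u\<close> for each of its pairs
  and then looks like a new configuration indexed by \<open>B\<close>. The probability that the blocks of a
  partition receive distinct digits gives the factors \<open>1 - i/q\<close> of \<open>\<pi>\<^sub>\<tau>(-1/q)\<close>, and the probability that
  all elements of \<open>B\<close> agree gives \<open>q\<^bsup>1 - |B|\<^esup>\<close> (\<open>word_mean_Suc\<close>). In the limit the partition with the single
  block \<open>A\<close> appears on both sides and produces the geometric factor \<open>1/(1 - t)\<close>; the other partitions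
  have smaller blocks. Unrolling the recursion yields a sum over laminar families on \<open>A\<close> that contain
  \<open>A\<close> and all singletons, here called hierarchies (\<open>hierarchy_sum_rec\<close>, \<open>word_mean_tendsto\<close>).

  Finally, a hierarchy is the same thing as a tree with labelled leaves: send each vertex to the set of
  labels of the leaves below it. Two labellings of one tree give the same hierarchy exactly when they
  differ by an automorphism, and the automorphism is unique because a vertex of a branching tree is
  determined by the leaves below it. So a tree \<open>\<tau>\<close> with \<open>m\<close> leaves accounts for \<open>m!/\<bar>Aut \<tau>\<bar>\<close> hierarchies
  (\<open>card_hierarchies_of_tree\<close>), which turns the sum over hierarchies into the sum over \<open>UTP\<close>
  (\<open>UTP_sum_eq_hierarchy_sum\<close>).
\<close>

section \<open>Hierarchies\<close>

definition hierarchy_on :: "'v set \<Rightarrow> 'v set set \<Rightarrow> bool" where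
  "hierarchy_on A H \<longleftrightarrow> A \<in> H \<and> (\<forall>B\<in>H. B \<subseteq> A \<and> B \<noteq> {}) \<and> (\<forall>a\<in>A. {a} \<in> H) \<and>
     (\<forall>B\<in>H. \<forall>C\<in>H. B \<subseteq> C \<or> C \<subseteq> B \<or> B \<inter> C = {})"

text \<open>
  The maximal members of \<open>H\<close> properly contained in \<open>B\<close>; they become the children of the vertex \<open>B\<close>
  when \<open>H\<close> is drawn as a tree.
\<close>

definition subblocks :: "'v set set \<Rightarrow> 'v set \<Rightarrow> 'v set set" where
  "subblocks H B = {C \<in> H. C \<subset> B \<and> \<not> (\<exists>D\<in>H. C \<subset> D \<and> D \<subset> B)}"

definition below :: "'v set set \<Rightarrow> 'v set \<Rightarrow> 'v set set" where
  "below H B = {C \<in> H. C \<subseteq> B}"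

definition hierarchy_weight :: "(nat \<Rightarrow> nat \<Rightarrow> 'b::comm_monoid_mult) \<Rightarrow> 'v set set \<Rightarrow> 'b" where
  "hierarchy_weight g H = (\<Prod>B\<in>{B \<in> H. 2 \<le> card B}. g (card (subblocks H B)) (card B))"

definition hierarchy_sum :: "(nat \<Rightarrow> nat \<Rightarrow> 'b::comm_semiring_1) \<Rightarrow> 'v set \<Rightarrow> 'b" where
  "hierarchy_sum g A = (\<Sum>H | hierarchy_on A H. hierarchy_weight g H)"

lemma hierarchy_onD:
  assumes "hierarchy_on A H"
  shows "A \<in> H" "\<And>B. B \<in> H \<Longrightarrow> B \<subseteq> A" "\<And>B. B \<in> H \<Longrightarrow> B \<noteq> {}" "\<And>a. a \<in> A \<Longrightarrow> {a} \<in> H"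
    "\<And>B C. B \<in> H \<Longrightarrow> C \<in> H \<Longrightarrow> B \<subseteq> C \<or> C \<subseteq> B \<or> B \<inter> C = {}"
proof -
  show "A \<in> H" using assms by (simp add: hierarchy_on_def)
  show "\<And>B. B \<in> H \<Longrightarrow> B \<subseteq> A" using assms by (simp add: hierarchy_on_def)
  show "\<And>B. B \<in> H \<Longrightarrow> B \<noteq> {}" using assms by (simp add: hierarchy_on_def)
  show "\<And>a. a \<in> A \<Longrightarrow> {a} \<in> H" using assms by (simp add: hierarchy_on_def)
  show "\<And>B C. B \<in> H \<Longrightarrow> C \<in> H \<Longrightarrow> B \<subseteq> C \<or> C \<subseteq> B \<or> B \<inter> C = {}"
    using assms by (simp add: hierarchy_on_def)
qed

lemma finite_hierarchies: "finite A \<Longrightarrow> finite {H. hierarchy_on A H}"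
  by (rule finite_subset[of _ "Pow (Pow A)"]) (auto simp: hierarchy_on_def)

lemma finite_hierarchy: "finite A \<Longrightarrow> hierarchy_on A H \<Longrightarrow> finite H"
  by (rule finite_subset[of _ "Pow A"]) (auto simp: hierarchy_on_def)

lemma subblocks_below: "C \<subseteq> B \<Longrightarrow> subblocks (below H B) C = subblocks H C"
  unfolding subblocks_def below_def by blast

lemma hierarchy_below: "hierarchy_on A H \<Longrightarrow> B \<in> H \<Longrightarrow> hierarchy_on B (below H B)"
  by (simp add: hierarchy_on_def below_def subset_iff)

lemma ex_subblock:
  assumes "finite A" "hierarchy_on A H" "B \<in> H" "C \<in> H" "C \<subset> B"
  shows "\<exists>K\<in>subblocks H B. C \<subseteq> K"
proof -
  define S where "S = {D \<in> H. C \<subseteq> D \<and> D \<subset> B}"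
  have "finite S" using finite_hierarchy[OF assms(1,2)] by (simp add: S_def)
  moreover have "C \<in> S" using assms by (simp add: S_def)
  ultimately have "\<exists>K\<in>S. C \<subseteq> K \<and> (\<forall>D\<in>S. K \<subseteq> D \<longrightarrow> K = D)"
    by (rule finite_has_maximal2)
  then obtain K where K: "K \<in> S" "C \<subseteq> K" and max: "\<And>D. D \<in> S \<Longrightarrow> K \<subseteq> D \<Longrightarrow> K = D" by auto
  have "\<not> (K \<subset> D \<and> D \<subset> B)" if "D \<in> H" for D
    using max[of D] K(2) that by (auto simp: S_def)
  then have "K \<in> subblocks H B" using K(1) by (auto simp: subblocks_def S_def)
  with K(2) show ?thesis by blast
qed

lemma partition_on_subblocks:
  assumes "finite A" "hierarchy_on A H" "B \<in> H" "2 \<le> card B"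
  shows "partition_on B (subblocks H B)"
proof (rule partition_onI)
  show "\<Union> (subblocks H B) = B"
  proof
    show "\<Union> (subblocks H B) \<subseteq> B" unfolding subblocks_def by auto
    show "B \<subseteq> \<Union> (subblocks H B)"
    proof
      fix b assume b: "b \<in> B"
      have "{b} \<in> H" using b hierarchy_onD[OF assms(2)] assms(3) by blast
      moreover have "{b} \<subset> B" using b assms(4) by (cases "B = {b}") auto
      ultimately obtain K where "K \<in> subblocks H B" "{b} \<subseteq> K" using ex_subblock[OF assms(1-3)] by blast
      then show "b \<in> \<Union> (subblocks H B)" by auto
    qed
  qed
  show "disjnt C D" if "C \<in> subblocks H B" "D \<in> subblocks H B" "C \<noteq> D" for C D
    using that hierarchy_onD(5)[OF assms(2), of C D] unfolding subblocks_def disjnt_def by blast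
  show "{} \<notin> subblocks H B" using hierarchy_onD(3)[OF assms(2)] unfolding subblocks_def by blast
qed

lemma card_subblocks:
  assumes "finite A" "hierarchy_on A H" "B \<in> H" "2 \<le> card B"
  shows "2 \<le> card (subblocks H B)"
proof -
  have P: "partition_on B (subblocks H B)" by (rule partition_on_subblocks[OF assms])
  have f: "finite (subblocks H B)" using finite_hierarchy[OF assms(1,2)] by (simp add: subblocks_def)
  have "card (subblocks H B) \<noteq> 0"
  proof
    assume "card (subblocks H B) = 0"
    then have "subblocks H B = {}" using f by simp
    then show False using P assms(4) by (simp add: partition_on_def)
  qed
  moreover have "card (subblocks H B) \<noteq> 1"
  proof
    assume "card (subblocks H B) = 1"
    then obtain K where "subblocks H B = {K}" by (auto simp: card_1_singleton_iff)
    then show False using P by (auto simp: partition_on_def subblocks_def)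
  qed
  ultimately show ?thesis by linarith
qed

lemma hierarchy_decompose:
  assumes "finite A" "hierarchy_on A H"
  shows "H = insert A (\<Union>B\<in>subblocks H A. below H B)"
proof -
  have "C \<in> insert A (\<Union>B\<in>subblocks H A. below H B)" if CH: "C \<in> H" for C
  proof (cases "C = A")
    case False
    then have "C \<subset> A" using hierarchy_onD(2)[OF assms(2) CH] by blast
    then obtain K where "K \<in> subblocks H A" "C \<subseteq> K"
      using ex_subblock[OF assms hierarchy_onD(1)[OF assms(2)] CH \<open>C \<subset> A\<close>] by blast
    then show ?thesis using that by (auto simp: below_def)
  qed auto
  moreover have "A \<in> H" using assms(2) by (simp add: hierarchy_on_def)
  ultimately show ?thesis by (auto simp: below_def)
qed

lemma partition_block_psubset:
  assumes "partition_on A P" "2 \<le> card P" "B \<in> P"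
  shows "B \<subset> A"
proof -
  have "P \<noteq> {B}" using assms(2) by auto
  then obtain C where C: "C \<in> P" "C \<noteq> B" using assms(3) by blast
  then obtain x where x: "x \<in> C" using partition_onD3[OF assms(1)] by fastforce
  have "B \<inter> C = {}" using disjointD[OF partition_onD2[OF assms(1)] assms(3) C(1)] C(2) by simp
  then have "x \<in> A - B" using x C(1) partition_onD1[OF assms(1)] by blast
  then show ?thesis using assms(3) partition_onD1[OF assms(1)] by blast
qed

text \<open>
  Together with \<open>hierarchy_decompose\<close> this makes a hierarchy on \<open>A\<close> the same as a
  partition of \<open>A\<close> with a hierarchy on each block, which is the bijection behind \<open>hierarchy_sum_rec\<close>.
  A partition with one block has to be excluded, since it would reproduce \<open>A\<close> itself.
\<close>

lemma hierarchy_compose: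
  assumes P: "partition_on A P" "2 \<le> card P" and h: "\<And>B. B \<in> P \<Longrightarrow> hierarchy_on B (h B)"
  defines "H \<equiv> insert A (\<Union>B\<in>P. h B)"
  shows "hierarchy_on A H" "subblocks H A = P" "\<And>B. B \<in> P \<Longrightarrow> below H B = h B"
proof -
  have disj: "B \<inter> C = {}" if "B \<in> P" "C \<in> P" "B \<noteq> C" for B C
    using that P unfolding partition_on_def disjoint_def by blast
  have sub: "C \<subseteq> B \<and> C \<noteq> {}" if "B \<in> P" "C \<in> h B" for B C
    using h[OF that(1)] that(2) by (auto simp: hierarchy_on_def)
  have inP: "B \<in> h B" if "B \<in> P" for B using h[OF that] by (auto simp: hierarchy_on_def)
  have U: "\<Union>P = A" using P by (auto simp: partition_on_def)
  have ne: "B \<noteq> {}" if "B \<in> P" for B using P that by (auto simp: partition_on_def)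
  have psub: "B \<subset> A" if "B \<in> P" for B
    by (rule partition_block_psubset[OF P that])
  have Ane: "A \<noteq> {}"
  proof -
    have "P \<noteq> {}" using P(2) by auto
    then show ?thesis using psub by blast
  qed
  have lam: "B \<subseteq> C \<or> C \<subseteq> B \<or> B \<inter> C = {}" if B: "B \<in> H" and C: "C \<in> H" for B C
  proof (cases "B = A \<or> C = A")
    case True
    then show ?thesis using B C sub U unfolding H_def by blast
  next
    case False
    then obtain B' C' where BC: "B' \<in> P" "B \<in> h B'" "C' \<in> P" "C \<in> h C'"
      using B C unfolding H_def by blast
    show ?thesis
    proof (cases "B' = C'")
      case True
      then show ?thesis using hierarchy_onD(5)[OF h[OF BC(1)]] BC by blast
    next
      case False
      then show ?thesis using BC sub disj by blast
    qed
  qed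
  show "hierarchy_on A H" unfolding hierarchy_on_def
  proof (intro conjI ballI)
    show "A \<in> H" by (simp add: H_def)
    show "B \<subseteq> A" "B \<noteq> {}" if "B \<in> H" for B using that sub U Ane unfolding H_def by blast+
    show "{a} \<in> H" if "a \<in> A" for a
      using that U hierarchy_onD(4)[OF h] unfolding H_def by blast
  qed (use lam in blast)
  show bel: "below H B = h B" if B: "B \<in> P" for B
  proof
    show "h B \<subseteq> below H B" using B sub unfolding below_def H_def by blast
    show "below H B \<subseteq> h B"
    proof
      fix C assume "C \<in> below H B"
      then have C: "C \<in> H" "C \<subseteq> B" by (auto simp: below_def)
      then have "C \<noteq> A" using psub[OF B] by blast
      then obtain D where D: "D \<in> P" "C \<in> h D" using C unfolding H_def by blast
      then have "D = B" using sub[OF D] C B disj by blast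
      then show "C \<in> h B" using D by simp
    qed
  qed
  show "subblocks H A = P"
  proof
    show "P \<subseteq> subblocks H A"
    proof
      fix B assume B: "B \<in> P"
      have "\<not> (\<exists>D\<in>H. B \<subset> D \<and> D \<subset> A)"
      proof
        assume "\<exists>D\<in>H. B \<subset> D \<and> D \<subset> A"
        then obtain D where D: "D \<in> H" "B \<subset> D" "D \<subset> A" by blast
        then obtain E where E: "E \<in> P" "D \<in> h E" unfolding H_def by blast
        then have "B \<subset> E" using sub D by blast
        then show False using disj[OF B E(1)] ne[OF B] by blast
      qed
      then show "B \<in> subblocks H A" using psub[OF B] inP[OF B] B by (auto simp: subblocks_def H_def)
    qed
    show "subblocks H A \<subseteq> P"
    proof
      fix C assume C: "C \<in> subblocks H A"
      then obtain D where D: "D \<in> P" "C \<in> h D" unfolding subblocks_def H_def by blast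
      then have "C \<subseteq> D" "D \<in> H" "D \<subset> A" using sub[OF D] inP[OF D(1)] psub[OF D(1)] by (simp_all add: H_def, blast)
      then have "C = D" using C unfolding subblocks_def by blast
      then show "C \<in> P" using D by simp
    qed
  qed
qed

lemma hierarchy_weight_decompose:
  assumes "finite A" "hierarchy_on A H" "2 \<le> card A"
  shows "hierarchy_weight g H =
    g (card (subblocks H A)) (card A) * (\<Prod>B\<in>subblocks H A. hierarchy_weight g (below H B))"
proof -
  have P: "partition_on A (subblocks H A)"
    by (rule partition_on_subblocks[OF assms(1,2) hierarchy_onD(1)[OF assms(2)] assms(3)])
  have fH: "finite H" by (rule finite_hierarchy[OF assms(1,2)])
  then have fk: "finite (subblocks H A)" by (simp add: subblocks_def)
  let ?g = "\<lambda>B. g (card (subblocks H B)) (card B)"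
  let ?S = "\<lambda>B. {C \<in> below H B. 2 \<le> card C}"
  have disj: "B \<inter> C = {}" if "B \<in> subblocks H A" "C \<in> subblocks H A" "B \<noteq> C" for B C
    using that P unfolding partition_on_def disjoint_def by blast
  have eq: "{B \<in> H. 2 \<le> card B} = insert A (\<Union>B\<in>subblocks H A. ?S B)"
    using assms(3) by (subst hierarchy_decompose[OF assms(1,2)]) auto
  have "A \<notin> (\<Union>B\<in>subblocks H A. ?S B)" by (auto simp: subblocks_def below_def)
  moreover have fS: "finite (?S B)" for B using fH by (simp add: below_def)
  ultimately have "hierarchy_weight g H = ?g A * prod ?g (\<Union>B\<in>subblocks H A. ?S B)"
    unfolding hierarchy_weight_def eq using fk by (subst prod.insert) auto
  also have "prod ?g (\<Union>B\<in>subblocks H A. ?S B) = (\<Prod>B\<in>subblocks H A. prod ?g (?S B))"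
  proof (rule prod.UNION_disjoint[OF fk])
    show "\<forall>B\<in>subblocks H A. finite (?S B)" using fS by blast
    show "\<forall>B\<in>subblocks H A. \<forall>C\<in>subblocks H A. B \<noteq> C \<longrightarrow> ?S B \<inter> ?S C = {}"
    proof (intro ballI impI)
      fix B C assume BC: "B \<in> subblocks H A" "C \<in> subblocks H A" "B \<noteq> C"
      show "?S B \<inter> ?S C = {}"
      proof (rule ccontr)
        assume "?S B \<inter> ?S C \<noteq> {}"
        then obtain D where D: "D \<subseteq> B" "D \<subseteq> C" "D \<in> H" by (auto simp: below_def)
        then have "D = {}" using disj[OF BC] by blast
        then show False using D(3) assms(2) by (auto simp: hierarchy_on_def)
      qed
    qed
  qed
  also have "\<dots> = (\<Prod>B\<in>subblocks H A. hierarchy_weight g (below H B))"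
    unfolding hierarchy_weight_def
    by (intro prod.cong refl) (auto simp: below_def subblocks_below[unfolded below_def])
  finally show ?thesis .
qed

text \<open>
  The root of a hierarchy contributes the factor for \<open>A\<close>; the rest is an independent choice of a
  hierarchy on each block of the top partition, so the sum over these choices is a product of sums.
\<close>

lemma hierarchy_sum_rec:
  assumes A: "finite A" "2 \<le> card A"
  shows "hierarchy_sum g A =
    (\<Sum>P | partition_on A P \<and> 2 \<le> card P. g (card P) (card A) * (\<Prod>B\<in>P. hierarchy_sum g B))"
proof -
  let ?Ps = "{P. partition_on A P \<and> 2 \<le> card P}"
  let ?Hs = "\<lambda>P. PiE P (\<lambda>B. {H. hierarchy_on B H})"
  have fP: "finite ?Ps" using finitely_many_partition_on[OF A(1)] by (rule rev_finite_subset) auto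
  have finB: "finite B" if "partition_on A P" "B \<in> P" for B P
    using that A(1) by (metis Union_upper finite_subset partition_onD1)
  have finP: "finite P" if "partition_on A P" for P
    using that A(1) by (metis finite_UnionD partition_onD1)
  have "(\<Sum>P\<in>?Ps. g (card P) (card A) * (\<Prod>B\<in>P. hierarchy_sum g B)) =
        (\<Sum>P\<in>?Ps. \<Sum>h\<in>?Hs P. g (card P) (card A) * (\<Prod>B\<in>P. hierarchy_weight g (h B)))"
  proof (rule sum.cong[OF refl])
    fix P assume P: "P \<in> ?Ps"
    have "(\<Prod>B\<in>P. hierarchy_sum g B) = (\<Sum>h\<in>?Hs P. \<Prod>B\<in>P. hierarchy_weight g (h B))"
      unfolding hierarchy_sum_def
      by (rule prod_sum_PiE) (use P finP finB finite_hierarchies in auto)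
    then show "g (card P) (card A) * (\<Prod>B\<in>P. hierarchy_sum g B) =
        (\<Sum>h\<in>?Hs P. g (card P) (card A) * (\<Prod>B\<in>P. hierarchy_weight g (h B)))"
      by (simp add: sum_distrib_left)
  qed
  also have "\<dots> = (\<Sum>(P, h)\<in>Sigma ?Ps ?Hs.
      g (card P) (card A) * (\<Prod>B\<in>P. hierarchy_weight g (h B)))"
    by (rule sum.Sigma[OF fP]) (auto intro!: finite_PiE finP finite_hierarchies finB)
  also have "\<dots> = hierarchy_sum g A" unfolding hierarchy_sum_def
  proof (rule sum.reindex_bij_witness
      [where i = "\<lambda>H. (subblocks H A, \<lambda>B\<in>subblocks H A. below H B)" and j = "\<lambda>(P, h). insert A (\<Union>B\<in>P. h B)"])
    fix X assume "X \<in> Sigma ?Ps ?Hs"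
    then obtain P h where X: "X = (P, h)" and P: "partition_on A P" "2 \<le> card P" and h: "h \<in> ?Hs P"
      by auto
    have h': "hierarchy_on B (h B)" if "B \<in> P" for B using h that by (auto simp: PiE_iff)
    note c = hierarchy_compose[OF P h']
    have r: "(\<lambda>B\<in>P. below (insert A (\<Union>B\<in>P. h B)) B) = h"
      using h c(3) by (intro PiE_ext[OF _ h]) auto
    show "(subblocks (case X of (P, h) \<Rightarrow> insert A (\<Union>B\<in>P. h B)) A,
      \<lambda>B\<in>subblocks (case X of (P, h) \<Rightarrow> insert A (\<Union>B\<in>P. h B)) A. 
         below (case X of (P, h) \<Rightarrow> insert A (\<Union>B\<in>P. h B)) B) = X"
      using r c(2) by (simp add: X)
    show "(case X of (P, h) \<Rightarrow> insert A (\<Union>B\<in>P. h B)) \<in> {H. hierarchy_on A H}"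
      using c(1) by (simp add: X)
    show "hierarchy_weight g (case X of (P, h) \<Rightarrow> insert A (\<Union>B\<in>P. h B)) = 
       (case X of (P, h) \<Rightarrow> g (card P) (card A) * (\<Prod>B\<in>P. hierarchy_weight g (h B)))"
      using hierarchy_weight_decompose[OF A(1) c(1) A(2), of g] by (simp add: X c(2,3))
  next
    fix H assume "H \<in> {H. hierarchy_on A H}"
    then have H: "hierarchy_on A H" by simp
    show "(case (subblocks H A, \<lambda>B\<in>subblocks H A. below H B) of (P, h) \<Rightarrow> insert A (\<Union>B\<in>P. h B)) = H"
      using hierarchy_decompose[OF A(1) H] by simp
    show "(subblocks H A, \<lambda>B\<in>subblocks H A. below H B) \<in> Sigma ?Ps ?Hs"
      using partition_on_subblocks[OF A(1) H _ A(2)] card_subblocks[OF A(1) H _ A(2)] hierarchy_onD(1)[OF H]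
        hierarchy_below[OF H] by (auto simp: subblocks_def)
  qed
  finally show ?thesis by simp
qed

lemma hierarchy_sum_singleton: "hierarchy_sum g {a} = 1"
proof -
  have "H = {{a}}" if H: "hierarchy_on {a} H" for H
  proof -
    have "B = {a}" if "B \<in> H" for B
      using hierarchy_onD(2,3)[OF H that] by (auto simp: subset_singleton_iff)
    then show ?thesis using hierarchy_onD(1)[OF H] by blast
  qed
  moreover have "hierarchy_on {a} {{a}}" by (simp add: hierarchy_on_def)
  ultimately have "{H. hierarchy_on {a} H} = {{{a}}}" by blast
  moreover have "hierarchy_weight g {{a}} = 1"
  proof -
    have empty: "{B \<in> {{a}}. 2 \<le> card B} = {}" by auto
    show ?thesis unfolding hierarchy_weight_def empty by simp
  qed
  ultimately show ?thesis by (simp add: hierarchy_sum_def)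
qed



section \<open>Sorting indices by their first digit\<close>

definition block_of :: "'i set set \<Rightarrow> 'i \<Rightarrow> 'i set" where
  "block_of P i = (THE B. B \<in> P \<and> i \<in> B)"

definition fibres :: "'i set \<Rightarrow> ('i \<Rightarrow> 'd) \<Rightarrow> 'i set set" where
  "fibres A c = (\<lambda>d. {i \<in> A. c i = d}) ` (c ` A)"

lemma block_of_eq:
  assumes "partition_on A P" "B \<in> P" "i \<in> B"
  shows "block_of P i = B"
  unfolding block_of_def
proof (rule the_equality)
  show "B \<in> P \<and> i \<in> B" using assms by simp
  show "C = B" if "C \<in> P \<and> i \<in> C" for C
    using partition_onD2[OF assms(1)] that assms(2,3) by (auto dest: disjointD)
qed

lemma block_of_mem:
  assumes "partition_on A P" "i \<in> A"
  shows "block_of P i \<in> P" "i \<in> block_of P i"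
proof -
  obtain B where B: "B \<in> P" "i \<in> B" using assms by (auto simp: partition_on_def)
  then show "block_of P i \<in> P" "i \<in> block_of P i" using block_of_eq[OF assms(1) B] by auto
qed

lemma finite_partition:
  assumes "finite A" "partition_on A P"
  shows "finite P" "\<And>B. B \<in> P \<Longrightarrow> finite B"
  using assms partition_onD1[OF assms(2)] by (auto intro: finite_UnionD finite_subset)

lemma partition_on_fibres: "partition_on A (fibres A c)"
  by (rule partition_onI) (auto simp: fibres_def disjnt_def)

text \<open>
  A function on \<open>A\<close> is a family of functions on the blocks of \<open>P\<close>, so a sum of products of terms that
  each see one block only factorizes.
\<close>

lemma sum_PiE_partition:
  fixes \<Phi> :: "'i set \<Rightarrow> ('i \<Rightarrow> 'w) \<Rightarrow> 'b::comm_semiring_1"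
  assumes A: "finite A" and P: "partition_on A P" and W: "finite W"
    and \<Phi>: "\<And>B v. B \<in> P \<Longrightarrow> \<Phi> B (restrict v B) = \<Phi> B v"
  shows "(\<Sum>v\<in>PiE A (\<lambda>_. W). \<Prod>B\<in>P. \<Phi> B v) = (\<Prod>B\<in>P. \<Sum>v\<in>PiE B (\<lambda>_. W). \<Phi> B v)"
proof -
  note fP = finite_partition[OF A P]
  have U: "\<Union>P = A" using P by (simp add: partition_on_def)
  have "(\<Prod>B\<in>P. \<Sum>v\<in>PiE B (\<lambda>_. W). \<Phi> B v) =
      (\<Sum>h\<in>PiE P (\<lambda>B. PiE B (\<lambda>_. W)). \<Prod>B\<in>P. \<Phi> B (h B))"
    by (rule prod_sum_PiE) (use fP W in \<open>auto intro: finite_PiE\<close>)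
  also have "\<dots> = (\<Sum>v\<in>PiE A (\<lambda>_. W). \<Prod>B\<in>P. \<Phi> B v)"
  proof (rule sum.reindex_bij_witness[where j = "\<lambda>h. \<lambda>i\<in>A. h (block_of P i) i"
        and i = "\<lambda>v. \<lambda>B\<in>P. restrict v B"])
    fix h assume h: "h \<in> PiE P (\<lambda>B. PiE B (\<lambda>_. W))"
    have r: "restrict (\<lambda>i\<in>A. h (block_of P i) i) B = h B" if B: "B \<in> P" for B
    proof
      fix i
      have "h B \<in> PiE B (\<lambda>_. W)" using h B by auto
      then show "restrict (\<lambda>i\<in>A. h (block_of P i) i) B i = h B i"
      proof (cases "i \<in> B")
        case True
        then have "i \<in> A" using B U by blast
        then show ?thesis by (simp add: True block_of_eq[OF P B True])
      next
        case False
        then show ?thesis using PiE_arb[OF \<open>h B \<in> PiE B (\<lambda>_. W)\<close> False] by simp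
      qed
    qed
    have v': "restrict (\<lambda>i\<in>A. h (block_of P i) i) B \<in> PiE B (\<lambda>_. W)" if "B \<in> P" for B
      unfolding r[OF that] using h that by auto
    show "(\<lambda>B\<in>P. restrict (\<lambda>i\<in>A. h (block_of P i) i) B) = h"
    proof (rule PiE_ext[OF _ h])
      show "(\<lambda>B\<in>P. restrict (\<lambda>i\<in>A. h (block_of P i) i) B) \<in> PiE P (\<lambda>B. PiE B (\<lambda>_. W))"
        by (rule restrict_PiE_iff[THEN iffD2]) (use v' in blast)
      show "(\<lambda>B\<in>P. restrict (\<lambda>i\<in>A. h (block_of P i) i) B) B = h B" if "B \<in> P" for B
        using r[OF that] that by (simp only: restrict_apply if_True)
    qed
    show "(\<lambda>i\<in>A. h (block_of P i) i) \<in> PiE A (\<lambda>_. W)"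
    proof (rule restrict_PiE_iff[THEN iffD2], rule ballI)
      fix i assume "i \<in> A"
      then show "h (block_of P i) i \<in> W"
        using h block_of_mem[OF P \<open>i \<in> A\<close>] by (simp add: PiE_iff)
    qed
    show "(\<Prod>B\<in>P. \<Phi> B (\<lambda>i\<in>A. h (block_of P i) i)) = (\<Prod>B\<in>P. \<Phi> B (h B))"
    proof (rule prod.cong[OF refl])
      fix B assume B: "B \<in> P"
      show "\<Phi> B (\<lambda>i\<in>A. h (block_of P i) i) = \<Phi> B (h B)"
        using \<Phi>[OF B, of "\<lambda>i\<in>A. h (block_of P i) i"] r[OF B] by simp
    qed
  next
    fix v assume v: "v \<in> PiE A (\<lambda>_. W)"
    show "(\<lambda>B\<in>P. restrict v B) \<in> PiE P (\<lambda>B. PiE B (\<lambda>_. W))"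
      using v U by (auto simp: PiE_iff)
    show "(\<lambda>i\<in>A. (\<lambda>B\<in>P. restrict v B) (block_of P i) i) = v"
    proof (rule PiE_ext[OF _ v])
      show "(\<lambda>i\<in>A. (\<lambda>B\<in>P. restrict v B) (block_of P i) i) \<in> PiE A (\<lambda>_. W)"
        using v by (simp add: PiE_iff block_of_mem[OF P])
    qed (simp add: block_of_mem[OF P])
  qed
  finally show ?thesis by simp
qed

text \<open>
  A function with set of fibres \<open>P\<close> is an injective assignment of values to the blocks of \<open>P\<close>.
\<close>

lemma card_fibres:
  assumes A: "finite A" and P: "partition_on A P" and D: "finite D"
  shows "card {c \<in> PiE A (\<lambda>_. D). fibres A c = P} = (\<Prod>i<card P. card D - i)"
proof -
  note fP = finite_partition[OF A P]
  have U: "\<Union>P = A" and ne: "\<And>B. B \<in> P \<Longrightarrow> B \<noteq> {}" using P by (auto simp: partition_on_def)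
  \<comment> \<open>any point of a block recovers the value that the function takes on that block\<close>
  define pt where "pt B = (SOME i. i \<in> B)" for B :: "'a set"
  have pt: "pt B \<in> B" if "B \<in> P" for B using ne[OF that] unfolding pt_def by (simp add: some_in_eq)
  have bij: "bij_betw (\<lambda>g. \<lambda>i\<in>A. g (block_of P i)) {g \<in> PiE P (\<lambda>_. D). inj_on g P}
     {c \<in> PiE A (\<lambda>_. D). fibres A c = P}"
  proof (rule bij_betwI[where g = "\<lambda>c. \<lambda>B\<in>P. c (pt B)"])
    show "(\<lambda>g. \<lambda>i\<in>A. g (block_of P i)) \<in> {g \<in> PiE P (\<lambda>_. D). inj_on g P} \<rightarrow>
      {c \<in> PiE A (\<lambda>_. D). fibres A c = P}"
    proof
      fix g assume "g \<in> {g \<in> PiE P (\<lambda>_. D). inj_on g P}"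
      then have g: "g \<in> PiE P (\<lambda>_. D)" "inj_on g P" by auto
      have fib: "{i \<in> A. g (block_of P i) = g B} = B" if B: "B \<in> P" for B
      proof -
        have "i \<in> B" if i: "i \<in> A" "g (block_of P i) = g B" for i
          using inj_onD[OF g(2) i(2) block_of_mem(1)[OF P i(1)] B] block_of_mem(2)[OF P i(1)] by simp
        moreover have "i \<in> A \<and> g (block_of P i) = g B" if "i \<in> B" for i
          using block_of_eq[OF P B that] that B U by auto
        ultimately show ?thesis by blast
      qed
      have im: "(\<lambda>i\<in>A. g (block_of P i)) ` A = g ` P"
      proof -
        have "block_of P ` A = P"
          using block_of_mem[OF P] block_of_eq[OF P] U ne by (auto simp: image_iff) (metis UnionI ex_in_conv)
        then have "g ` P = g ` block_of P ` A" by simp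
        then show ?thesis by (simp add: image_image)
      qed
      have "fibres A (\<lambda>i\<in>A. g (block_of P i)) = (\<lambda>d. {i \<in> A. g (block_of P i) = d}) ` (g ` P)"
        unfolding fibres_def im by (intro image_cong refl) auto
      also have "\<dots> = P" using fib by (simp add: image_image)
      finally show "(\<lambda>i\<in>A. g (block_of P i)) \<in> {c \<in> PiE A (\<lambda>_. D). fibres A c = P}"
        using g(1) block_of_mem[OF P] by (auto simp: PiE_iff)
    qed
    have const: "c (pt B) = c i" if c: "fibres A c = P" and B: "B \<in> P" "i \<in> B" for c :: "'a \<Rightarrow> 'b" and B i
      using pt[OF B(1)] B c by (auto simp: fibres_def)
    show "(\<lambda>c. \<lambda>B\<in>P. c (pt B)) \<in> {c \<in> PiE A (\<lambda>_. D). fibres A c = P} \<rightarrow>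
      {g \<in> PiE P (\<lambda>_. D). inj_on g P}"
    proof
      fix c assume "c \<in> {c \<in> PiE A (\<lambda>_. D). fibres A c = P}"
      then have c: "c \<in> PiE A (\<lambda>_. D)" "fibres A c = P" by auto
      have "inj_on (\<lambda>B\<in>P. c (pt B)) P"
      proof (rule inj_onI)
        fix B C assume BC: "B \<in> P" "C \<in> P" and eq: "(\<lambda>B\<in>P. c (pt B)) B = (\<lambda>B\<in>P. c (pt B)) C"
        then have "c (pt B) = c (pt C)" by simp
        moreover obtain d e where "B = {i \<in> A. c i = d}" "C = {i \<in> A. c i = e}"
          using BC c(2) by (auto simp: fibres_def)
        moreover have "c (pt B) = d" "c (pt C) = e"
          using pt[OF BC(1)] pt[OF BC(2)] calculation(2,3) by auto
        ultimately show "B = C" by simp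
      qed
      then show "(\<lambda>B\<in>P. c (pt B)) \<in> {g \<in> PiE P (\<lambda>_. D). inj_on g P}"
        using c(1) pt U by (auto simp: PiE_iff)
    qed
    show "(\<lambda>B\<in>P. (\<lambda>i\<in>A. g (block_of P i)) (pt B)) = g"
      if "g \<in> {g \<in> PiE P (\<lambda>_. D). inj_on g P}" for g
    proof (rule PiE_ext)
      show g: "g \<in> PiE P (\<lambda>_. D)" using that by simp
      show "(\<lambda>B\<in>P. (\<lambda>i\<in>A. g (block_of P i)) (pt B)) \<in> PiE P (\<lambda>_. D)"
        using g pt U block_of_mem[OF P] by (auto simp: PiE_iff)
      show "(\<lambda>B\<in>P. (\<lambda>i\<in>A. g (block_of P i)) (pt B)) B = g B" if B: "B \<in> P" for B
        using B pt[OF B] block_of_eq[OF P B pt[OF B]] U by auto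
    qed
    show "(\<lambda>i\<in>A. (\<lambda>B\<in>P. c (pt B)) (block_of P i)) = c"
      if "c \<in> {c \<in> PiE A (\<lambda>_. D). fibres A c = P}" for c
    proof (rule PiE_ext)
      show c: "c \<in> PiE A (\<lambda>_. D)" using that by simp
      show "(\<lambda>i\<in>A. (\<lambda>B\<in>P. c (pt B)) (block_of P i)) \<in> PiE A (\<lambda>_. D)"
      proof (rule restrict_PiE_iff[THEN iffD2], rule ballI)
        fix i assume "i \<in> A"
        note b = block_of_mem(1)[OF P this]
        have "pt (block_of P i) \<in> A" using pt[OF b] b U by blast
        then show "(\<lambda>B\<in>P. c (pt B)) (block_of P i) \<in> D" using b c by (simp add: PiE_iff)
      qed
      show "(\<lambda>i\<in>A. (\<lambda>B\<in>P. c (pt B)) (block_of P i)) i = c i" if i: "i \<in> A" for i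
        using i block_of_mem[OF P i] const \<open>c \<in> {c \<in> PiE A (\<lambda>_. D). fibres A c = P}\<close> by auto
    qed
  qed
  have "card {c \<in> PiE A (\<lambda>_. D). fibres A c = P} = card {g \<in> PiE P (\<lambda>_. D). inj_on g P}"
    by (rule bij_betw_same_card[OF bij, symmetric])
  also have "\<dots> = (\<Prod>i<card P. card D - i)"
    using card_inj_on_subset_funcset[of P D P] fP(1) D by (simp add: atLeast0LessThan)
  finally show ?thesis .
qed

definition pairs :: "'i::linorder set \<Rightarrow> ('i \<times> 'i) set" where
  "pairs A = {(i, j). i \<in> A \<and> j \<in> A \<and> i < j}"

lemma finite_pairs: "finite A \<Longrightarrow> finite (pairs A)"
  by (rule finite_subset[of _ "A \<times> A"]) (auto simp: pairs_def)

lemma card_pairs: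
  assumes "finite A"
  shows "card (pairs A) = card A choose 2"
proof -
  have "bij_betw (\<lambda>(i, j). {i, j}) (pairs A) {B. B \<subseteq> A \<and> card B = 2}"
  proof (rule bij_betw_imageI)
    show "inj_on (\<lambda>(i, j). {i, j}) (pairs A)"
      by (auto simp: inj_on_def pairs_def doubleton_eq_iff)
    show "(\<lambda>(i, j). {i, j}) ` pairs A = {B. B \<subseteq> A \<and> card B = 2}"
    proof
      show "(\<lambda>(i, j). {i, j}) ` pairs A \<subseteq> {B. B \<subseteq> A \<and> card B = 2}" by (auto simp: pairs_def)
      show "{B. B \<subseteq> A \<and> card B = 2} \<subseteq> (\<lambda>(i, j). {i, j}) ` pairs A"
      proof
        fix B assume "B \<in> {B. B \<subseteq> A \<and> card B = 2}"
        then obtain i j where ij: "B = {i, j}" "i \<noteq> j" "i \<in> A" "j \<in> A"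
          by (auto simp: card_2_iff)
        then have "(i, j) \<in> pairs A \<or> (j, i) \<in> pairs A" by (auto simp: pairs_def)
        then show "B \<in> (\<lambda>(i, j). {i, j}) ` pairs A"
          using ij(1) by (force simp: insert_commute)
      qed
    qed
  qed
  then show ?thesis using n_subsets[OF assms, of 2] by (simp add: bij_betw_same_card)
qed

section \<open>Averages over tuples of words\<close>

text \<open>
  \<open>u\<close> to the length of the longest common prefix for words of equal length that differ at some
  position, and 0 for equal words. The value 0 mirrors the integrand, which vanishes where two coordinates coincide.
\<close>

fun word_dist :: "'b::comm_ring_1 \<Rightarrow> 'd list \<Rightarrow> 'd list \<Rightarrow> 'b" where
  "word_dist u (a # v) (b # w) = (if a = b then u * word_dist u v w else 1)"
| "word_dist u _ _ = 0"

definition words :: "'d set \<Rightarrow> nat \<Rightarrow> 'd list set" where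
  "words D N = {w. set w \<subseteq> D \<and> length w = N}"

lemma finite_words: "finite D \<Longrightarrow> finite (words D N)"
  unfolding words_def by (rule finite_lists_length_eq)

lemma card_words: "finite D \<Longrightarrow> card (words D N) = card D ^ N"
  unfolding words_def by (rule card_lists_length_eq)

definition word_sum :: "'d set \<Rightarrow> complex \<Rightarrow> nat \<Rightarrow> 'i::linorder set \<Rightarrow> complex" where
  "word_sum D u N A =
     (\<Sum>w\<in>PiE A (\<lambda>_. words D N). \<Prod>(i, j)\<in>pairs A. word_dist u (w i) (w j))"

lemma prod_pairs_fibres:
  fixes F :: "'i::linorder \<Rightarrow> 'i \<Rightarrow> 'b::comm_monoid_mult"
  assumes A: "finite A"
  shows "(\<Prod>(i, j)\<in>pairs A. if c i = c j then F i j else 1) =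
    (\<Prod>B\<in>fibres A c. \<Prod>(i, j)\<in>pairs B. F i j)"
proof -
  note P = partition_on_fibres[of A c]
  note fP = finite_partition[OF A P]
  have "(\<Prod>(i, j)\<in>pairs A. if c i = c j then F i j else 1) =
      (\<Prod>x\<in>pairs A. if c (fst x) = c (snd x) then F (fst x) (snd x) else 1)"
    by (simp add: case_prod_beta)
  also have "\<dots> = (\<Prod>x\<in>{x \<in> pairs A. c (fst x) = c (snd x)}. F (fst x) (snd x))"
    by (rule prod.inter_filter[symmetric]) (rule finite_pairs[OF A])
  also have "{x \<in> pairs A. c (fst x) = c (snd x)} = (\<Union>B\<in>fibres A c. pairs B)"
    by (auto simp: pairs_def fibres_def)
  also have "(\<Prod>x\<in>(\<Union>B\<in>fibres A c. pairs B). F (fst x) (snd x)) =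
      (\<Prod>B\<in>fibres A c. \<Prod>x\<in>pairs B. F (fst x) (snd x))"
  proof (rule prod.UNION_disjoint[OF fP(1)])
    show "\<forall>B\<in>fibres A c. finite (pairs B)" using fP(2) finite_pairs by blast
    show "\<forall>B\<in>fibres A c. \<forall>C\<in>fibres A c. B \<noteq> C \<longrightarrow> pairs B \<inter> pairs C = {}"
      by (auto simp: fibres_def pairs_def)
  qed
  finally show ?thesis by (simp add: case_prod_beta)
qed

lemma sum_words_Suc:
  "(\<Sum>w\<in>PiE A (\<lambda>_. words D (Suc N)). F w) =
   (\<Sum>c\<in>PiE A (\<lambda>_. D). \<Sum>v\<in>PiE A (\<lambda>_. words D N). F (\<lambda>i\<in>A. c i # v i))"
proof -
  have "(\<Sum>w\<in>PiE A (\<lambda>_. words D (Suc N)). F w) =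
     (\<Sum>(c, v)\<in>PiE A (\<lambda>_. D) \<times> PiE A (\<lambda>_. words D N). F (\<lambda>i\<in>A. c i # v i))"
  proof (rule sum.reindex_bij_witness[where i = "\<lambda>(c, v). \<lambda>i\<in>A. c i # v i"
        and j = "\<lambda>w. (\<lambda>i\<in>A. hd (w i), \<lambda>i\<in>A. tl (w i))"])
    fix w assume w: "w \<in> PiE A (\<lambda>_. words D (Suc N))"
    have ex: "\<exists>a v. w i = a # v \<and> a \<in> D \<and> v \<in> words D N" if "i \<in> A" for i
    proof -
      have "w i \<in> words D (Suc N)" using w that by auto
      then show ?thesis by (cases "w i") (auto simp: words_def)
    qed
    then have hd: "hd (w i) \<in> D \<and> tl (w i) \<in> words D N \<and> hd (w i) # tl (w i) = w i" if "i \<in> A" for i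
      using that by fastforce
    show r: "(case (\<lambda>i\<in>A. hd (w i), \<lambda>i\<in>A. tl (w i)) of (c, v) \<Rightarrow> \<lambda>i\<in>A. c i # v i) = w"
      by (rule PiE_ext[OF _ w]) (use hd w in auto)
    show "(\<lambda>i\<in>A. hd (w i), \<lambda>i\<in>A. tl (w i)) \<in> PiE A (\<lambda>_. D) \<times> PiE A (\<lambda>_. words D N)"
      using hd by auto
    show "(case (\<lambda>i\<in>A. hd (w i), \<lambda>i\<in>A. tl (w i)) of (c, v) \<Rightarrow> F (\<lambda>i\<in>A. c i # v i)) = F w"
      using r by simp
  next
    fix x assume x: "x \<in> PiE A (\<lambda>_. D) \<times> PiE A (\<lambda>_. words D N)"
    then obtain c v where cv: "x = (c, v)" "c \<in> PiE A (\<lambda>_. D)" "v \<in> PiE A (\<lambda>_. words D N)" by auto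
    have "restrict c A = c" "restrict v A = v" using cv(2,3) by (auto simp: PiE_restrict)
    then show "(\<lambda>i\<in>A. hd ((case x of (c, v) \<Rightarrow> \<lambda>i\<in>A. c i # v i) i),
        \<lambda>i\<in>A. tl ((case x of (c, v) \<Rightarrow> \<lambda>i\<in>A. c i # v i) i)) = x"
      by (simp add: cv(1) cong: restrict_cong)
    show "(case x of (c, v) \<Rightarrow> \<lambda>i\<in>A. c i # v i) \<in> PiE A (\<lambda>_. words D (Suc N))"
      using cv by (auto simp: words_def PiE_iff)
  qed
  then show ?thesis by (simp add: sum.cartesian_product)
qed

text \<open>
  Split every word into its first letter and its tail. Only pairs with equal first letters see the
  tails, so for fixed first letters the sum factorizes over the fibres of the first letter; then the
  first letters are grouped by the partition that they induce.
\<close>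

lemma word_sum_Suc:
  assumes A: "finite A" and D: "finite D"
  shows "word_sum D u (Suc N) A =
    (\<Sum>P | partition_on A P. of_nat (\<Prod>i<card P. card D - i) *
       (\<Prod>B\<in>P. u ^ (card B choose 2) * word_sum D u N B))"
proof -
  let ?\<Phi> = "\<lambda>B v. u ^ (card B choose 2) * (\<Prod>(i, j)\<in>pairs B. word_dist u (v i) (v j))"
  let ?G = "\<lambda>P. \<Prod>B\<in>P. u ^ (card B choose 2) * word_sum D u N B"
  let ?Ps = "{P. partition_on A P}"
  have "(\<Sum>v\<in>PiE A (\<lambda>_. words D N). \<Prod>(i, j)\<in>pairs A.
           word_dist u ((\<lambda>i\<in>A. c i # v i) i) ((\<lambda>i\<in>A. c i # v i) j)) = ?G (fibres A c)" for c
  proof -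
    note P = partition_on_fibres[of A c]
    note fP = finite_partition[OF A P]
    have "(\<Prod>(i, j)\<in>pairs A. word_dist u ((\<lambda>i\<in>A. c i # v i) i) ((\<lambda>i\<in>A. c i # v i) j)) =
      (\<Prod>B\<in>fibres A c. ?\<Phi> B v)" for v
    proof -
      have "(\<Prod>(i, j)\<in>pairs A. word_dist u ((\<lambda>i\<in>A. c i # v i) i) ((\<lambda>i\<in>A. c i # v i) j)) =
        (\<Prod>(i, j)\<in>pairs A. if c i = c j then u * word_dist u (v i) (v j) else 1)"
        by (rule prod.cong) (auto simp: pairs_def)
      also have "\<dots> = (\<Prod>B\<in>fibres A c. \<Prod>(i, j)\<in>pairs B. u * word_dist u (v i) (v j))"
        by (rule prod_pairs_fibres[OF A])
      also have "\<dots> = (\<Prod>B\<in>fibres A c. ?\<Phi> B v)"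
        by (intro prod.cong refl) (simp add: case_prod_beta prod.distrib card_pairs fP)
      finally show ?thesis .
    qed
    then have "(\<Sum>v\<in>PiE A (\<lambda>_. words D N). \<Prod>(i, j)\<in>pairs A.
           word_dist u ((\<lambda>i\<in>A. c i # v i) i) ((\<lambda>i\<in>A. c i # v i) j)) =
        (\<Sum>v\<in>PiE A (\<lambda>_. words D N). \<Prod>B\<in>fibres A c. ?\<Phi> B v)" by simp
    also have "\<dots> = (\<Prod>B\<in>fibres A c. \<Sum>v\<in>PiE B (\<lambda>_. words D N). ?\<Phi> B v)"
    proof (rule sum_PiE_partition[OF A P finite_words[OF D]])
      show "?\<Phi> B (restrict v B) = ?\<Phi> B v" for B and v :: "'a \<Rightarrow> 'b list"
        by (intro arg_cong2[where f = "(*)"] refl prod.cong) (auto simp: pairs_def)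
    qed
    also have "\<dots> = ?G (fibres A c)" by (simp add: word_sum_def sum_distrib_left)
    finally show ?thesis .
  qed
  then have "word_sum D u (Suc N) A = (\<Sum>c\<in>PiE A (\<lambda>_. D). ?G (fibres A c))"
    unfolding word_sum_def by (subst sum_words_Suc) simp
  also have "\<dots> = (\<Sum>P\<in>?Ps. \<Sum>c\<in>{c \<in> PiE A (\<lambda>_. D). fibres A c = P}. ?G (fibres A c))"
    by (rule sum.group[symmetric])
      (use A D finitely_many_partition_on[OF A] partition_on_fibres in \<open>auto intro: finite_PiE\<close>)
  also have "\<dots> = (\<Sum>P\<in>?Ps. of_nat (\<Prod>i<card P. card D - i) * ?G P)"
  proof (rule sum.cong[OF refl])
    fix P assume "P \<in> ?Ps"
    then have "partition_on A P" by simp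
    then show "(\<Sum>c\<in>{c \<in> PiE A (\<lambda>_. D). fibres A c = P}. ?G (fibres A c)) =
        of_nat (\<Prod>i<card P. card D - i) * ?G P"
      using card_fibres[OF A _ D, of P] by (simp del: of_nat_prod)
  qed
  finally show ?thesis .
qed


text \<open>
  The probability that \<open>r\<close> independent uniformly distributed digits are pairwise distinct.
\<close>

definition distinct_prob :: "nat \<Rightarrow> nat \<Rightarrow> complex" where
  "distinct_prob q r = (\<Prod>i<r. 1 - of_nat i / of_nat q)"

text \<open>
  What a set of \<open>k\<close> indices contributes when all of them get the same digit: the probability
  \<open>1/q\<^bsup>k-1\<^esup>\<close> of this event, and one factor \<open>u\<close> for each pair.
\<close>

definition cluster_factor :: "nat \<Rightarrow> complex \<Rightarrow> nat \<Rightarrow> complex" where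
  "cluster_factor q u k = u ^ (k choose 2) / of_nat q ^ (k - 1)"

definition word_mean :: "'d set \<Rightarrow> complex \<Rightarrow> nat \<Rightarrow> 'i::linorder set \<Rightarrow> complex" where
  "word_mean D u N A = word_sum D u N A / of_nat (card D) ^ (N * card A)"

text \<open>
  The weight of a vertex with \<open>c\<close> children and \<open>k\<close> leaves below it. The geometric series
  \<open>t + t\<^sup>2 + \<dots> = t/(1 - t)\<close> runs over the number of further digits shared by the \<open>k\<close> leaves.
\<close>

definition node_factor :: "nat \<Rightarrow> complex \<Rightarrow> nat \<Rightarrow> nat \<Rightarrow> complex" where
  "node_factor q u c k = distinct_prob q c * (cluster_factor q u k / (1 - cluster_factor q u k))"

lemma of_nat_falling_factorial:
  "of_nat (\<Prod>i<r. q - i) = (\<Prod>i<r. of_nat q - of_nat i :: complex)"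
proof (cases "r \<le> q")
  case True
  then show ?thesis unfolding of_nat_prod by (intro prod.cong refl) (auto simp: of_nat_diff)
next
  case False
  then have "(\<Prod>i<r. q - i) = 0" "(\<Prod>i<r. of_nat q - of_nat i :: complex) = 0"
    using prod_zero[of "{..<r}" "\<lambda>i. q - i"] prod_zero[of "{..<r}" "\<lambda>i. of_nat q - of_nat i :: complex"]
    by (auto simp: Bex_def intro: exI[of _ q])
  then show ?thesis by (simp only: of_nat_0)
qed

lemma distinct_prob_eq:
  assumes "q > 0"
  shows "of_nat (\<Prod>i<r. q - i) = of_nat q ^ r * distinct_prob q r"
proof -
  have "of_nat q ^ r * distinct_prob q r = (\<Prod>i<r. of_nat q * (1 - of_nat i / of_nat q))"
    by (simp add: distinct_prob_def prod.distrib)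
  also have "\<dots> = (\<Prod>i<r. of_nat q - of_nat i)"
    by (intro prod.cong refl) (use assms in \<open>simp add: field_simps\<close>)
  finally show ?thesis by (simp only: of_nat_falling_factorial)
qed

lemma card_partition_sum:
  assumes "finite A" "partition_on A P"
  shows "card A = (\<Sum>B\<in>P. card B)"
  using assms finite_partition[OF assms] card_Union_disjoint[of P]
  by (simp add: partition_on_def disjoint_def pairwise_def disjnt_def)

lemma word_mean_Suc:
  assumes A: "finite A" and D: "finite D" "D \<noteq> {}"
  shows "word_mean D u (Suc N) A =
    (\<Sum>P | partition_on A P. distinct_prob (card D) (card P) *
       (\<Prod>B\<in>P. cluster_factor (card D) u (card B) * word_mean D u N B))"
proof -
  define q where "q = card D"
  have q: "q > 0" using D by (simp add: q_def card_gt_0_iff)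
  have "of_nat (\<Prod>i<card P. q - i) * (\<Prod>B\<in>P. u ^ (card B choose 2) * word_sum D u N B) /
      of_nat q ^ (Suc N * card A) =
      distinct_prob q (card P) * (\<Prod>B\<in>P. cluster_factor q u (card B) * word_mean D u N B)"
    if P: "partition_on A P" for P
  proof -
    note fP = finite_partition[OF A P]
    have pos: "card B > 0" if "B \<in> P" for B
      using fP(2)[OF that] partition_onD3[OF P] that by (auto simp: card_gt_0_iff)
    have e: "cluster_factor q u (card B) * word_mean D u N B =
        of_nat q * (u ^ (card B choose 2) * word_sum D u N B) / of_nat q ^ (Suc N * card B)"
      if BP: "B \<in> P" for B
    proof -
      obtain k where k: "card B = Suc k" using pos[OF BP] by (cases "card B") auto
      show ?thesis using q
        by (simp add: cluster_factor_def word_mean_def k q_def[symmetric] power_add field_simps)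
    qed
    have "(\<Prod>B\<in>P. cluster_factor q u (card B) * word_mean D u N B) =
        (\<Prod>B\<in>P. of_nat q * (u ^ (card B choose 2) * word_sum D u N B) / of_nat q ^ (Suc N * card B))"
      by (rule prod.cong) (use e in auto)
    also have "\<dots> = of_nat q ^ card P * (\<Prod>B\<in>P. u ^ (card B choose 2) * word_sum D u N B) /
        (\<Prod>B\<in>P. of_nat q ^ (Suc N * card B))"
      by (simp only: prod_dividef prod.distrib prod_constant)
    also have "(\<Prod>B\<in>P. (of_nat q :: complex) ^ (Suc N * card B)) = of_nat q ^ (Suc N * card A)"
      by (simp only: card_partition_sum[OF A P] sum_distrib_left power_sum)
    finally show ?thesis
      by (simp only: distinct_prob_eq[OF q] times_divide_eq_right mult_ac)
  qed
  then show ?thesis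
    unfolding word_mean_def[of D u "Suc N" A] word_sum_Suc[OF A D(1)] sum_divide_distrib q_def[symmetric]
    by (intro sum.cong refl) auto
qed


lemma word_sum_singleton:
  assumes "finite D"
  shows "word_sum D u N {a} = of_nat (card D) ^ N"
proof -
  have "pairs {a} = {}" by (auto simp: pairs_def)
  moreover have "card (PiE {a} (\<lambda>_. words D N)) = card D ^ N"
    by (simp add: card_PiE card_words[OF assms])
  ultimately show ?thesis by (simp add: word_sum_def)
qed

text \<open>
  The limit has to be the fixed point \<open>L\<close> of \<open>x \<mapsto> t x + C\<close>. The error \<open>x\<^sub>n - L\<close> shrinks by the factor
  \<open>\<bar>t\<bar>\<close> in each step, up to a perturbation \<open>c\<^sub>n - C\<close> that tends to 0.
\<close>

lemma tendsto_affine_recursion: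
  fixes x c :: "nat \<Rightarrow> complex" and t :: complex
  assumes rec: "\<And>n. x (Suc n) = t * x n + c n" and t: "norm t < 1" and c: "c \<longlonglongrightarrow> C"
  shows "x \<longlonglongrightarrow> C / (1 - t)"
proof -
  define L where "L = C / (1 - t)"
  have "t \<noteq> 1" using t by auto
  then have L: "L = t * L + C" by (simp add: L_def field_simps)
  define r where "r = norm t"
  have r: "0 \<le> r" "r < 1" using t by (auto simp: r_def)
  have step: "norm (x (Suc n) - L) \<le> r * norm (x n - L) + norm (c n - C)" for n
  proof -
    have "x (Suc n) - L = t * (x n - L) + (c n - C)"
      using rec[of n] L by (simp add: algebra_simps)
    then show ?thesis by (metis norm_mult norm_triangle_ineq r_def)
  qed
  have "\<exists>n0. \<forall>n\<ge>n0. norm (x n - L) < e" if e: "e > 0" for e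
  proof -
    \<comment> \<open>perturbations below this bound add up to at most e/2 along the geometric series\<close>
    have "e / 2 * (1 - r) > 0" using e r by simp
    then obtain M where M: "\<And>n. n \<ge> M \<Longrightarrow> norm (c n - C) < e / 2 * (1 - r)"
      using LIMSEQ_D[OF c] by blast
    have bd: "norm (x (M + k) - L) \<le> r ^ k * norm (x M - L) + e / 2" for k
    proof (induction k)
      case 0
      then show ?case using e by simp
    next
      case (Suc k)
      have "norm (x (M + Suc k) - L) \<le> r * norm (x (M + k) - L) + norm (c (M + k) - C)"
        using step[of "M + k"] by simp
      also have "\<dots> \<le> r * (r ^ k * norm (x M - L) + e / 2) + e / 2 * (1 - r)"
        by (intro add_mono mult_left_mono Suc r) (use M[of "M + k"] in simp)
      also have "\<dots> = r ^ Suc k * norm (x M - L) + e / 2" by (simp add: field_simps)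
      finally show ?case .
    qed
    have "(\<lambda>k. r ^ k * norm (x M - L)) \<longlonglongrightarrow> 0 * norm (x M - L)"
      by (intro tendsto_intros LIMSEQ_realpow_zero r)
    then have "(\<lambda>k. r ^ k * norm (x M - L)) \<longlonglongrightarrow> 0" by simp
    then obtain K where K: "\<And>k. k \<ge> K \<Longrightarrow> norm (r ^ k * norm (x M - L) - 0) < e / 2"
      using LIMSEQ_D[of _ 0 "e / 2"] e by (meson half_gt_zero)
    have "norm (x n - L) < e" if n: "n \<ge> M + K" for n
    proof -
      have "norm (x n - L) \<le> r ^ (n - M) * norm (x M - L) + e / 2"
        using bd[of "n - M"] n by simp
      moreover have "r ^ (n - M) * norm (x M - L) < e / 2"
      proof (rule le_less_trans[OF abs_ge_self])
        show "\<bar>r ^ (n - M) * norm (x M - L)\<bar> < e / 2"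
          using K[of "n - M"] n unfolding real_norm_def diff_zero by linarith
      qed
      ultimately show ?thesis by linarith
    qed
    then show ?thesis by blast
  qed
  then show ?thesis unfolding L_def[symmetric] by (intro LIMSEQ_I) blast
qed

lemma norm_cluster_factor_less_1:
  assumes "q \<ge> 2" "norm u \<le> 1" "k \<ge> 2"
  shows "norm (cluster_factor q u k) < 1"
proof -
  have "real q ^ (k - 1) > 1" using assms by (intro one_less_power) auto
  moreover have "norm u ^ (k choose 2) \<le> 1" using assms by (intro power_le_one) auto
  ultimately show ?thesis
    by (simp add: cluster_factor_def norm_divide norm_power divide_less_eq)
qed

text \<open>
  Strong induction on \<open>\<bar>A\<bar>\<close>. In \<open>word_mean_Suc\<close> the one-block partition reproduces the average for \<open>A\<close>
  with coefficient \<open>t\<close>, where \<open>\<bar>t\<bar> < 1\<close>, and the remaining terms converge by induction; so the average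
  follows an affine recursion, and its limit solves the recursion of \<open>hierarchy_sum_rec\<close>. The
  average is multiplied by \<open>cluster_factor\<close> because this combination enters \<open>word_mean_Suc\<close> block by
  block, and so its limit satisfies a recursion without division by \<open>t\<close>.
\<close>

theorem word_mean_tendsto:
  fixes A :: "'i::linorder set"
  assumes D: "finite D" "card D \<ge> 2" and u: "norm u \<le> 1" and A: "finite A" "A \<noteq> {}"
  shows "(\<lambda>N. cluster_factor (card D) u (card A) * word_mean D u N A)
    \<longlonglongrightarrow> hierarchy_sum (node_factor (card D) u) A"
  using A
proof (induction "card A" arbitrary: A rule: less_induct)
  case less
  define q where "q = card D"
  let ?t = "cluster_factor q u" and ?G = "hierarchy_sum (node_factor q u)"
  have q: "q \<ge> 2" using D by (simp add: q_def)
  have D': "D \<noteq> {}" using D by auto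
  show ?case
  proof (cases "card A = 1")
    case True
    then obtain a where a: "A = {a}" by (auto simp: card_1_singleton_iff)
    have "word_mean D u N A = 1" for N
      using q D(1) by (simp add: word_mean_def a word_sum_singleton q_def[symmetric])
    then show ?thesis
      by (simp add: a hierarchy_sum_singleton cluster_factor_def numeral_2_eq_2)
  next
    case False
    moreover have "card A \<noteq> 0" using less.prems by simp
    ultimately have A2: "card A \<ge> 2" by linarith
    let ?Ps = "{P. partition_on A P \<and> 2 \<le> card P}"
    define c where "c N = (\<Sum>P\<in>?Ps. distinct_prob q (card P) * (\<Prod>B\<in>P. ?t (card B) * word_mean D u N B))" for N
    define C where "C = (\<Sum>P\<in>?Ps. distinct_prob q (card P) * (\<Prod>B\<in>P. ?G B))"
    have fin: "finite ?Ps"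
      using finitely_many_partition_on[OF less.prems(1)] by (rule rev_finite_subset) auto
    have split: "{P. partition_on A P} = insert {A} ?Ps"
    proof -
      have "P = {A}" if P: "partition_on A P" "\<not> 2 \<le> card P" for P
      proof -
        have "card P \<noteq> 0" using finite_partition[OF less.prems(1) P(1)] P(1) less.prems(2)
          by (auto simp: partition_on_def)
        then have "card P = 1" using P(2) by linarith
        then show ?thesis using P(1) by (auto simp: card_1_singleton_iff partition_on_def)
      qed
      note one = this
      have "partition_on A {A}" using less.prems(2) by (rule partition_on_space)
      show ?thesis
      proof (rule Set.set_eqI)
        show "P \<in> {P. partition_on A P} \<longleftrightarrow> P \<in> insert {A} ?Ps" for P
          using one[of P] \<open>partition_on A {A}\<close> by (cases "2 \<le> card P") auto
      qed
    qed
    have "word_mean D u (Suc N) A = ?t (card A) * word_mean D u N A + c N" for N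
      unfolding word_mean_Suc[OF less.prems(1) D(1) D'] split c_def q_def[symmetric]
      by (subst sum.insert[OF fin]) (simp_all add: distinct_prob_def)
    moreover have "c \<longlonglongrightarrow> C" unfolding c_def C_def
    proof (intro tendsto_intros)
      fix P B assume P: "P \<in> ?Ps" and B: "B \<in> P"
      then have P': "partition_on A P" by simp
      note fP = finite_partition[OF less.prems(1) P']
      have "B \<noteq> {}" using P' B by (auto simp: partition_on_def)
      moreover have "card B < card A"
        using partition_block_psubset[OF P' _ B] P less.prems(1) by (intro psubset_card_mono) auto
      ultimately show "(\<lambda>N. ?t (card B) * word_mean D u N B) \<longlonglongrightarrow> ?G B"
        using less.hyps[of B] fP(2)[OF B] unfolding q_def by blast
    qed
    ultimately have "(\<lambda>N. word_mean D u N A) \<longlonglongrightarrow> C / (1 - ?t (card A))"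
      using norm_cluster_factor_less_1[OF q u A2] by (intro tendsto_affine_recursion)
    then have "(\<lambda>N. ?t (card A) * word_mean D u N A) \<longlonglongrightarrow> ?t (card A) * (C / (1 - ?t (card A)))"
      by (rule tendsto_mult_left)
    also have "?t (card A) * (C / (1 - ?t (card A))) = ?G A"
      unfolding hierarchy_sum_rec[OF less.prems(1) A2] C_def node_factor_def
      by (simp add: sum_divide_distrib sum_distrib_left mult_ac)
    finally show ?thesis unfolding q_def .
  qed
qed



section \<open>Branching trees and their leaf sets\<close>

definition leaf_set :: "'v rooted_graph \<Rightarrow> 'v \<Rightarrow> 'v set" where
  "leaf_set T u = descendants T u \<inter> leaves T"

locale branching_tree =
  fixes T :: "'v rooted_graph"
  assumes tree: "rooted_tree T"
    and branching: "\<And>u. u \<in> parents T \<Longrightarrow> num_children T u \<ge> 2"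
begin

abbreviation "V \<equiv> rt_verts T"
abbreviation "E \<equiv> rt_arcs T"
abbreviation "L \<equiv> leaf_set T"

lemma dl_eq_card_leaf_set: "dl T u = card (L u)"
  by (simp add: dl_def leaf_set_def)

lemma finite_V: "finite V"
  and root_V: "rt_root T \<in> V"
  and E_V: "(u, v) \<in> E \<Longrightarrow> u \<in> V \<and> v \<in> V"
  and no_arc_to_root: "(u, rt_root T) \<notin> E"
  and reach: "v \<in> V \<Longrightarrow> (rt_root T, v) \<in> E\<^sup>*"
  using tree unfolding rooted_tree_def by auto

lemma parent_unique:
  assumes "(u, w) \<in> E" "(v, w) \<in> E"
  shows "u = v"
proof -
  have "w \<in> V - {rt_root T}" using assms E_V no_arc_to_root by blast
  then have "\<exists>!u. (u, w) \<in> E" using tree unfolding rooted_tree_def by blast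
  then show ?thesis using assms by blast
qed

lemma acyclic: "(u, u) \<notin> E\<^sup>+"
proof
  assume u: "(u, u) \<in> E\<^sup>+"
  then obtain w where "(u, w) \<in> E" by (meson tranclD)
  then have "(rt_root T, u) \<in> E\<^sup>*" using E_V reach by blast
  then have "(u, u) \<notin> E\<^sup>+"
  proof (induction rule: rtrancl_induct)
    case base
    then show ?case using no_arc_to_root by (meson tranclD2)
  next
    case (step v w)
    show ?case
    proof
      assume "(w, w) \<in> E\<^sup>+"
      then obtain p where p: "(w, p) \<in> E\<^sup>*" "(p, w) \<in> E" by (meson tranclD2)
      then have "p = v" using parent_unique step.hyps(2) by blast
      then have "(v, v) \<in> E\<^sup>+" using p step.hyps(2) by (meson rtrancl_into_trancl2)
      then show False using step.IH by blast
    qed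
  qed
  then show False using u by blast
qed

lemma comparable:
  assumes "(u, x) \<in> E\<^sup>*" "(v, x) \<in> E\<^sup>*"
  shows "(u, v) \<in> E\<^sup>* \<or> (v, u) \<in> E\<^sup>*"
  using assms
proof (induction arbitrary: v rule: rtrancl_induct)
  case base
  then show ?case by blast
next
  case (step y x)
  show ?case
  proof (cases "v = x")
    case True
    then show ?thesis using step.hyps by (meson rtrancl_into_rtrancl)
  next
    case False
    then obtain p where p: "(v, p) \<in> E\<^sup>*" "(p, x) \<in> E"
      using step.prems by (meson rtranclE)
    then have "p = y" using parent_unique step.hyps(2) by blast
    then show ?thesis using step.IH p(1) by blast
  qed
qed

lemma antisym_E: "(u, v) \<in> E\<^sup>* \<Longrightarrow> (v, u) \<in> E\<^sup>* \<Longrightarrow> u = v"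
  using acyclic by (metis rtranclD rtrancl_trancl_trancl)

lemma leaf_set_mono: "(u, v) \<in> E\<^sup>* \<Longrightarrow> L v \<subseteq> L u"
  unfolding leaf_set_def descendants_def by (auto intro: rtrancl_trans)

lemma leaf_set_leaf: "u \<in> leaves T \<Longrightarrow> L u = {u}"
  unfolding leaf_set_def descendants_def leaves_def children_def
  by (auto elim: converse_rtranclE)

lemma leaf_set_nonempty:
  assumes "u \<in> V"
  shows "L u \<noteq> {}"
proof -
  have "finite E" using finite_V E_V by (intro finite_subset[of E "V \<times> V"]) auto
  then have "wf (E\<inverse>)" using acyclic by (intro finite_acyclic_wf_converse) (auto simp: acyclic_def)
  then show ?thesis using assms
  proof (induction u rule: wf_induct_rule)
    case (less u)
    show ?case
    proof (cases "u \<in> leaves T")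
      case True
      then show ?thesis by (simp add: leaf_set_leaf)
    next
      case False
      then obtain v where v: "(u, v) \<in> E" using less.prems by (auto simp: leaves_def children_def)
      then have "L v \<noteq> {}" using less.IH E_V by blast
      then show ?thesis using leaf_set_mono[of u v] v by blast
    qed
  qed
qed

lemma leaf_set_disjoint:
  assumes "(u, v) \<notin> E\<^sup>*" "(v, u) \<notin> E\<^sup>*"
  shows "L u \<inter> L v = {}"
  using comparable assms unfolding leaf_set_def descendants_def by blast

lemma siblings_incomparable:
  assumes "(u, c) \<in> E" "(u, c') \<in> E" "c \<noteq> c'"
  shows "(c, c') \<notin> E\<^sup>*"
proof
  assume "(c, c') \<in> E\<^sup>*"
  then obtain p where p: "(c, p) \<in> E\<^sup>*" "(p, c') \<in> E" using assms(3) by (meson rtranclE)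
  then have "p = u" using parent_unique assms(2) by blast
  then have "(u, u) \<in> E\<^sup>+" using p(1) assms(1) by (meson rtrancl_into_trancl2)
  then show False using acyclic by blast
qed

text \<open>
  Branching enters here: a second child has leaves of its own, and none of them lies below
  the first child.
\<close>

lemma leaf_set_child_psubset:
  assumes "(u, c) \<in> E"
  shows "L c \<subset> L u"
proof -
  have "u \<in> parents T" using assms E_V by (auto simp: parents_def leaves_def children_def)
  then have "2 \<le> card (children T u)" using branching by (simp add: num_children_def)
  then have "children T u \<noteq> {c}" by auto
  then obtain c' where c': "(u, c') \<in> E" "c' \<noteq> c" using assms by (auto simp: children_def)
  have "L c \<inter> L c' = {}"
    using siblings_incomparable[OF assms c'(1)] siblings_incomparable[OF c'(1) assms] c'(2)
    by (intro leaf_set_disjoint) auto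
  moreover have "L c' \<noteq> {}" using c' E_V leaf_set_nonempty by blast
  moreover have "L c \<subseteq> L u" "L c' \<subseteq> L u" using leaf_set_mono assms c' by auto
  ultimately show ?thesis by blast
qed

text \<open>
  A vertex is determined by its leaf set, and inclusion of leaf sets is the descendant order; hence
  the whole tree can be read off from the family of leaf sets.
\<close>

lemma leaf_set_subset_iff:
  assumes "u \<in> V" "v \<in> V"
  shows "L v \<subseteq> L u \<longleftrightarrow> (u, v) \<in> E\<^sup>*"
proof
  assume sub: "L v \<subseteq> L u"
  then have "L u \<inter> L v \<noteq> {}" using leaf_set_nonempty[OF assms(2)] by blast
  then have cmp: "(u, v) \<in> E\<^sup>* \<or> (v, u) \<in> E\<^sup>*" using leaf_set_disjoint by blast
  show "(u, v) \<in> E\<^sup>*"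
  proof (rule ccontr)
    assume n: "(u, v) \<notin> E\<^sup>*"
    then have "(v, u) \<in> E\<^sup>*" "v \<noteq> u" using cmp by auto
    then obtain c where "(v, c) \<in> E" "(c, u) \<in> E\<^sup>*" by (meson converse_rtranclE)
    then have "L u \<subset> L v" using leaf_set_child_psubset leaf_set_mono by blast
    then show False using sub by blast
  qed
qed (rule leaf_set_mono)

lemma inj_leaf_set: "inj_on L V"
  using leaf_set_subset_iff antisym_E by (intro inj_onI) (metis order_refl)

lemma leaves_root: "L (rt_root T) = leaves T"
  unfolding leaf_set_def descendants_def leaves_def using reach by auto

lemma finite_leaf_set: "finite (L u)"
  using finite_V by (auto simp: leaf_set_def leaves_def)

lemma arc_iff_cover:
  assumes "u \<in> V" "v \<in> V"
  shows "(u, v) \<in> E \<longleftrightarrow> L v \<subset> L u \<and> \<not> (\<exists>w\<in>V. L v \<subset> L w \<and> L w \<subset> L u)"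
proof
  assume uv: "(u, v) \<in> E"
  have False if w: "w \<in> V" "L v \<subset> L w" "L w \<subset> L u" for w
  proof -
    have "(w, v) \<in> E\<^sup>*" "w \<noteq> v" using leaf_set_subset_iff[OF w(1) assms(2)] w(2) by auto
    then obtain p where "(w, p) \<in> E\<^sup>*" "(p, v) \<in> E" by (meson rtranclE)
    then have "(w, u) \<in> E\<^sup>*" using parent_unique uv by blast
    then show False using leaf_set_mono w(3) by blast
  qed
  then show "L v \<subset> L u \<and> \<not> (\<exists>w\<in>V. L v \<subset> L w \<and> L w \<subset> L u)"
    using leaf_set_child_psubset[OF uv] by blast
next
  assume c: "L v \<subset> L u \<and> \<not> (\<exists>w\<in>V. L v \<subset> L w \<and> L w \<subset> L u)"
  then have "(u, v) \<in> E\<^sup>*" "u \<noteq> v" using leaf_set_subset_iff[OF assms] by auto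
  then obtain x where x: "(u, x) \<in> E" "(x, v) \<in> E\<^sup>*" by (meson converse_rtranclE)
  then have xV: "x \<in> V" and "L v \<subseteq> L x" "L x \<subset> L u"
    using E_V leaf_set_mono leaf_set_child_psubset by blast+
  then have "L v = L x" using c by blast
  then have "v = x" using inj_leaf_set xV assms(2) by (metis inj_onD)
  then show "(u, v) \<in> E" using x by simp
qed

lemma leaf_iff_card: "u \<in> V \<Longrightarrow> u \<in> leaves T \<longleftrightarrow> \<not> 2 \<le> card (L u)"
proof
  show "u \<in> leaves T \<Longrightarrow> \<not> 2 \<le> card (L u)" by (simp add: leaf_set_leaf)
  assume u: "u \<in> V" and c: "\<not> 2 \<le> card (L u)"
  show "u \<in> leaves T"
  proof (rule ccontr)
    assume "u \<notin> leaves T"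
    then obtain v where v: "(u, v) \<in> E" using u by (auto simp: leaves_def children_def)
    then have "card (L v) < card (L u)"
      by (intro psubset_card_mono finite_leaf_set leaf_set_child_psubset)
    moreover have "card (L v) \<noteq> 0"
      using leaf_set_nonempty finite_leaf_set v E_V by (simp add: card_eq_0_iff)
    ultimately show False using c by linarith
  qed
qed

end

section \<open>The hierarchy of a tree with labelled leaves\<close>

definition tree_hierarchy :: "'v rooted_graph \<Rightarrow> ('v \<Rightarrow> 'i) \<Rightarrow> 'i set set" where
  "tree_hierarchy T l = (\<lambda>u. l ` leaf_set T u) ` rt_verts T"

context branching_tree
begin

context
  fixes l :: "'v \<Rightarrow> 'i" and A :: "'i set"
  assumes l: "bij_betw l (leaves T) A"
begin

lemma leaf_set_leaves: "L u \<subseteq> leaves T" by (simp add: leaf_set_def)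

lemma label_subset_iff: "l ` L v \<subseteq> l ` L u \<longleftrightarrow> L v \<subseteq> L u"
  using l leaf_set_leaves by (intro inj_on_image_subset_iff) (auto simp: bij_betw_def)

lemma label_psubset_iff: "l ` L v \<subset> l ` L u \<longleftrightarrow> L v \<subset> L u"
  by (simp only: less_le_not_le label_subset_iff)

lemma card_label: "card (l ` L u) = card (L u)"
  using l leaf_set_leaves[of u] unfolding bij_betw_def
  by (intro card_image) (auto intro: inj_on_subset)

lemma inj_label: "inj_on (\<lambda>u. l ` L u) V"
proof (rule inj_onI)
  fix u v assume uv: "u \<in> V" "v \<in> V" and eq: "l ` L u = l ` L v"
  then have "L u = L v" using label_subset_iff[of u v] label_subset_iff[of v u] by auto
  then show "u = v" using inj_leaf_set uv by (metis inj_onD)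
qed

lemma hierarchy_tree_hierarchy: "hierarchy_on A (tree_hierarchy T l)"
  unfolding hierarchy_on_def
proof (intro conjI ballI)
  have lA: "l ` leaves T = A" using l by (simp add: bij_betw_def)
  show "A \<in> tree_hierarchy T l"
    using root_V leaves_root lA unfolding tree_hierarchy_def by (metis imageI)
  show "B \<subseteq> A" if "B \<in> tree_hierarchy T l" for B
    using that lA leaf_set_leaves unfolding tree_hierarchy_def by blast
  show "B \<noteq> {}" if "B \<in> tree_hierarchy T l" for B
    using that leaf_set_nonempty unfolding tree_hierarchy_def by auto
  show "{a} \<in> tree_hierarchy T l" if "a \<in> A" for a
  proof -
    obtain x where x: "x \<in> leaves T" "a = l x" using \<open>a \<in> A\<close> lA by auto
    then have "x \<in> V" "l ` L x = {a}" using leaf_set_leaf by (auto simp: leaves_def)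
    then show ?thesis unfolding tree_hierarchy_def by (metis imageI)
  qed
  show "B \<subseteq> C \<or> C \<subseteq> B \<or> B \<inter> C = {}" if BC: "B \<in> tree_hierarchy T l" "C \<in> tree_hierarchy T l" for B C
  proof -
    obtain u v where uv: "B = l ` L u" "C = l ` L v" "u \<in> V" "v \<in> V"
      using BC unfolding tree_hierarchy_def by auto
    show ?thesis
    proof (cases "L u \<inter> L v = {}")
      case True
      have "l ` L u \<inter> l ` L v = l ` (L u \<inter> L v)"
        using l leaf_set_leaves by (intro inj_on_image_Int[symmetric, of l "leaves T"]) (auto simp: bij_betw_def)
      then show ?thesis using True uv by simp
    next
      case False
      then have "(u, v) \<in> E\<^sup>* \<or> (v, u) \<in> E\<^sup>*" using leaf_set_disjoint by blast
      then have "L v \<subseteq> L u \<or> L u \<subseteq> L v" using leaf_set_mono by blast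
      then show ?thesis using uv label_subset_iff by blast
    qed
  qed
qed

lemma arc_iff_subblock:
  assumes "u \<in> V" "v \<in> V"
  shows "(u, v) \<in> E \<longleftrightarrow> l ` L v \<in> subblocks (tree_hierarchy T l) (l ` L u)"
  unfolding arc_iff_cover[OF assms] subblocks_def tree_hierarchy_def
  using assms by (simp add: label_psubset_iff)

lemma subblocks_tree_hierarchy:
  assumes "u \<in> V"
  shows "subblocks (tree_hierarchy T l) (l ` L u) = (\<lambda>v. l ` L v) ` children T u"
proof
  show "subblocks (tree_hierarchy T l) (l ` L u) \<subseteq> (\<lambda>v. l ` L v) ` children T u"
  proof
    fix C assume C: "C \<in> subblocks (tree_hierarchy T l) (l ` L u)"
    then obtain v where v: "v \<in> V" "C = l ` L v" by (auto simp: subblocks_def tree_hierarchy_def)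
    then have "v \<in> children T u" using C arc_iff_subblock[OF assms v(1)] by (simp add: children_def)
    then show "C \<in> (\<lambda>v. l ` L v) ` children T u" using v(2) by blast
  qed
  show "(\<lambda>v. l ` L v) ` children T u \<subseteq> subblocks (tree_hierarchy T l) (l ` L u)"
    using arc_iff_subblock[OF assms] E_V by (auto simp: children_def)
qed

lemma weight_tree_hierarchy:
  "hierarchy_weight g (tree_hierarchy T l) = (\<Prod>u\<in>parents T. g (num_children T u) (dl T u))"
proof -
  have set: "{B \<in> tree_hierarchy T l. 2 \<le> card B} = (\<lambda>u. l ` L u) ` parents T"
  proof
    show "{B \<in> tree_hierarchy T l. 2 \<le> card B} \<subseteq> (\<lambda>u. l ` L u) ` parents T"
      using leaf_iff_card by (auto simp: tree_hierarchy_def parents_def card_label)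
    show "(\<lambda>u. l ` L u) ` parents T \<subseteq> {B \<in> tree_hierarchy T l. 2 \<le> card B}"
      using leaf_iff_card by (auto simp: tree_hierarchy_def parents_def card_label)
  qed
  have PV: "parents T \<subseteq> V" by (auto simp: parents_def)
  have "card (subblocks (tree_hierarchy T l) (l ` L u)) = num_children T u" if "u \<in> V" for u
    unfolding subblocks_tree_hierarchy[OF that] num_children_def
    using E_V by (intro card_image inj_on_subset[OF inj_label]) (auto simp: children_def)
  then show ?thesis
    unfolding hierarchy_weight_def set
    using PV by (subst prod.reindex[OF inj_on_subset[OF inj_label PV]])
      (auto intro!: prod.cong simp: card_label dl_eq_card_leaf_set)
qed

end

end


section \<open>Isomorphisms of trees\<close>

definition tree_iso :: "('v \<Rightarrow> 'w) \<Rightarrow> 'v rooted_graph \<Rightarrow> 'w rooted_graph \<Rightarrow> bool" where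
  "tree_iso \<phi> T T' \<longleftrightarrow> bij_betw \<phi> (rt_verts T) (rt_verts T') \<and> \<phi> (rt_root T) = rt_root T' \<and>
     (\<forall>u\<in>rt_verts T. \<forall>v\<in>rt_verts T. rt_adj T u v \<longleftrightarrow> rt_adj T' (\<phi> u) (\<phi> v))"

lemma rt_isomorphic_iff: "rt_isomorphic T T' \<longleftrightarrow> (\<exists>\<phi>. tree_iso \<phi> T T')"
  by (simp add: rt_isomorphic_def tree_iso_def)

lemma rt_Aut_iff: "\<phi> \<in> rt_Aut T \<longleftrightarrow> \<phi> permutes rt_verts T \<and> tree_iso \<phi> T T"
  by (auto simp: rt_Aut_def tree_iso_def permutes_imp_bij)

lemma tree_iso_comp:
  assumes "tree_iso \<phi> T T'" "tree_iso \<psi> T' T''"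
  shows "tree_iso (\<psi> \<circ> \<phi>) T T''"
  unfolding tree_iso_def
proof (intro conjI ballI)
  show "bij_betw (\<psi> \<circ> \<phi>) (rt_verts T) (rt_verts T'')"
    using assms bij_betw_trans unfolding tree_iso_def by blast
  show "(\<psi> \<circ> \<phi>) (rt_root T) = rt_root T''" using assms by (simp add: tree_iso_def)
  fix u v assume uv: "u \<in> rt_verts T" "v \<in> rt_verts T"
  then have "\<phi> u \<in> rt_verts T'" "\<phi> v \<in> rt_verts T'"
    using assms(1) bij_betwE unfolding tree_iso_def by blast+
  then show "rt_adj T u v \<longleftrightarrow> rt_adj T'' ((\<psi> \<circ> \<phi>) u) ((\<psi> \<circ> \<phi>) v)"
    using assms uv by (simp add: tree_iso_def)
qed

lemma tree_iso_inv:
  assumes "tree_iso \<phi> T T'" "rt_root T \<in> rt_verts T"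
  shows "tree_iso (inv_into (rt_verts T) \<phi>) T' T"
  unfolding tree_iso_def
proof (intro conjI ballI)
  have b: "bij_betw \<phi> (rt_verts T) (rt_verts T')" using assms(1) by (simp add: tree_iso_def)
  show "bij_betw (inv_into (rt_verts T) \<phi>) (rt_verts T') (rt_verts T)"
    using b by (rule bij_betw_inv_into)
  show "inv_into (rt_verts T) \<phi> (rt_root T') = rt_root T"
    using assms b by (metis bij_betw_inv_into_left tree_iso_def)
  fix u v assume uv: "u \<in> rt_verts T'" "v \<in> rt_verts T'"
  then have "inv_into (rt_verts T) \<phi> u \<in> rt_verts T" "inv_into (rt_verts T) \<phi> v \<in> rt_verts T"
    using bij_betwE[OF bij_betw_inv_into[OF b]] by auto
  then have "rt_adj T (inv_into (rt_verts T) \<phi> u) (inv_into (rt_verts T) \<phi> v) \<longleftrightarrow>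
      rt_adj T' (\<phi> (inv_into (rt_verts T) \<phi> u)) (\<phi> (inv_into (rt_verts T) \<phi> v))"
    using assms(1) unfolding tree_iso_def by blast
  then show "rt_adj T' u v \<longleftrightarrow> rt_adj T (inv_into (rt_verts T) \<phi> u) (inv_into (rt_verts T) \<phi> v)"
    using uv by (simp add: bij_betw_inv_into_right[OF b])
qed

lemma rt_isomorphic_refl: "rt_isomorphic T T"
  unfolding rt_isomorphic_iff by (rule exI[of _ id]) (simp add: tree_iso_def)

text \<open>
  An isomorphism is only assumed to respect undirected adjacency and the root. Directions follow by
  induction along the path from the root: an arc out of a vertex cannot be reversed, since the unique
  arc into the image of that vertex already comes from the image of its parent.
\<close>

lemma tree_iso_arc:
  assumes "branching_tree T" "branching_tree T'" and iso: "tree_iso \<phi> T T'"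
    and uv: "(u, v) \<in> rt_arcs T"
  shows "(\<phi> u, \<phi> v) \<in> rt_arcs T'"
proof -
  interpret T: branching_tree T by fact
  interpret T': branching_tree T' by fact
  have inj: "inj_on \<phi> T.V" and adj: "\<And>u v. u \<in> T.V \<Longrightarrow> v \<in> T.V \<Longrightarrow> rt_adj T u v \<longleftrightarrow> rt_adj T' (\<phi> u) (\<phi> v)"
    and root: "\<phi> (rt_root T) = rt_root T'"
    using iso by (auto simp: tree_iso_def bij_betw_def)
  have "(rt_root T, u) \<in> T.E\<^sup>*" using uv T.E_V T.reach by blast
  then show ?thesis using uv
  proof (induction arbitrary: v rule: rtrancl_induct)
    case (base v)
    then have "rt_adj T' (\<phi> (rt_root T)) (\<phi> v)" using adj T.E_V by (metis rt_adj_def)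
    then show ?case using root T'.no_arc_to_root by (simp add: rt_adj_def)
  next
    case (step p u)
    have "rt_adj T' (\<phi> u) (\<phi> v)" using step.prems adj T.E_V by (metis rt_adj_def)
    moreover have "(\<phi> v, \<phi> u) \<notin> T'.E"
    proof
      assume "(\<phi> v, \<phi> u) \<in> T'.E"
      then have "\<phi> v = \<phi> p" using step.IH[OF step.hyps(2)] T'.parent_unique by blast
      then have "v = p" using inj T.E_V step.prems step.hyps(2) by (metis inj_onD)
      then have "(u, u) \<in> T.E\<^sup>+" using step.prems step.hyps(2) by (meson r_into_rtrancl rtrancl_into_trancl2)
      then show False using T.acyclic by blast
    qed
    ultimately show ?case by (simp add: rt_adj_def)
  qed
qed

lemma tree_iso_leaf_set_subset:
  assumes T: "branching_tree T" "branching_tree T'" and iso: "tree_iso \<phi> T T'"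
    and u: "u \<in> rt_verts T"
  shows "\<phi> ` leaf_set T u \<subseteq> leaf_set T' (\<phi> u)"
proof
  interpret T: branching_tree T by fact
  interpret T': branching_tree T' by fact
  have b: "bij_betw \<phi> T.V T'.V" using iso by (simp add: tree_iso_def)
  fix y assume "y \<in> \<phi> ` leaf_set T u"
  then obtain x where x: "y = \<phi> x" "(u, x) \<in> T.E\<^sup>*" "x \<in> leaves T"
    by (auto simp: leaf_set_def descendants_def)
  have "(\<phi> u, \<phi> x) \<in> T'.E\<^sup>*" using x(2)
    by (induction rule: rtrancl_induct) (auto intro: rtrancl_into_rtrancl tree_iso_arc[OF T iso])
  moreover have "\<phi> x \<in> leaves T'"
  proof -
    have xV: "x \<in> T.V" using x(3) by (simp add: leaves_def)
    have "(\<phi> x, z) \<notin> T'.E" for z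
    proof
      assume z: "(\<phi> x, z) \<in> T'.E"
      have "(inv_into T.V \<phi> (\<phi> x), inv_into T.V \<phi> z) \<in> T.E"
        by (rule tree_iso_arc[OF T(2,1) tree_iso_inv[OF iso T.root_V] z])
      then show False using x(3) bij_betw_inv_into_left[OF b xV] by (auto simp: leaves_def children_def)
    qed
    then show ?thesis using bij_betwE[OF b] xV by (auto simp: leaves_def children_def)
  qed
  ultimately show "y \<in> leaf_set T' (\<phi> u)" using x(1) by (simp add: leaf_set_def descendants_def)
qed

lemma tree_iso_leaf_set:
  assumes T: "branching_tree T" "branching_tree T'" and iso: "tree_iso \<phi> T T'"
    and u: "u \<in> rt_verts T"
  shows "\<phi> ` leaf_set T u = leaf_set T' (\<phi> u)"
proof
  interpret T: branching_tree T by fact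
  interpret T': branching_tree T' by fact
  let ?\<psi> = "inv_into T.V \<phi>"
  have b: "bij_betw \<phi> T.V T'.V" using iso by (simp add: tree_iso_def)
  show "\<phi> ` leaf_set T u \<subseteq> leaf_set T' (\<phi> u)" by (rule tree_iso_leaf_set_subset[OF assms])
  have \<phi>u: "\<phi> u \<in> T'.V" using bij_betwE[OF b] u by blast
  have sub: "?\<psi> ` leaf_set T' (\<phi> u) \<subseteq> leaf_set T u"
    using tree_iso_leaf_set_subset[OF T(2,1) tree_iso_inv[OF iso T.root_V] \<phi>u]
    by (simp add: bij_betw_inv_into_left[OF b u])
  show "leaf_set T' (\<phi> u) \<subseteq> \<phi> ` leaf_set T u"
  proof
    fix y assume y: "y \<in> leaf_set T' (\<phi> u)"
    then have "\<phi> (?\<psi> y) = y"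
      by (intro bij_betw_inv_into_right[OF b]) (simp add: leaf_set_def leaves_def)
    then show "y \<in> \<phi> ` leaf_set T u" using sub y by (metis image_eqI subsetD)
  qed
qed

lemma tree_iso_leaves:
  assumes "branching_tree T" "branching_tree T'" "tree_iso \<phi> T T'"
  shows "bij_betw \<phi> (leaves T) (leaves T')"
proof -
  interpret T: branching_tree T by fact
  interpret T': branching_tree T' by fact
  have "\<phi> ` leaves T = leaves T'"
    using tree_iso_leaf_set[OF assms T.root_V] assms(3) by (simp add: tree_iso_def T.leaves_root T'.leaves_root)
  moreover have "inj_on \<phi> (leaves T)"
    using assms(3) by (auto simp: tree_iso_def bij_betw_def leaves_def intro: inj_on_subset)
  ultimately show ?thesis by (simp add: bij_betw_def)
qed

lemma tree_iso_tree_hierarchy: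
  assumes T: "branching_tree T" "branching_tree T'" "tree_iso \<phi> T T'"
  shows "tree_hierarchy T (l \<circ> \<phi>) = tree_hierarchy T' l"
proof -
  have im: "\<phi> ` rt_verts T = rt_verts T'" using T(3) by (simp add: tree_iso_def bij_betw_def)
  have "tree_hierarchy T (l \<circ> \<phi>) = (\<lambda>u. l ` leaf_set T' (\<phi> u)) ` rt_verts T"
    unfolding tree_hierarchy_def
    by (intro image_cong refl) (simp only: image_comp[symmetric] tree_iso_leaf_set[OF T])
  also have "\<dots> = tree_hierarchy T' l" unfolding tree_hierarchy_def im[symmetric] by (simp add: image_image)
  finally show ?thesis .
qed

lemma tree_hierarchy_cong:
  assumes "\<And>x. x \<in> leaves T \<Longrightarrow> l x = l' x"
  shows "tree_hierarchy T l = tree_hierarchy T l'"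
  unfolding tree_hierarchy_def
  by (intro image_cong refl) (use assms in \<open>auto simp: leaf_set_def\<close>)

text \<open>
  Both trees are recovered from the same hierarchy, so matching vertices with equal label sets is an
  isomorphism.
\<close>

lemma tree_iso_of_tree_hierarchy_eq:
  assumes T: "branching_tree T" "branching_tree T'"
    and l: "bij_betw l (leaves T) A" "bij_betw l' (leaves T') A"
    and eq: "tree_hierarchy T l = tree_hierarchy T' l'"
  obtains \<phi> where "tree_iso \<phi> T T'" "\<And>u. u \<in> rt_verts T \<Longrightarrow> l' ` leaf_set T' (\<phi> u) = l ` leaf_set T u"
proof -
  interpret T: branching_tree T by fact
  interpret T': branching_tree T' by fact
  let ?\<Lambda> = "\<lambda>u. l ` leaf_set T u" and ?\<Lambda>' = "\<lambda>u. l' ` leaf_set T' u"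
  define \<phi> where "\<phi> = inv_into T'.V ?\<Lambda>' \<circ> ?\<Lambda>"
  have b: "bij_betw ?\<Lambda> T.V (tree_hierarchy T l)"
    using T.inj_label[OF l(1)] by (simp add: bij_betw_def tree_hierarchy_def)
  have b': "bij_betw ?\<Lambda>' T'.V (tree_hierarchy T l)"
    using T'.inj_label[OF l(2)] eq by (simp add: bij_betw_def tree_hierarchy_def)
  have \<phi>: "bij_betw \<phi> T.V T'.V"
    unfolding \<phi>_def by (rule bij_betw_trans[OF b bij_betw_inv_into[OF b']])
  have \<Lambda>: "?\<Lambda>' (\<phi> u) = ?\<Lambda> u" if "u \<in> T.V" for u
  proof -
    have "?\<Lambda> u \<in> tree_hierarchy T l" using bij_betwE[OF b] that by blast
    then show ?thesis unfolding \<phi>_def comp_def by (rule bij_betw_inv_into_right[OF b'])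
  qed
  have arcs: "(u, v) \<in> T.E \<longleftrightarrow> (\<phi> u, \<phi> v) \<in> T'.E" if "u \<in> T.V" "v \<in> T.V" for u v
  proof -
    have "\<phi> u \<in> T'.V" "\<phi> v \<in> T'.V" using that bij_betwE[OF \<phi>] by blast+
    then show ?thesis
      using T.arc_iff_subblock[OF l(1) that] T'.arc_iff_subblock[OF l(2), of "\<phi> u" "\<phi> v"]
      by (simp add: \<Lambda>[OF that(1)] \<Lambda>[OF that(2)] eq)
  qed
  have "\<phi> (rt_root T) = rt_root T'"
  proof -
    have "?\<Lambda>' (\<phi> (rt_root T)) = A"
      using \<Lambda>[OF T.root_V] l(1) by (simp add: T.leaves_root bij_betw_def)
    moreover have "?\<Lambda>' (rt_root T') = A"
      using l(2) by (simp add: T'.leaves_root bij_betw_def)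
    ultimately show ?thesis
      using T'.inj_label[OF l(2)] bij_betwE[OF \<phi>] T.root_V T'.root_V by (metis (no_types, lifting) inj_onD)
  qed
  then have "tree_iso \<phi> T T'"
    using \<phi> arcs by (simp add: tree_iso_def rt_adj_def)
  then show ?thesis using \<Lambda> by (rule that)
qed


section \<open>Counting the hierarchies of a tree\<close>

definition labellings :: "'v rooted_graph \<Rightarrow> 'i set \<Rightarrow> ('v \<Rightarrow> 'i) set" where
  "labellings T A = {l \<in> PiE (leaves T) (\<lambda>_. A). bij_betw l (leaves T) A}"

lemma card_labellings:
  assumes "finite (leaves T)" "finite A" "card (leaves T) = card A"
  shows "card (labellings T A) = fact (card A)"
proof -
  have "l ` leaves T = A" if "l \<in> PiE (leaves T) (\<lambda>_. A)" "inj_on l (leaves T)" for l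
    using that assms by (intro card_subset_eq) (auto simp: card_image)
  then have "labellings T A = {l \<in> PiE (leaves T) (\<lambda>_. A). inj_on l (leaves T)}"
    by (auto simp: labellings_def bij_betw_def)
  then show ?thesis
    using card_inj_on_subset_funcset[of "leaves T" A "leaves T"] assms
    by (simp add: fact_prod_rev)
qed

text \<open>
  Composing \<open>l0\<close> with automorphisms gives a bijection. It is injective because an automorphism is
  determined by its effect on the leaves, and it is surjective by \<open>tree_iso_of_tree_hierarchy_eq\<close>.
\<close>

lemma card_labellings_same_hierarchy:
  assumes T: "branching_tree T" and l0: "bij_betw l0 (leaves T) A"
  shows "card {l \<in> labellings T A. tree_hierarchy T l = tree_hierarchy T l0} = card (rt_Aut T)"
proof -
  interpret branching_tree T by fact
  have sub: "x \<in> V" if "x \<in> leaves T" for x using that by (simp add: leaves_def)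
  have lv: "bij_betw \<phi> (leaves T) (leaves T)" if "\<phi> \<in> rt_Aut T" for \<phi>
    using that by (intro tree_iso_leaves[OF T T]) (simp add: rt_Aut_iff)
  have bij: "bij_betw (\<lambda>\<phi>. restrict (l0 \<circ> \<phi>) (leaves T)) (rt_Aut T)
    {l \<in> labellings T A. tree_hierarchy T l = tree_hierarchy T l0}"
  proof (rule bij_betw_imageI)
    show "inj_on (\<lambda>\<phi>. restrict (l0 \<circ> \<phi>) (leaves T)) (rt_Aut T)"
    proof (rule inj_onI)
      fix \<phi> \<psi> assume \<phi>: "\<phi> \<in> rt_Aut T" and \<psi>: "\<psi> \<in> rt_Aut T"
        and eq: "restrict (l0 \<circ> \<phi>) (leaves T) = restrict (l0 \<circ> \<psi>) (leaves T)"
      have leaf: "\<phi> x = \<psi> x" if x: "x \<in> leaves T" for x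
      proof -
        have "l0 (\<phi> x) = l0 (\<psi> x)" using fun_cong[OF eq, of x] x by simp
        then show ?thesis
          using l0 bij_betwE[OF lv[OF \<phi>]] bij_betwE[OF lv[OF \<psi>]] x by (metis bij_betw_def inj_onD)
      qed
      show "\<phi> = \<psi>"
      proof
        fix u
        show "\<phi> u = \<psi> u"
        proof (cases "u \<in> V")
          case True
          have "L (\<phi> u) = L (\<psi> u)"
            using tree_iso_leaf_set[OF T T _ True, of \<phi>] tree_iso_leaf_set[OF T T _ True, of \<psi>] \<phi> \<psi>
              image_cong[of "L u" "L u" \<phi> \<psi>] leaf by (simp add: rt_Aut_iff leaf_set_def)
          moreover have "\<phi> u \<in> V" "\<psi> u \<in> V"
            using True \<phi> \<psi> by (auto simp: rt_Aut_iff permutes_in_image)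
          ultimately show ?thesis using inj_leaf_set by (metis inj_onD)
        next
          case False
          then show ?thesis
            using \<phi> \<psi> permutes_not_in[of \<phi> V u] permutes_not_in[of \<psi> V u] by (simp add: rt_Aut_iff)
        qed
      qed
    qed
    show "(\<lambda>\<phi>. restrict (l0 \<circ> \<phi>) (leaves T)) ` rt_Aut T =
      {l \<in> labellings T A. tree_hierarchy T l = tree_hierarchy T l0}" (is "?f ` _ = ?R")
    proof
      show "?f ` rt_Aut T \<subseteq> ?R"
      proof
        fix l assume "l \<in> ?f ` rt_Aut T"
        then obtain \<phi> where \<phi>: "\<phi> \<in> rt_Aut T" "l = ?f \<phi>" by blast
        have b: "bij_betw (l0 \<circ> \<phi>) (leaves T) A" by (rule bij_betw_trans[OF lv[OF \<phi>(1)] l0])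
        then have "bij_betw l (leaves T) A" using \<phi>(2) by (simp cong: bij_betw_cong)
        moreover have "l \<in> PiE (leaves T) (\<lambda>_. A)" using bij_betwE[OF b] \<phi>(2) by auto
        moreover have "tree_hierarchy T l = tree_hierarchy T (l0 \<circ> \<phi>)"
          by (rule tree_hierarchy_cong) (simp add: \<phi>(2))
        moreover have "tree_hierarchy T (l0 \<circ> \<phi>) = tree_hierarchy T l0"
          using \<phi>(1) by (intro tree_iso_tree_hierarchy[OF T T]) (simp add: rt_Aut_iff)
        ultimately show "l \<in> ?R" by (simp add: labellings_def)
      qed
      show "?R \<subseteq> ?f ` rt_Aut T"
      proof
        fix l assume "l \<in> ?R"
        then have l: "l \<in> PiE (leaves T) (\<lambda>_. A)" "bij_betw l (leaves T) A"
          and eq: "tree_hierarchy T l = tree_hierarchy T l0" by (auto simp: labellings_def)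
        obtain \<phi> where \<phi>: "tree_iso \<phi> T T" "\<And>u. u \<in> V \<Longrightarrow> l0 ` L (\<phi> u) = l ` L u"
          using tree_iso_of_tree_hierarchy_eq[OF T T l(2) l0 eq] by blast
        \<comment> \<open>outside the tree the isomorphism is arbitrary, whereas a permutation of V must be the identity there\<close>
        define \<psi> where "\<psi> u = (if u \<in> V then \<phi> u else u)" for u
        have "bij_betw \<psi> V V" using \<phi>(1) by (simp add: tree_iso_def \<psi>_def cong: bij_betw_cong)
        then have "\<psi> permutes V" by (rule bij_imp_permutes) (simp add: \<psi>_def)
        moreover have "tree_iso \<psi> T T"
          using \<phi>(1) root_V \<open>bij_betw \<psi> V V\<close> by (simp add: tree_iso_def \<psi>_def)
        ultimately have \<psi>: "\<psi> \<in> rt_Aut T" by (simp add: rt_Aut_iff)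
        have "?f \<psi> = l"
        proof (rule PiE_ext[OF _ l(1)])
          show "?f \<psi> \<in> PiE (leaves T) (\<lambda>_. A)"
            using bij_betwE[OF bij_betw_trans[OF lv[OF \<psi>] l0]] by auto
          show "?f \<psi> x = l x" if x: "x \<in> leaves T" for x
          proof -
            have "\<phi> x \<in> leaves T" using bij_betwE[OF lv[OF \<psi>]] x sub by (auto simp: \<psi>_def)
            then have "{l0 (\<phi> x)} = {l x}"
              using \<phi>(2)[OF sub[OF x]] x by (simp add: leaf_set_leaf)
            then show ?thesis using x sub by (simp add: \<psi>_def)
          qed
        qed
        then show "l \<in> ?f ` rt_Aut T" using \<psi> by blast
      qed
    qed
  qed
  show ?thesis by (rule bij_betw_same_card[OF bij, symmetric])
qed

definition hierarchies_of_tree :: "'v rooted_graph \<Rightarrow> 'i set \<Rightarrow> 'i set set set" where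
  "hierarchies_of_tree T A = tree_hierarchy T ` labellings T A"

lemma branching_tree_finite_leaves: "branching_tree T \<Longrightarrow> finite (leaves T)"
  using branching_tree.finite_V[of T] by (simp add: leaves_def)

text \<open>
  The labellings of the leaves, \<open>m!\<close> in number, are distributed over the hierarchies of the tree with
  fibres of size \<open>\<bar>Aut\<bar>\<close>.
\<close>

lemma card_hierarchies_of_tree:
  assumes T: "branching_tree T" and A: "finite A" "card (leaves T) = card A"
  shows "card (hierarchies_of_tree T A) * card (rt_Aut T) = fact (card A)"
proof -
  have f: "finite (labellings T A)"
    using branching_tree_finite_leaves[OF T] A(1) unfolding labellings_def
    by (intro finite_subset[OF _ finite_PiE[of "leaves T" "\<lambda>_. A"]]) auto
  have "fact (card A) = card (labellings T A)"
    by (rule card_labellings[symmetric, OF branching_tree_finite_leaves[OF T] A])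
  also have "\<dots> = (\<Sum>l\<in>labellings T A. 1)" by simp
  also have "\<dots> = (\<Sum>H\<in>hierarchies_of_tree T A. \<Sum>l\<in>{l \<in> labellings T A. tree_hierarchy T l = H}. 1)"
    unfolding hierarchies_of_tree_def by (rule sum.group[symmetric]) (use f in auto)
  also have "\<dots> = (\<Sum>H\<in>hierarchies_of_tree T A. card (rt_Aut T))"
  proof (rule sum.cong[OF refl])
    fix H assume "H \<in> hierarchies_of_tree T A"
    then obtain l0 where "bij_betw l0 (leaves T) A" "H = tree_hierarchy T l0"
      by (auto simp: hierarchies_of_tree_def labellings_def)
    then show "(\<Sum>l\<in>{l \<in> labellings T A. tree_hierarchy T l = H}. 1) = card (rt_Aut T)"
      using card_labellings_same_hierarchy[OF T] by simp
  qed
  finally show ?thesis by simp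
qed

text \<open>
  The members of the hierarchy, numbered by an injection \<open>e\<close> into the naturals, are the vertices; the
  arcs go from a member to its maximal proper submembers, and the leaves are the singletons.
\<close>

lemma hierarchy_realized:
  fixes A :: "'i set"
  assumes A: "finite A" "A \<noteq> {}" and H: "hierarchy_on A H"
  obtains T :: "nat rooted_graph" and l where "branching_tree T" "card (leaves T) = card A"
    "bij_betw l (leaves T) A" "tree_hierarchy T l = H"
proof -
  have fH: "finite H" by (rule finite_hierarchy[OF A(1) H])
  obtain e :: "'i set \<Rightarrow> nat" where e: "inj_on e H"
    using finite_imp_inj_to_nat_seg[OF fH] by blast
  have eq: "B = C" if "e B = e C" "B \<in> H" "C \<in> H" for B C using inj_onD[OF e that] .
  define T where "T = \<lparr>rt_verts = e ` H, rt_arcs = {(e B, e C) | B C. B \<in> H \<and> C \<in> subblocks H B}, rt_root = e A\<rparr>"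
  define l where "l x = the_elem (inv_into H e x)" for x
  note HD = hierarchy_onD[OF H]
  have kH: "C \<in> H" "C \<subset> B" if "C \<in> subblocks H B" for B C using that by (auto simp: subblocks_def)
  have arc: "(e B, e C) \<in> rt_arcs T \<longleftrightarrow> C \<in> subblocks H B" if "B \<in> H" "C \<in> H" for B C
    using that eq kH by (auto simp: T_def) metis
  have finB: "finite B" if "B \<in> H" for B using HD(2)[OF that] A(1) by (rule finite_subset)
  have down: "(e B, e C) \<in> (rt_arcs T)\<^sup>*" if "B \<in> H" "C \<in> H" "C \<subseteq> B" for B C
    using that
  proof (induction "card B" arbitrary: B rule: less_induct)
    case less
    show ?case
    proof (cases "C = B")
      case False
      then have "C \<subset> B" using less.prems by blast
      then obtain K where K: "K \<in> subblocks H B" "C \<subseteq> K"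
        using ex_subblock[OF A(1) H less.prems(1,2)] by blast
      have "(e K, e C) \<in> (rt_arcs T)\<^sup>*"
        using kH[OF K(1)] K(2) less.prems finB by (intro less.hyps psubset_card_mono) auto
      moreover have "(e B, e K) \<in> rt_arcs T" using arc kH K less.prems by blast
      ultimately show ?thesis by (meson converse_rtrancl_into_rtrancl)
    qed simp
  qed
  have up: "\<exists>C\<in>H. y = e C \<and> C \<subseteq> B" if "(e B, y) \<in> (rt_arcs T)\<^sup>*" "B \<in> H" for B y
    using that(1)
  proof (induction rule: rtrancl_induct)
    case base
    then show ?case using that(2) by blast
  next
    case (step y z)
    then obtain C where C: "C \<in> H" "y = e C" "C \<subseteq> B" by blast
    obtain C' D where D: "y = e C'" "z = e D" "C' \<in> H" "D \<in> subblocks H C'" using step.hyps(2) by (auto simp: T_def)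
    then have "C' = C" using eq C by metis
    then show ?case using D C kH[OF D(4)] by blast
  qed
  have parent: "\<exists>!u. (u, e C) \<in> rt_arcs T" if C: "C \<in> H" "C \<noteq> A" for C
  proof -
    have "\<exists>B\<in>H. C \<in> subblocks H B"
    proof -
      define S where "S = {D \<in> H. C \<subset> D}"
      have "finite S" "A \<in> S" using fH HD(1) HD(2)[OF C(1)] C(2) by (auto simp: S_def)
      then obtain B where B: "B \<in> S" "\<And>D. D \<in> S \<Longrightarrow> D \<subseteq> B \<Longrightarrow> B = D"
        using finite_has_minimal2[of S A] by metis
      have "\<not> (C \<subset> D \<and> D \<subset> B)" if "D \<in> H" for D using B(2)[of D] that by (auto simp: S_def)
      then have "C \<in> subblocks H B" using B(1) C(1) by (auto simp: subblocks_def S_def)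
      then show ?thesis using B(1) by (auto simp: S_def)
    qed
    then obtain B where B: "B \<in> H" "C \<in> subblocks H B" by blast
    show ?thesis
    proof (rule ex1I[of _ "e B"])
      show "(e B, e C) \<in> rt_arcs T" using arc B C(1) by blast
      fix u assume "(u, e C) \<in> rt_arcs T"
      then obtain B' C' where "u = e B'" "e C = e C'" "B' \<in> H" "C' \<in> subblocks H B'" by (auto simp: T_def)
      then have B': "u = e B'" "B' \<in> H" "C \<in> subblocks H B'" using eq[OF _ C(1), of C'] kH by auto
      have "B \<inter> B' \<noteq> {}" using kH[OF B(2)] kH[OF B'(3)] HD(3)[OF C(1)] by blast
      then have "B \<subseteq> B' \<or> B' \<subseteq> B" using HD(5)[OF B(1) B'(2)] by blast
      moreover have "\<not> B \<subset> B'" using B'(3) B(1) kH[OF B(2)] by (auto simp: subblocks_def)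
      moreover have "\<not> B' \<subset> B" using B(2) B'(2) kH[OF B'(3)] by (auto simp: subblocks_def)
      ultimately show "u = e B" using B'(1) by blast
    qed
  qed
  have rt: "rooted_tree T"
    unfolding rooted_tree_def
  proof (intro conjI ballI allI)
    show "finite (rt_verts T)" "rt_root T \<in> rt_verts T" using fH HD(1) by (auto simp: T_def)
    show "rt_arcs T \<subseteq> rt_verts T \<times> rt_verts T" using kH by (auto simp: T_def)
    show "(u, rt_root T) \<notin> rt_arcs T" for u
    proof
      assume "(u, rt_root T) \<in> rt_arcs T"
      then obtain B C where "e A = e C" "B \<in> H" "C \<in> subblocks H B" by (auto simp: T_def)
      then show False using eq[OF _ HD(1), of C] kH HD(2) by blast
    qed
    show "\<exists>!u. (u, v) \<in> rt_arcs T" if v: "v \<in> rt_verts T - {rt_root T}" for v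
    proof -
      obtain C where "v = e C" "C \<in> H" "C \<noteq> A" using v by (auto simp: T_def)
      then show ?thesis using parent[of C] by simp
    qed
    show "(rt_root T, v) \<in> (rt_arcs T)\<^sup>*" if v: "v \<in> rt_verts T" for v
    proof -
      obtain C where "v = e C" "C \<in> H" using v by (auto simp: T_def)
      then show ?thesis using down[OF HD(1) _ HD(2), of C] by (simp add: T_def)
    qed
  qed
  have ch: "children T (e B) = e ` subblocks H B" if B: "B \<in> H" for B
  proof
    show "e ` subblocks H B \<subseteq> children T (e B)" using B by (auto simp: children_def T_def)
    show "children T (e B) \<subseteq> e ` subblocks H B"
    proof
      fix x assume "x \<in> children T (e B)"
      then obtain B' C where x: "e B = e B'" "x = e C" "B' \<in> H" "C \<in> subblocks H B'"
        by (auto simp: children_def T_def)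
      then have "B' = B" using eq[OF x(1) B x(3)] by simp
      then show "x \<in> e ` subblocks H B" using x by simp
    qed
  qed
  have single: "subblocks H {a} = {}" for a
  proof -
    have False if "C \<in> subblocks H {a}" for C
    proof -
      have "C = {}" using kH(2)[OF that] by blast
      then show False using HD(3)[OF kH(1)[OF that]] by blast
    qed
    then show ?thesis by blast
  qed
  have big: "2 \<le> card B" if B: "B \<in> H" "B \<notin> (\<lambda>a. {a}) ` A" for B
  proof -
    have "card B \<noteq> 0" using HD(3)[OF B(1)] finB[OF B(1)] by simp
    moreover have "card B \<noteq> 1" using B(2) HD(2)[OF B(1)] by (auto simp: card_1_singleton_iff)
    ultimately show ?thesis by linarith
  qed
  have lv: "leaves T = e ` (\<lambda>a. {a}) ` A"
  proof
    show "leaves T \<subseteq> e ` (\<lambda>a. {a}) ` A"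
    proof
      fix x assume "x \<in> leaves T"
      then obtain B where B: "x = e B" "B \<in> H" "children T (e B) = {}" by (auto simp: leaves_def T_def)
      then have "subblocks H B = {}" using ch by simp
      then have "\<not> 2 \<le> card B" using card_subblocks[OF A(1) H B(2)] by auto
      then have "B \<in> (\<lambda>a. {a}) ` A" using big[OF B(2)] by argo
      then show "x \<in> e ` (\<lambda>a. {a}) ` A" unfolding B(1) by (rule imageI)
    qed
    show "e ` (\<lambda>a. {a}) ` A \<subseteq> leaves T"
    proof
      fix x assume "x \<in> e ` (\<lambda>a. {a}) ` A"
      then obtain a where a: "x = e {a}" "a \<in> A" by blast
      have "children T x = {}" using ch[OF HD(4)[OF a(2)]] single a(1) by simp
      moreover have "x \<in> rt_verts T" using HD(4)[OF a(2)] a(1) by (simp add: T_def)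
      ultimately show "x \<in> leaves T" by (simp add: leaves_def)
    qed
  qed
  have ch2: "num_children T u \<ge> 2" if u: "u \<in> parents T" for u
  proof -
    obtain B where B: "u = e B" "B \<in> H" "u \<notin> leaves T" using u by (auto simp: parents_def T_def)
    then have "B \<notin> (\<lambda>a. {a}) ` A" unfolding lv by blast
    then have "2 \<le> card B" by (rule big[OF B(2)])
    then have "2 \<le> card (subblocks H B)" by (rule card_subblocks[OF A(1) H B(2)])
    moreover have "card (e ` subblocks H B) = card (subblocks H B)"
      using e kH by (intro card_image) (auto intro: inj_on_subset)
    ultimately show ?thesis using ch[OF B(2)] B(1) by (simp add: num_children_def)
  qed
  have bt: "branching_tree T" using rt ch2 by unfold_locales
  have le: "l (e {a}) = a" if "a \<in> A" for a using HD(4)[OF that] e by (simp add: l_def)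
  have bl: "bij_betw l (leaves T) A"
    unfolding bij_betw_def lv using le by (auto simp: inj_on_def image_image)
  have ls: "l ` leaf_set T (e B) = B" if B: "B \<in> H" for B
  proof
    show "l ` leaf_set T (e B) \<subseteq> B"
    proof
      fix b assume "b \<in> l ` leaf_set T (e B)"
      then obtain a where a: "a \<in> A" "(e B, e {a}) \<in> (rt_arcs T)\<^sup>*" "b = a"
        using le by (auto simp: leaf_set_def descendants_def lv)
      then obtain C where "C \<in> H" "e {a} = e C" "C \<subseteq> B" using up[OF a(2) B] by blast
      then show "b \<in> B" using eq[OF _ HD(4)[OF a(1)]] a(3) by blast
    qed
    show "B \<subseteq> l ` leaf_set T (e B)"
    proof
      fix b assume b: "b \<in> B"
      then have bA: "b \<in> A" using HD(2)[OF B] by blast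
      have "(e B, e {b}) \<in> (rt_arcs T)\<^sup>*" using down[OF B HD(4)[OF bA]] b by blast
      then have "e {b} \<in> leaf_set T (e B)" using bA by (auto simp: leaf_set_def descendants_def lv)
      then show "b \<in> l ` leaf_set T (e B)" using le[OF bA] by (metis imageI)
    qed
  qed
  have "tree_hierarchy T l = H"
    using ls by (simp add: tree_hierarchy_def T_def image_image)
  then show ?thesis using that[OF bt _ bl] bij_betw_same_card[OF bl] by blast
qed


section \<open>From isomorphism classes to hierarchies\<close>

lemma branching_treesD:
  assumes "T \<in> branching_trees m"
  shows "branching_tree T" "card (leaves T) = m"
  using assms by (auto simp: branching_trees_def intro: branching_tree.intro)

lemma branching_treesI:
  assumes "branching_tree T" "card (leaves T) = m"
  shows "T \<in> branching_trees m"
  using assms by (auto simp: branching_trees_def branching_tree_def)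

abbreviation iso_rel :: "nat \<Rightarrow> (nat rooted_graph \<times> nat rooted_graph) set" where
  "iso_rel m \<equiv> {(T, T'). T \<in> branching_trees m \<and> T' \<in> branching_trees m \<and> rt_isomorphic T T'}"

lemma equiv_iso: "equiv (branching_trees m) (iso_rel m)"
proof (rule equivI)
  show "iso_rel m \<subseteq> branching_trees m \<times> branching_trees m" by blast
  show "refl_on (branching_trees m) (iso_rel m)"
    by (rule refl_onI) (auto simp: rt_isomorphic_refl)
  show "sym (iso_rel m)"
  proof (rule symI)
    fix T T' assume "(T, T') \<in> iso_rel m"
    then have T: "T \<in> branching_trees m" "T' \<in> branching_trees m" and "rt_isomorphic T T'" by auto
    then obtain \<phi> where "tree_iso \<phi> T T'" by (auto simp: rt_isomorphic_iff)
    then have "rt_isomorphic T' T"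
      using tree_iso_inv branching_tree.root_V[OF branching_treesD(1)[OF T(1)]]
      by (auto simp: rt_isomorphic_iff)
    then show "(T', T) \<in> iso_rel m" using T by simp
  qed
  show "trans (iso_rel m)"
  proof (rule transI)
    fix T T' T'' assume a: "(T, T') \<in> iso_rel m" "(T', T'') \<in> iso_rel m"
    then obtain \<phi> \<psi> where "tree_iso \<phi> T T'" "tree_iso \<psi> T' T''" by (auto simp: rt_isomorphic_iff)
    then have "rt_isomorphic T T''" unfolding rt_isomorphic_iff by (blast intro: tree_iso_comp)
    then show "(T, T'') \<in> iso_rel m" using a by simp
  qed
qed

lemma rep_in_class:
  assumes "\<tau> \<in> UTP m"
  shows "rep \<tau> \<in> \<tau>" "rep \<tau> \<in> branching_trees m"
proof -
  have \<tau>: "\<tau> \<in> branching_trees m // iso_rel m" using assms by (simp add: UTP_def)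
  have "\<tau> \<noteq> {}" by (rule in_quotient_imp_non_empty[OF equiv_iso \<tau>])
  then show "rep \<tau> \<in> \<tau>" unfolding rep_def by (simp add: some_in_eq)
  moreover have "\<tau> \<subseteq> branching_trees m" by (rule in_quotient_imp_subset[OF equiv_iso \<tau>])
  ultimately show "rep \<tau> \<in> branching_trees m" by blast
qed

lemma UTP_eq_of_common_hierarchy:
  assumes \<tau>: "\<tau> \<in> UTP m" "\<tau>' \<in> UTP m"
    and H: "H \<in> hierarchies_of_tree (rep \<tau>) A" "H \<in> hierarchies_of_tree (rep \<tau>') A"
  shows "\<tau> = \<tau>'"
proof -
  obtain l l' where l: "bij_betw l (leaves (rep \<tau>)) A" "H = tree_hierarchy (rep \<tau>) l"
    and l': "bij_betw l' (leaves (rep \<tau>')) A" "H = tree_hierarchy (rep \<tau>') l'"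
    using H by (auto simp: hierarchies_of_tree_def labellings_def)
  note r = rep_in_class[OF \<tau>(1)] rep_in_class[OF \<tau>(2)]
  have eq: "tree_hierarchy (rep \<tau>) l = tree_hierarchy (rep \<tau>') l'" using l l' by simp
  obtain \<phi> where "tree_iso \<phi> (rep \<tau>) (rep \<tau>')"
    by (rule tree_iso_of_tree_hierarchy_eq[OF branching_treesD(1)[OF r(2)] branching_treesD(1)[OF r(4)] l(1) l'(1) eq])
  then have "(rep \<tau>, rep \<tau>') \<in> iso_rel m" using r by (auto simp: rt_isomorphic_iff)
  then show ?thesis
    using quotient_eqI[OF equiv_iso _ _ r(1) r(3)] \<tau> by (simp add: UTP_def)
qed

lemma hierarchy_in_UTP:
  assumes A: "finite A" "A \<noteq> {}" "card A = m" and H: "hierarchy_on A H"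
  obtains \<tau> where "\<tau> \<in> UTP m" "H \<in> hierarchies_of_tree (rep \<tau>) A"
proof -
  obtain T :: "nat rooted_graph" and l where T: "branching_tree T" "card (leaves T) = card A"
    and l: "bij_betw l (leaves T) A" "tree_hierarchy T l = H"
    by (rule hierarchy_realized[OF A(1,2) H])
  have Tm: "T \<in> branching_trees m" using T A(3) by (intro branching_treesI) auto
  define \<tau> where "\<tau> = iso_rel m `` {T}"
  have \<tau>: "\<tau> \<in> UTP m" unfolding UTP_def \<tau>_def by (rule quotientI[OF Tm])
  note r = rep_in_class[OF \<tau>]
  have "rt_isomorphic T T'" if "T' \<in> \<tau>" for T' using that by (simp add: \<tau>_def)
  then have "rt_isomorphic T (rep \<tau>)" using r(1) by blast
  then obtain \<psi> where \<psi>: "tree_iso \<psi> T (rep \<tau>)" by (auto simp: rt_isomorphic_iff)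
  define \<phi> where "\<phi> = inv_into (rt_verts T) \<psi>"
  have \<phi>: "tree_iso \<phi> (rep \<tau>) T"
    unfolding \<phi>_def by (rule tree_iso_inv[OF \<psi> branching_tree.root_V[OF T(1)]])
  note br = branching_treesD(1)[OF r(2)]
  let ?l = "restrict (l \<circ> \<phi>) (leaves (rep \<tau>))"
  have b: "bij_betw (l \<circ> \<phi>) (leaves (rep \<tau>)) A"
    by (rule bij_betw_trans[OF tree_iso_leaves[OF br T(1) \<phi>] l(1)])
  then have "bij_betw ?l (leaves (rep \<tau>)) A" by (simp cong: bij_betw_cong)
  moreover have "?l \<in> PiE (leaves (rep \<tau>)) (\<lambda>_. A)" using bij_betwE[OF b] by auto
  moreover have "tree_hierarchy (rep \<tau>) ?l = H"
    using tree_iso_tree_hierarchy[OF br T(1) \<phi>, of l] tree_hierarchy_cong[of "rep \<tau>" ?l "l \<circ> \<phi>"] l(2)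
    by simp
  ultimately have "H \<in> hierarchies_of_tree (rep \<tau>) A"
    unfolding hierarchies_of_tree_def labellings_def by (intro image_eqI[of _ _ ?l]) simp_all
  then show ?thesis by (rule that[OF \<tau>])
qed

text \<open>
  Each hierarchy belongs to exactly one isomorphism class \<open>\<tau>\<close>, and the class \<open>\<tau>\<close> has \<open>m!/\<bar>Aut \<tau>\<bar>\<close> of them.
  The weight of a hierarchy is the product of \<open>g\<close> over the parents of any tree that realizes it. That
  \<open>UTP m\<close> is finite also comes out of this correspondence.
\<close>

theorem UTP_sum_eq_hierarchy_sum:
  fixes g :: "nat \<Rightarrow> nat \<Rightarrow> complex"
  assumes A: "finite A" "A \<noteq> {}" "card A = m"
  shows "(\<Sum>\<tau>\<in>UTP m. fact m / of_nat (card (rt_Aut (rep \<tau>))) *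
      (\<Prod>u\<in>parents (rep \<tau>). g (num_children (rep \<tau>) u) (dl (rep \<tau>) u))) = hierarchy_sum g A"
proof -
  let ?Hs = "{H. hierarchy_on A H}"
  let ?H = "\<lambda>\<tau>. hierarchies_of_tree (rep \<tau>) A"
  define cls where "cls H = (THE \<tau>. \<tau> \<in> UTP m \<and> H \<in> ?H \<tau>)" for H
  have cls_eq: "cls H = \<tau>" if "\<tau> \<in> UTP m" "H \<in> ?H \<tau>" for H \<tau>
    unfolding cls_def using that UTP_eq_of_common_hierarchy by (intro the_equality) blast+
  have sub: "hierarchy_on A H" if t: "\<tau> \<in> UTP m" "H \<in> ?H \<tau>" for \<tau> H
  proof -
    obtain l where "bij_betw l (leaves (rep \<tau>)) A" "H = tree_hierarchy (rep \<tau>) l"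
      using t(2) by (auto simp: hierarchies_of_tree_def labellings_def)
    then show ?thesis
      using branching_tree.hierarchy_tree_hierarchy[OF branching_treesD(1)[OF rep_in_class(2)[OF t(1)]]]
      by simp
  qed
  have cls_Hs: "cls H \<in> UTP m \<and> H \<in> ?H (cls H)" if H: "H \<in> ?Hs" for H
  proof -
    obtain \<tau> where "\<tau> \<in> UTP m" "H \<in> ?H \<tau>" by (rule hierarchy_in_UTP[OF A, of H]) (use H in auto)
    then show ?thesis using cls_eq[of \<tau> H] by simp
  qed
  have fibre: "{H \<in> ?Hs. cls H = \<tau>} = ?H \<tau>" if "\<tau> \<in> UTP m" for \<tau>
    using cls_eq[OF that] sub[OF that] cls_Hs by auto
  have cards: "card (?H \<tau>) * card (rt_Aut (rep \<tau>)) = fact m" if "\<tau> \<in> UTP m" for \<tau>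
    using card_hierarchies_of_tree[OF branching_treesD(1)[OF rep_in_class(2)[OF that]] A(1)]
      branching_treesD(2)[OF rep_in_class(2)[OF that]] A(3) by simp
  have "UTP m \<subseteq> cls ` ?Hs"
  proof
    fix \<tau> assume \<tau>: "\<tau> \<in> UTP m"
    have "?H \<tau> \<noteq> {}"
    proof
      assume "?H \<tau> = {}"
      then show False using cards[OF \<tau>] by simp
    qed
    then obtain H where H: "H \<in> ?H \<tau>" by blast
    have "\<tau> = cls H" by (rule cls_eq[OF \<tau> H, symmetric])
    moreover have "H \<in> ?Hs" using sub[OF \<tau> H] by simp
    ultimately show "\<tau> \<in> cls ` ?Hs" by (rule image_eqI)
  qed
  then have finU: "finite (UTP m)"
    using finite_hierarchies[OF A(1)] by (meson finite_imageI finite_subset)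
  have "hierarchy_sum g A = (\<Sum>\<tau>\<in>UTP m. \<Sum>H\<in>{H \<in> ?Hs. cls H = \<tau>}. hierarchy_weight g H)"
    unfolding hierarchy_sum_def
    by (rule sum.group[symmetric]) (use finite_hierarchies[OF A(1)] finU cls_Hs in auto)
  also have "\<dots> = (\<Sum>\<tau>\<in>UTP m. fact m / of_nat (card (rt_Aut (rep \<tau>))) *
      (\<Prod>u\<in>parents (rep \<tau>). g (num_children (rep \<tau>) u) (dl (rep \<tau>) u)))"
  proof (rule sum.cong[OF refl])
    fix \<tau> assume \<tau>: "\<tau> \<in> UTP m"
    let ?W = "\<Prod>u\<in>parents (rep \<tau>). g (num_children (rep \<tau>) u) (dl (rep \<tau>) u)"
    have "hierarchy_weight g H = ?W" if "H \<in> ?H \<tau>" for H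
      using that branching_tree.weight_tree_hierarchy[OF branching_treesD(1)[OF rep_in_class(2)[OF \<tau>]], of _ A g]
      by (auto simp: hierarchies_of_tree_def labellings_def)
    then have "(\<Sum>H\<in>?H \<tau>. hierarchy_weight g H) = of_nat (card (?H \<tau>)) * ?W" by simp
    moreover have "of_nat (card (?H \<tau>)) = (fact m / of_nat (card (rt_Aut (rep \<tau>))) :: complex)"
    proof -
      have "of_nat (card (?H \<tau>)) * of_nat (card (rt_Aut (rep \<tau>))) = (fact m :: complex)"
        using cards[OF \<tau>] by (metis of_nat_fact of_nat_mult)
      moreover have "card (rt_Aut (rep \<tau>)) \<noteq> 0"
      proof
        assume "card (rt_Aut (rep \<tau>)) = 0"
        then show False using cards[OF \<tau>] by simp
      qed
      ultimately show ?thesis by (simp add: eq_divide_eq)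
    qed
    ultimately show "(\<Sum>H\<in>{H \<in> ?Hs. cls H = \<tau>}. hierarchy_weight g H) =
        fact m / of_nat (card (rt_Aut (rep \<tau>))) * ?W" unfolding fibre[OF \<tau>] by simp
  qed
  finally show ?thesis by simp
qed



section \<open>Valuation and absolute value\<close>

locale dvr = principal_domain R for R (structure) +
  fixes p
  assumes p_closed: "p \<in> carrier R" and p_nonzero: "p \<noteq> \<zero>"
    and max_ideal_eq: "max_ideal R = PIdl p" and maximal: "maximalideal (PIdl p) R"

lemma discrete_valuation_ring_dvr:
  assumes "discrete_valuation_ring R"
  obtains p where "dvr R p"
proof -
  interpret principal_domain R using assms by (simp add: discrete_valuation_ring_def)
  have ex: "\<exists>!I. maximalideal I R" and nf: "\<not> Ring.field R"
    using assms by (auto simp: discrete_valuation_ring_def)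
  have m: "maximalideal (max_ideal R) R" unfolding max_ideal_def by (rule theI'[OF ex])
  then have "ideal (max_ideal R) R" by (simp add: maximalideal_def)
  then obtain p where p: "p \<in> carrier R" "max_ideal R = PIdl\<^bsub>R\<^esub> p" using exists_gen by blast
  have "p \<noteq> \<zero>\<^bsub>R\<^esub>"
  proof
    assume "p = \<zero>\<^bsub>R\<^esub>"
    then have "PIdl\<^bsub>R\<^esub> p = {\<zero>\<^bsub>R\<^esub>}" using one_closed by (force simp: cgenideal_def)
    then show False using m p nf zeromaximalideal_eq_field by simp
  qed
  then have "dvr R p" using p m by (intro dvr.intro dvr_axioms.intro principal_domain_axioms) simp_all
  then show ?thesis by (rule that)
qed

context dvr
begin

abbreviation P :: "nat \<Rightarrow> 'a set" where
  "P k \<equiv> ideal_power R (max_ideal R) k"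

lemma P_0: "P 0 = carrier R"
  by (simp add: ideal_power_def)

lemma mem_PIdl: "x \<in> PIdl a \<longleftrightarrow> (\<exists>y\<in>carrier R. x = y \<otimes> a)"
  by (auto simp: cgenideal_def)

lemma P_eq: "P k = PIdl (p [^] k)"
proof (induction k)
  case 0
  show ?case
  proof
    show "P 0 \<subseteq> PIdl (p [^] (0::nat))"
    proof
      fix x assume "x \<in> P 0"
      then have "x \<in> carrier R" "x = x \<otimes> p [^] (0::nat)" by (simp_all add: P_0)
      then show "x \<in> PIdl (p [^] (0::nat))" unfolding mem_PIdl by blast
    qed
    show "PIdl (p [^] (0::nat)) \<subseteq> P 0" by (auto simp: P_0 mem_PIdl)
  qed
next
  case (Suc k)
  have "P (Suc k) = (PIdl p) \<cdot> (PIdl (p [^] k))"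
    using Suc by (simp add: ideal_power_def max_ideal_eq)
  also have "\<dots> = PIdl (p [^] Suc k)"
  proof
    have J: "ideal (PIdl (p [^] Suc k)) R" using p_closed by (intro cgenideal_ideal) simp
    show "(PIdl p) \<cdot> (PIdl (p [^] k)) \<subseteq> PIdl (p [^] Suc k)"
    proof
      fix x assume "x \<in> (PIdl p) \<cdot> (PIdl (p [^] k))"
      then show "x \<in> PIdl (p [^] Suc k)"
      proof (induction rule: ideal_prod.induct)
        case (prod i j)
        then obtain a b where ab: "a \<in> carrier R" "i = a \<otimes> p" "b \<in> carrier R" "j = b \<otimes> p [^] k"
          by (auto simp: mem_PIdl)
        then have "i \<otimes> j = (a \<otimes> b) \<otimes> p [^] Suc k"
          using p_closed by (simp add: m_ac)
        then show ?case using ab by (auto simp: mem_PIdl)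
      qed (rule additive_subgroup.a_closed[OF ideal.axioms(1)[OF J]])
    qed
    show "PIdl (p [^] Suc k) \<subseteq> (PIdl p) \<cdot> (PIdl (p [^] k))"
    proof
      fix x assume "x \<in> PIdl (p [^] Suc k)"
      then obtain y where y: "y \<in> carrier R" "x = y \<otimes> p [^] Suc k" by (auto simp: mem_PIdl)
      then have "x = p \<otimes> (y \<otimes> p [^] k)" using p_closed by (simp add: m_ac)
      moreover have "p \<in> PIdl p" "y \<otimes> p [^] k \<in> PIdl (p [^] k)"
        using y p_closed cgenideal_self by (auto simp: mem_PIdl)
      ultimately show "x \<in> (PIdl p) \<cdot> (PIdl (p [^] k))" by (auto intro: ideal_prod.prod)
    qed
  qed
  finally show ?case .
qed

lemma ideal_P: "ideal (P k) R"
  unfolding P_eq using p_closed by (intro cgenideal_ideal) simp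

lemma P_carrier: "x \<in> P k \<Longrightarrow> x \<in> carrier R"
  using ideal.Icarr[OF ideal_P] .

lemma P_add: "x \<in> P k \<Longrightarrow> y \<in> P k \<Longrightarrow> x \<oplus> y \<in> P k"
  and P_zero: "\<zero> \<in> P k"
  and P_minus: "x \<in> P k \<Longrightarrow> \<ominus> x \<in> P k"
  using ideal_P[of k] unfolding ideal_def
  by (auto intro: additive_subgroup.a_closed additive_subgroup.zero_closed additive_subgroup.a_inv_closed
      ring.ring_simprules)

lemma P_1: "P (Suc 0) = PIdl p"
  using p_closed by (simp add: P_eq)

lemma p_mult_mem_P_iff:
  assumes y: "y \<in> carrier R"
  shows "p \<otimes> y \<in> P (Suc k) \<longleftrightarrow> y \<in> P k"
proof
  assume "p \<otimes> y \<in> P (Suc k)"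
  then obtain z where z: "z \<in> carrier R" "p \<otimes> y = z \<otimes> p [^] Suc k" by (auto simp: P_eq mem_PIdl)
  then have "p \<otimes> y = p \<otimes> (z \<otimes> p [^] k)" using p_closed by (simp add: m_ac)
  moreover have "z \<otimes> p [^] k \<in> carrier R" using z(1) p_closed by simp
  ultimately have "y = z \<otimes> p [^] k" using m_lcancel[OF p_nonzero p_closed y] by blast
  then show "y \<in> P k" using z by (auto simp: P_eq mem_PIdl)
next
  assume "y \<in> P k"
  then obtain z where z: "z \<in> carrier R" "y = z \<otimes> p [^] k" by (auto simp: P_eq mem_PIdl)
  then have "p \<otimes> y = z \<otimes> p [^] Suc k" using p_closed by (simp add: m_ac)
  then show "p \<otimes> y \<in> P (Suc k)" using z by (auto simp: P_eq mem_PIdl)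
qed

lemma P_Suc_subset: "P (Suc k) \<subseteq> P k"
proof
  fix x assume "x \<in> P (Suc k)"
  then obtain z where z: "z \<in> carrier R" "x = z \<otimes> p [^] Suc k" by (auto simp: P_eq mem_PIdl)
  then have "x = (z \<otimes> p) \<otimes> p [^] k" using p_closed by (simp add: m_ac)
  then show "x \<in> P k" using z p_closed by (auto simp: P_eq mem_PIdl)
qed

lemma P_antimono: "j \<le> k \<Longrightarrow> P k \<subseteq> P j"
  by (rule lift_Suc_antimono_le[of P]) (rule P_Suc_subset)

lemma mem_P_1E:
  assumes "x \<in> P (Suc 0)"
  obtains y where "y \<in> carrier R" "x = p \<otimes> y"
proof -
  obtain z where "z \<in> carrier R" "x = z \<otimes> p" using assms by (auto simp: P_1 mem_PIdl)
  then show ?thesis using that[of z] p_closed by (simp add: m_comm)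
qed

lemma one_notin_P_1: "\<one> \<notin> P (Suc 0)"
proof
  assume "\<one> \<in> P (Suc 0)"
  then have "PIdl p = carrier R"
    using ideal.one_imp_carrier[OF ideal_P[of "Suc 0"]] by (simp add: P_1)
  then show False using maximalideal.I_notcarr[OF maximal] by simp
qed

lemma P_1_prime:
  assumes "x \<in> carrier R" "y \<in> carrier R" "x \<otimes> y \<in> P (Suc 0)"
  shows "x \<in> P (Suc 0) \<or> y \<in> P (Suc 0)"
  using primeideal.I_prime[OF maximalideal_prime[OF maximal]] assms by (simp add: P_1)

text \<open>
  A nonzero \<open>x\<close> in every power of the maximal ideal could be divided by \<open>p\<close> forever. The quotients
  generate an ascending chain of ideals, which becomes stationary because \<open>R\<close> is noetherian; at that
  point \<open>p\<close> would be a unit.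
\<close>

lemma ex_notin_P:
  assumes x: "x \<in> carrier R" "x \<noteq> \<zero>"
  shows "\<exists>k. x \<notin> P k"
proof (rule ccontr)
  assume "\<nexists>k. x \<notin> P k"
  then have all: "x \<in> P k" for k by blast
  have "\<exists>y. y \<in> carrier R \<and> x = y \<otimes> p [^] k" for k :: nat using all[of k] by (auto simp: P_eq mem_PIdl)
  then obtain y where y: "\<And>k :: nat. y k \<in> carrier R" "\<And>k :: nat. x = y k \<otimes> p [^] k" by metis
  have step: "y k = p \<otimes> y (Suc k)" for k
  proof -
    have "p [^] k \<noteq> \<zero>"
    proof
      assume "p [^] k = \<zero>"
      then show False using x(2) y(2)[of k] y(1)[of k] by simp
    qed
    moreover have "p [^] k \<otimes> y k = p [^] k \<otimes> (p \<otimes> y (Suc k))"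
      using y(2)[of k] y(2)[of "Suc k"] y(1)[of k] y(1)[of "Suc k"] p_closed by (simp add: m_ac)
    ultimately show ?thesis using m_lcancel[of "p [^] k"] p_closed y(1) by simp
  qed
  let ?C = "range (\<lambda>k. PIdl (y k))"
  have mono: "PIdl (y j) \<subseteq> PIdl (y k)" if "j \<le> k" for j k
  proof (rule lift_Suc_mono_le[OF _ that])
    fix k
    show "PIdl (y k) \<subseteq> PIdl (y (Suc k))"
    proof
      fix z assume "z \<in> PIdl (y k)"
      then obtain a where "a \<in> carrier R" "z = a \<otimes> y k" by (auto simp: mem_PIdl)
      then have "z = (a \<otimes> p) \<otimes> y (Suc k)" "a \<otimes> p \<in> carrier R"
        using step[of k] p_closed y(1) by (simp_all add: m_assoc)
      then show "z \<in> PIdl (y (Suc k))" by (auto simp: mem_PIdl)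
    qed
  qed
  have "subset.chain {I. ideal I R} ?C"
    unfolding subset_chain_def
  proof (intro conjI ballI)
    show "?C \<subseteq> {I. ideal I R}" using cgenideal_ideal[OF y(1)] by blast
    fix X Y assume "X \<in> ?C" "Y \<in> ?C"
    then obtain i j where "X = PIdl (y i)" "Y = PIdl (y j)" by blast
    then show "X \<subseteq> Y \<or> Y \<subseteq> X" using mono[of i j] mono[of j i] by (cases "i \<le> j") simp_all
  qed
  then have "\<Union>?C \<in> ?C" by (rule ideal_chain_is_trivial[rotated]) simp
  then obtain k where k: "\<Union>?C = PIdl (y k)" by (rule rangeE)
  have "y (Suc k) \<in> PIdl (y (Suc k))" using cgenideal_self y(1) by simp
  then have "y (Suc k) \<in> \<Union>?C" by (intro UnionI[OF rangeI])
  then have "y (Suc k) \<in> PIdl (y k)" unfolding k .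
  then obtain a where a: "a \<in> carrier R" "y (Suc k) = a \<otimes> y k" by (auto simp: mem_PIdl)
  have "y (Suc k) \<noteq> \<zero>" using x(2) y(2)[of "Suc k"] p_closed by auto
  moreover have "y (Suc k) \<otimes> \<one> = y (Suc k) \<otimes> (a \<otimes> p)"
    using a step[of k] y(1) p_closed by (simp add: m_ac)
  ultimately have "\<one> = a \<otimes> p" using m_lcancel[of "y (Suc k)" \<one> "a \<otimes> p"] y(1) a p_closed by simp
  then have "\<one> \<in> P (Suc 0)" using a by (auto simp: P_1 mem_PIdl)
  then show False using one_notin_P_1 by blast
qed

text \<open>
  By \<open>ex_notin_P\<close> the exponents in the definition of the valuation are bounded, so that its
  \<open>GREATEST\<close> is attained.
\<close>

lemma mem_P_iff_valuation:
  assumes x: "x \<in> carrier R" "x \<noteq> \<zero>"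
  shows "x \<in> P k \<longleftrightarrow> k \<le> valuation R x"
proof -
  obtain b where b: "x \<notin> P b" using ex_notin_P[OF x] by blast
  have bd: "k \<le> b" if "x \<in> P k" for k
    using P_antimono[of b k] b that by (meson linear subsetD)
  have "x \<in> P (valuation R x)"
    unfolding valuation_def by (rule GreatestI_nat[of _ 0 b]) (use P_0 x bd in auto)
  moreover have "k \<le> valuation R x" if "x \<in> P k"
    unfolding valuation_def by (rule Greatest_le_nat[of _ k b]) (use that bd in auto)
  moreover have "P (valuation R x) \<subseteq> P k" if "k \<le> valuation R x" using that by (rule P_antimono)
  ultimately show ?thesis by blast
qed

lemma valuation_unit:
  assumes "x \<in> carrier R" "x \<notin> P (Suc 0)"
  shows "valuation R x = 0"
proof -
  have "x \<noteq> \<zero>" using assms(2) P_zero by blast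
  then show ?thesis using mem_P_iff_valuation[OF assms(1), of "Suc 0"] assms(2) by simp
qed

lemma valuation_p_mult:
  assumes y: "y \<in> carrier R" "y \<noteq> \<zero>"
  shows "valuation R (p \<otimes> y) = Suc (valuation R y)"
proof -
  have py: "p \<otimes> y \<in> carrier R" "p \<otimes> y \<noteq> \<zero>" using y p_closed p_nonzero integral_iff by auto
  have "k \<le> valuation R (p \<otimes> y) \<longleftrightarrow> k \<le> Suc (valuation R y)" for k
  proof (cases k)
    case (Suc j)
    then show ?thesis
      using mem_P_iff_valuation[OF py, of k] mem_P_iff_valuation[OF y, of j] p_mult_mem_P_iff[OF y(1), of j]
      by simp
  qed simp
  then show ?thesis by (meson order_antisym order_refl)
qed

lemma dvr_abs_zero: "dvr_abs R \<zero> = 0"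
  by (simp add: dvr_abs_def)

lemma dvr_abs_unit: "x \<in> carrier R \<Longrightarrow> x \<notin> P (Suc 0) \<Longrightarrow> dvr_abs R x = 1"
  using P_zero by (auto simp: dvr_abs_def valuation_unit)

lemma dvr_abs_p_mult: "y \<in> carrier R \<Longrightarrow> dvr_abs R (p \<otimes> y) = dvr_abs R y / residue_card R"
  using p_closed p_nonzero by (auto simp: dvr_abs_def valuation_p_mult integral_iff)

lemma dvr_abs_nonneg: "0 \<le> dvr_abs R x"
  by (simp add: dvr_abs_def)

text \<open>
  Strip factors \<open>p\<close> from \<open>x\<close> and \<open>y\<close> until both are outside the maximal ideal; the product is then
  outside as well, because maximal ideals are prime.
\<close>

lemma dvr_abs_mult:
  assumes "x \<in> carrier R" "y \<in> carrier R"
  shows "dvr_abs R (x \<otimes> y) = dvr_abs R x * dvr_abs R y"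
proof (cases "x = \<zero> \<or> y = \<zero>")
  case True
  then show ?thesis using assms by (auto simp: dvr_abs_zero)
next
  case False
  then show ?thesis using assms
  proof (induction "valuation R x + valuation R y" arbitrary: x y rule: less_induct)
    case less
    show ?case
    proof (cases "x \<in> P (Suc 0)")
      case True
      then obtain x' where x': "x' \<in> carrier R" "x = p \<otimes> x'" by (rule mem_P_1E)
      then have nz: "x' \<noteq> \<zero>" using less.prems p_closed by auto
      have "dvr_abs R (x' \<otimes> y) = dvr_abs R x' * dvr_abs R y"
        using less.prems x' nz by (intro less.hyps) (auto simp: valuation_p_mult)
      moreover have "x \<otimes> y = p \<otimes> (x' \<otimes> y)" using x' less.prems p_closed by (simp add: m_assoc)
      ultimately show ?thesis using x' less.prems by (simp add: dvr_abs_p_mult)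
    next
      case xu: False
      show ?thesis
      proof (cases "y \<in> P (Suc 0)")
        case True
        then obtain y' where y': "y' \<in> carrier R" "y = p \<otimes> y'" by (rule mem_P_1E)
        then have nz: "y' \<noteq> \<zero>" using less.prems p_closed by auto
        have "dvr_abs R (x \<otimes> y') = dvr_abs R x * dvr_abs R y'"
          using less.prems y' nz by (intro less.hyps) (auto simp: valuation_p_mult)
        moreover have "x \<otimes> y = p \<otimes> (x \<otimes> y')" using y' less.prems p_closed by (simp add: m_ac)
        ultimately show ?thesis using y' less.prems by (simp add: dvr_abs_p_mult)
      next
        case False
        then have "x \<otimes> y \<notin> P (Suc 0)" using P_1_prime xu less.prems by blast
        then show ?thesis using False xu less.prems by (simp add: dvr_abs_unit)
      qed
    qed
  qed
qed

end


section \<open>Digit expansions\<close>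

context dvr
begin

lemma P_diff_self: "x \<in> carrier R \<Longrightarrow> x \<ominus> x \<in> P k"
  using P_zero by (simp add: r_neg a_minus_def)

lemma P_diff_sym:
  assumes "x \<in> carrier R" "y \<in> carrier R" "x \<ominus> y \<in> P k"
  shows "y \<ominus> x \<in> P k"
proof -
  have "y \<ominus> x = \<ominus> (x \<ominus> y)" using assms(1,2) by algebra
  then show ?thesis using P_minus[OF assms(3)] by simp
qed

lemma P_diff_trans:
  assumes "x \<in> carrier R" "y \<in> carrier R" "z \<in> carrier R" "x \<ominus> y \<in> P k" "y \<ominus> z \<in> P k"
  shows "x \<ominus> z \<in> P k"
proof -
  have "x \<ominus> z = (x \<ominus> y) \<oplus> (y \<ominus> z)" using assms(1-3) by algebra
  then show ?thesis using P_add[OF assms(4,5)] by simp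
qed

lemma mem_coset_iff:
  assumes "x \<in> carrier R"
  shows "y \<in> P k +> x \<longleftrightarrow> y \<in> carrier R \<and> y \<ominus> x \<in> P k"
proof
  assume "y \<in> P k +> x"
  then obtain h where h: "h \<in> P k" "y = h \<oplus> x" by (auto simp: a_r_coset_def')
  have hc: "h \<in> carrier R" by (rule P_carrier[OF h(1)])
  then have "y \<ominus> x = h" unfolding h(2) using assms by algebra
  then show "y \<in> carrier R \<and> y \<ominus> x \<in> P k" using h hc assms by simp
next
  assume y: "y \<in> carrier R \<and> y \<ominus> x \<in> P k"
  then have yc: "y \<in> carrier R" by simp
  have "y = (y \<ominus> x) \<oplus> x" using assms yc by algebra
  then show "y \<in> P k +> x" unfolding a_r_coset_def' using y by blast
qed

text \<open>
  The chosen element depends on the residue class of \<open>x\<close> only, since the predicate does; this makes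
  \<open>residue\<close> a system of representatives.
\<close>

definition residue :: "'a \<Rightarrow> 'a" where
  "residue x = (SOME y. y \<in> carrier R \<and> x \<ominus> y \<in> P (Suc 0))"

definition quotient :: "'a \<Rightarrow> 'a" where
  "quotient x = (SOME y. y \<in> carrier R \<and> x \<ominus> residue x = p \<otimes> y)"

abbreviation D :: "'a set" where
  "D \<equiv> residue ` carrier R"

lemma residue:
  assumes "x \<in> carrier R"
  shows "residue x \<in> carrier R" "x \<ominus> residue x \<in> P (Suc 0)"
proof -
  have "\<exists>y. y \<in> carrier R \<and> x \<ominus> y \<in> P (Suc 0)" using P_diff_self[OF assms] assms by blast
  from someI_ex[OF this] show "residue x \<in> carrier R" "x \<ominus> residue x \<in> P (Suc 0)"
    unfolding residue_def by blast+
qed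

lemma residue_eq_iff:
  assumes x: "x \<in> carrier R" and y: "y \<in> carrier R"
  shows "residue x = residue y \<longleftrightarrow> x \<ominus> y \<in> P (Suc 0)"
proof
  assume eq: "residue x = residue y"
  have "residue x \<ominus> y \<in> P (Suc 0)"
    unfolding eq by (rule P_diff_sym[OF y residue(1)[OF y] residue(2)[OF y]])
  then show "x \<ominus> y \<in> P (Suc 0)" by (rule P_diff_trans[OF x residue(1)[OF x] y residue(2)[OF x]])
next
  assume xy: "x \<ominus> y \<in> P (Suc 0)"
  have "z \<in> carrier R \<and> x \<ominus> z \<in> P (Suc 0) \<longleftrightarrow> z \<in> carrier R \<and> y \<ominus> z \<in> P (Suc 0)" for z
    using P_diff_trans[OF x y _ xy] P_diff_trans[OF y x _ P_diff_sym[OF x y xy]] by blast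
  then show "residue x = residue y" unfolding residue_def by presburger
qed

lemma residue_residue: "x \<in> carrier R \<Longrightarrow> residue (residue x) = residue x"
  by (metis residue residue_eq_iff)

lemma quotient:
  assumes "x \<in> carrier R"
  shows "quotient x \<in> carrier R" "x = residue x \<oplus> p \<otimes> quotient x"
proof -
  obtain y where "y \<in> carrier R" "x \<ominus> residue x = p \<otimes> y"
    using residue(2)[OF assms] by (rule mem_P_1E)
  then have "\<exists>y. y \<in> carrier R \<and> x \<ominus> residue x = p \<otimes> y" by blast
  from someI_ex[OF this] have *: "quotient x \<in> carrier R" "x \<ominus> residue x = p \<otimes> quotient x"
    unfolding quotient_def by blast+
  show "quotient x \<in> carrier R" by fact
  have "x = residue x \<oplus> (x \<ominus> residue x)" using assms residue(1)[OF assms] by algebra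
  then show "x = residue x \<oplus> p \<otimes> quotient x" unfolding *(2) .
qed

lemma residue_quotient_add:
  assumes d: "d \<in> D" and y: "y \<in> carrier R"
  shows "residue (d \<oplus> p \<otimes> y) = d" "quotient (d \<oplus> p \<otimes> y) = y"
proof -
  obtain z where z: "z \<in> carrier R" "d = residue z" using d by blast
  have dc: "d \<in> carrier R" using z residue(1) by simp
  note pc = p_closed
  define x where "x = d \<oplus> p \<otimes> y"
  have x: "x \<in> carrier R" using dc y pc by (simp add: x_def)
  have "x \<ominus> d = p \<otimes> y" unfolding x_def using dc y pc by algebra
  then have "x \<ominus> d \<in> P (Suc 0)" using p_mult_mem_P_iff[OF y, of 0] y by (simp add: P_0)
  then have "residue x = residue d" using residue_eq_iff[OF x dc] by simp
  also have "\<dots> = d" using residue_residue[OF z(1)] z(2) by simp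
  finally have rx: "residue x = d" .
  then show "residue (d \<oplus> p \<otimes> y) = d" by (simp add: x_def)
  have q: "quotient x \<in> carrier R" by (rule quotient(1)[OF x])
  have "d \<oplus> p \<otimes> quotient x = d \<oplus> p \<otimes> y" using quotient(2)[OF x] rx x_def by simp
  then have "p \<otimes> quotient x = p \<otimes> y" using dc y q pc by simp
  then show "quotient (d \<oplus> p \<otimes> y) = y"
    using m_lcancel[OF p_nonzero p_closed q y] by (simp add: x_def)
qed

fun digits :: "nat \<Rightarrow> 'a \<Rightarrow> 'a list" where
  "digits 0 x = []"
| "digits (Suc N) x = residue x # digits N (quotient x)"

lemma diff_eq_p_mult:
  assumes x: "x \<in> carrier R" and y: "y \<in> carrier R" and eq: "residue x = residue y"
  shows "x \<ominus> y = p \<otimes> (quotient x \<ominus> quotient y)"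
proof -
  note c = p_closed residue(1)[OF y] quotient(1)[OF x] quotient(1)[OF y]
  have "x \<ominus> y = (residue y \<oplus> p \<otimes> quotient x) \<ominus> (residue y \<oplus> p \<otimes> quotient y)"
    using quotient(2)[OF x] quotient(2)[OF y] eq by simp
  also have "\<dots> = p \<otimes> (quotient x \<ominus> quotient y)" using c by algebra
  finally show ?thesis .
qed

lemma digits_eq_iff:
  "x \<in> carrier R \<Longrightarrow> y \<in> carrier R \<Longrightarrow> digits N x = digits N y \<longleftrightarrow> x \<ominus> y \<in> P N"
proof (induction N arbitrary: x y)
  case 0
  then show ?case by (simp add: P_0)
next
  case (Suc N)
  note q = quotient(1)[OF Suc.prems(1)] quotient(1)[OF Suc.prems(2)]
  show ?case
  proof (cases "residue x = residue y")
    case True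
    have "x \<ominus> y \<in> P (Suc N) \<longleftrightarrow> quotient x \<ominus> quotient y \<in> P N"
      unfolding diff_eq_p_mult[OF Suc.prems True] using q by (intro p_mult_mem_P_iff) simp
    then show ?thesis using True Suc.IH[OF q] by simp
  next
    case False
    then have "x \<ominus> y \<notin> P (Suc 0)" using residue_eq_iff[OF Suc.prems] by simp
    then have "x \<ominus> y \<notin> P (Suc N)" using P_antimono[of "Suc 0" "Suc N"] by auto
    then show ?thesis using False by simp
  qed
qed

lemma digits_words: "x \<in> carrier R \<Longrightarrow> digits N x \<in> words D N"
proof (induction N arbitrary: x)
  case 0
  then show ?case by (simp add: words_def)
next
  case (Suc N)
  then have "digits N (quotient x) \<in> words D N" using quotient(1) by blast
  then show ?case using Suc.prems by (simp add: words_def)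
qed

lemma ex_digits:
  "w \<in> words D N \<Longrightarrow> \<exists>x\<in>carrier R. digits N x = w"
proof (induction N arbitrary: w)
  case 0
  then show ?case by (auto simp: words_def)
next
  case (Suc N)
  then obtain d v where w: "w = d # v" "d \<in> D" "v \<in> words D N"
    by (cases w) (auto simp: words_def)
  then obtain y where y: "y \<in> carrier R" "digits N y = v" using Suc.IH by blast
  have "d \<in> carrier R" using w(2) residue(1) by blast
  then have "d \<oplus> p \<otimes> y \<in> carrier R" using y(1) p_closed by simp
  moreover have "digits (Suc N) (d \<oplus> p \<otimes> y) = w"
    using residue_quotient_add[OF w(2) y(1)] y(2) w(1) by simp
  ultimately show ?case by blast
qed

text \<open>
  The function \<open>\<phi>\<close> stands for \<open>\<bar>x\<bar>\<^sup>s\<close>, with \<open>u = \<bar>p\<bar>\<^sup>s\<close>: if the first digits agree, one factor \<open>p\<close> can be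
  cancelled from \<open>x - y\<close>, and otherwise \<open>x - y\<close> is a unit.
\<close>

lemma word_dist_digits:
  assumes \<phi>: "\<And>x. x \<in> carrier R \<Longrightarrow> x \<notin> P (Suc 0) \<Longrightarrow> \<phi> x = 1"
    "\<And>x. x \<in> carrier R \<Longrightarrow> \<phi> (p \<otimes> x) = u * \<phi> x"
  shows "x \<in> carrier R \<Longrightarrow> y \<in> carrier R \<Longrightarrow>
    word_dist u (digits N x) (digits N y) = (if x \<ominus> y \<in> P N then 0 else \<phi> (x \<ominus> y))"
proof (induction N arbitrary: x y)
  case 0
  then show ?case by (simp add: P_0)
next
  case (Suc N)
  note q = quotient(1)[OF Suc.prems(1)] quotient(1)[OF Suc.prems(2)]
  have qd: "quotient x \<ominus> quotient y \<in> carrier R" using q by simp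
  show ?case
  proof (cases "residue x = residue y")
    case True
    have "x \<ominus> y \<in> P (Suc N) \<longleftrightarrow> quotient x \<ominus> quotient y \<in> P N"
      unfolding diff_eq_p_mult[OF Suc.prems True] using qd by (rule p_mult_mem_P_iff)
    moreover have "\<phi> (x \<ominus> y) = u * \<phi> (quotient x \<ominus> quotient y)"
      unfolding diff_eq_p_mult[OF Suc.prems True] using qd by (rule \<phi>(2))
    ultimately show ?thesis using True Suc.IH[OF q] by simp
  next
    case False
    then have "x \<ominus> y \<notin> P (Suc 0)" using residue_eq_iff[OF Suc.prems] by simp
    moreover from this have "x \<ominus> y \<notin> P (Suc N)" using P_antimono[of "Suc 0" "Suc N"] by auto
    ultimately show ?thesis using False \<phi>(1)[of "x \<ominus> y"] Suc.prems by simp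
  qed
qed

lemma card_D: "card D = residue_card R"
proof -
  have "bij_betw (\<lambda>d. P (Suc 0) +> d) D (carrier (R Quot max_ideal R))"
  proof (rule bij_betw_imageI)
    have Dc: "d \<in> carrier R" "residue d = d" if "d \<in> D" for d
      using that residue(1) residue_residue by auto
    show "inj_on (\<lambda>d. P (Suc 0) +> d) D"
    proof (rule inj_onI)
      fix d e assume d: "d \<in> D" and e: "e \<in> D" and eq: "P (Suc 0) +> d = P (Suc 0) +> e"
      have "d \<in> P (Suc 0) +> d" using mem_coset_iff[OF Dc(1)[OF d]] P_diff_self Dc(1)[OF d] by simp
      then have "d \<ominus> e \<in> P (Suc 0)" unfolding eq using mem_coset_iff[OF Dc(1)[OF e]] by simp
      then show "d = e" using residue_eq_iff[OF Dc(1)[OF d] Dc(1)[OF e]] Dc(2)[OF d] Dc(2)[OF e] by simp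
    qed
    have coset: "P (Suc 0) +> residue a = P (Suc 0) +> a" if a: "a \<in> carrier R" for a
    proof (rule Set.set_eqI)
      fix y
      show "y \<in> P (Suc 0) +> residue a \<longleftrightarrow> y \<in> P (Suc 0) +> a"
        using mem_coset_iff[OF a, of y "Suc 0"] mem_coset_iff[OF residue(1)[OF a], of y "Suc 0"]
          residue_eq_iff[OF _ a, of y] residue_eq_iff[OF _ residue(1)[OF a], of y] residue_residue[OF a]
        by auto
    qed
    have "carrier (R Quot max_ideal R) = (\<lambda>a. max_ideal R +> a) ` carrier R"
      by (auto simp: FactRing_def A_RCOSETS_def')
    also have "\<dots> = (\<lambda>a. P (Suc 0) +> a) ` carrier R"
      unfolding P_1 unfolding max_ideal_eq ..
    also have "\<dots> = (\<lambda>d. P (Suc 0) +> d) ` D"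
      unfolding image_image by (intro image_cong refl) (simp add: coset)
    finally show "(\<lambda>d. P (Suc 0) +> d) ` D = carrier (R Quot max_ideal R)" by simp
  qed
  then show ?thesis unfolding residue_card_def by (rule bij_betw_same_card)
qed

lemma zero_one_residue: "residue \<zero> \<noteq> residue \<one>"
proof
  assume "residue \<zero> = residue \<one>"
  then have "\<one> \<ominus> \<zero> \<in> P (Suc 0)" using residue_eq_iff[of \<one> \<zero>] by simp
  moreover have "\<one> \<ominus> \<zero> = \<one>" by (simp add: a_minus_def)
  ultimately show False using one_notin_P_1 by simp
qed

lemma istopology_adic:
  "istopology (\<lambda>U. U \<subseteq> carrier R \<and> (\<forall>x\<in>U. \<exists>k. P k +> x \<subseteq> U))"
  unfolding istopology_def
proof (intro conjI allI impI ballI; (elim conjE)?)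
  fix S T x
  assume S: "S \<subseteq> carrier R" "\<forall>x\<in>S. \<exists>k. P k +> x \<subseteq> S"
    and T: "T \<subseteq> carrier R" "\<forall>x\<in>T. \<exists>k. P k +> x \<subseteq> T"
  show "S \<inter> T \<subseteq> carrier R" using S by blast
  assume x: "x \<in> S \<inter> T"
  then have xc: "x \<in> carrier R" using S by blast
  obtain j k where jk: "P j +> x \<subseteq> S" "P k +> x \<subseteq> T" using S T x by blast
  have "P (max j k) +> x \<subseteq> P j +> x" "P (max j k) +> x \<subseteq> P k +> x"
    using P_antimono[of j "max j k"] P_antimono[of k "max j k"] by (auto simp: a_r_coset_def')
  then show "\<exists>k. P k +> x \<subseteq> S \<inter> T" using jk by (intro exI[of _ "max j k"]) blast
next
  fix K assume K: "\<forall>U\<in>K. U \<subseteq> carrier R \<and> (\<forall>x\<in>U. \<exists>k. P k +> x \<subseteq> U)"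
  then show "\<Union>K \<subseteq> carrier R" by blast
  fix x assume "x \<in> \<Union>K"
  then obtain U where U: "U \<in> K" "x \<in> U" by blast
  then obtain k where "P k +> x \<subseteq> U" using K by blast
  then show "\<exists>k. P k +> x \<subseteq> \<Union>K" using U by blast
qed

lemma openin_adic:
  "openin (adic_topology R) U \<longleftrightarrow> U \<subseteq> carrier R \<and> (\<forall>x\<in>U. \<exists>k. P k +> x \<subseteq> U)"
  unfolding adic_topology_def by (simp add: topology_inverse'[OF istopology_adic])

definition cell :: "nat \<Rightarrow> 'a list \<Rightarrow> 'a set" where
  "cell N w = {y \<in> carrier R. digits N y = w}"

lemma openin_cell: "openin (adic_topology R) (cell N w)"
  unfolding openin_adic
proof (intro conjI ballI)
  show "cell N w \<subseteq> carrier R" by (auto simp: cell_def)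
  fix x assume "x \<in> cell N w"
  then have x: "x \<in> carrier R" "digits N x = w" by (auto simp: cell_def)
  have "P N +> x \<subseteq> cell N w"
    using x digits_eq_iff[OF _ x(1)] by (auto simp: mem_coset_iff[OF x(1)] cell_def)
  then show "\<exists>k. P k +> x \<subseteq> cell N w" by blast
qed

lemma topspace_adic: "topspace (adic_topology R) = carrier R"
proof
  show "topspace (adic_topology R) \<subseteq> carrier R"
    using openin_topspace[of "adic_topology R"] unfolding openin_adic by blast
  have "carrier R = cell 0 []" by (auto simp: cell_def)
  then have "openin (adic_topology R) (carrier R)" by (simp only: openin_cell)
  then show "carrier R \<subseteq> topspace (adic_topology R)" by (rule openin_subset)
qed

text \<open>
  The residue classes are open, so compactness leaves only finitely many of them.
\<close>

lemma finite_D: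
  assumes "compact_space (adic_topology R)"
  shows "finite D"
proof -
  let ?\<U> = "(\<lambda>d. cell 1 [d]) ` D"
  have cover: "carrier R \<subseteq> \<Union>?\<U>" by (auto simp: cell_def)
  have "compactin (adic_topology R) (carrier R)"
    using assms by (simp add: compact_space_def topspace_adic)
  then have "\<exists>F. finite F \<and> F \<subseteq> ?\<U> \<and> carrier R \<subseteq> \<Union>F"
    by (rule compactinD[OF _ _ cover]) (use openin_cell in blast)
  then obtain F where F: "finite F" "F \<subseteq> ?\<U>" "carrier R \<subseteq> \<Union>F" by blast
  then obtain D' where D': "finite D'" "D' \<subseteq> D" "F = (\<lambda>d. cell 1 [d]) ` D'"
    by (meson finite_subset_image)
  have "D \<subseteq> D'"
  proof
    fix d assume "d \<in> D"
    then obtain x where x: "x \<in> carrier R" "d = residue x" by blast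
    then obtain e where "e \<in> D'" "x \<in> cell 1 [e]" using F(3) D'(3) by blast
    then show "d \<in> D'" using x by (simp add: cell_def)
  qed
  then show ?thesis using D'(1) by (rule finite_subset)
qed

lemma card_D_ge_2: "finite D \<Longrightarrow> 2 \<le> card D"
  using card_mono[of D "{residue \<zero>, residue \<one>}"] zero_one_residue by simp

lemma cell_translate:
  assumes a: "a \<in> cell N v" and b: "b \<in> cell N w"
  shows "y \<in> cell N v \<longleftrightarrow> y \<in> carrier R \<and> (b \<ominus> a) \<oplus> y \<in> cell N w"
proof (cases "y \<in> carrier R")
  case y: True
  have ab: "a \<in> carrier R" "digits N a = v" "b \<in> carrier R" "digits N b = w"
    using a b by (auto simp: cell_def)
  have t: "(b \<ominus> a) \<oplus> y \<in> carrier R" using ab y by simp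
  have "((b \<ominus> a) \<oplus> y) \<ominus> b = y \<ominus> a" using ab(1,3) y by algebra
  then have "digits N ((b \<ominus> a) \<oplus> y) = w \<longleftrightarrow> digits N y = v"
    using digits_eq_iff[OF t ab(3), of N] digits_eq_iff[OF y ab(1), of N] ab by simp
  then show ?thesis using y t by (simp add: cell_def)
qed (simp add: cell_def)

end


section \<open>Haar measure and the limit of digit averages\<close>

lemma norm_word_dist_le_1:
  fixes u :: complex
  assumes "norm u \<le> 1"
  shows "norm (word_dist u v w) \<le> 1"
  using assms by (induction u v w rule: word_dist.induct) (auto simp: norm_mult mult_le_one)

locale dvr_power = dvr R p for R (structure) and p +
  fixes I :: "'i::linorder set" and M :: "('i \<Rightarrow> 'a) measure"
  assumes finite_I: "finite I" and finite_D: "finite D" and haar: "power_haar_measure R I M"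
begin

lemma space_M: "space M = PiE I (\<lambda>_. carrier R)"
  using haar by (simp add: power_haar_measure_def normalized_haar_measure_def topspace_adic)

lemma open_in_sets_M:
  assumes "openin (product_topology (\<lambda>_. adic_topology R) I) U"
  shows "U \<in> sets M"
  using haar assms by (auto simp: power_haar_measure_def normalized_haar_measure_def)

lemma emeasure_space_M: "emeasure M (space M) = 1"
  using haar unfolding power_haar_measure_def normalized_haar_measure_def by blast

lemma finite_measure_M: "finite_measure M"
  by (rule finite_measureI) (simp add: emeasure_space_M)

definition cylinder :: "nat \<Rightarrow> ('i \<Rightarrow> 'a list) \<Rightarrow> ('i \<Rightarrow> 'a) set" where
  "cylinder N w = PiE I (\<lambda>i. cell N (w i))"

lemma cylinder_sets: "cylinder N w \<in> sets M"
  unfolding cylinder_def by (intro open_in_sets_M) (simp add: openin_PiE finite_I openin_cell)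

lemma emeasure_translate:
  assumes "t \<in> PiE I (\<lambda>_. carrier R)" "A \<in> sets M"
  shows "emeasure M ((\<lambda>x. \<lambda>i\<in>I. t i \<oplus> x i) ` A) = emeasure M A"
proof -
  have eq: "t <#\<^bsub>product_group I (\<lambda>_. add_monoid R)\<^esub> A = (\<lambda>x. \<lambda>i\<in>I. t i \<oplus> x i) ` A"
    by (auto simp: l_coset_def)
  have "\<forall>t\<in>carrier (product_group I (\<lambda>_. add_monoid R)). \<forall>A\<in>sets M.
      emeasure M (t <#\<^bsub>product_group I (\<lambda>_. add_monoid R)\<^esub> A) = emeasure M A"
    using haar unfolding power_haar_measure_def normalized_haar_measure_def by blast
  moreover have "t \<in> carrier (product_group I (\<lambda>_. add_monoid R))" using assms(1) by simp
  ultimately show ?thesis unfolding eq[symmetric] using assms(2) by blast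
qed

text \<open>
  Two cylinders of the same level are translates of each other: translate by the difference of any two
  of their points.
\<close>

lemma emeasure_cylinder_eq:
  assumes v: "v \<in> PiE I (\<lambda>_. words D N)" and w: "w \<in> PiE I (\<lambda>_. words D N)"
  shows "emeasure M (cylinder N v) = emeasure M (cylinder N w)"
proof -
  have ex: "\<exists>x. x \<in> cell N (v' i)" if "v' \<in> PiE I (\<lambda>_. words D N)" "i \<in> I" for v' i
    using ex_digits[of "v' i" N] that by (auto simp: cell_def)
  define a b where "a i = (SOME x. x \<in> cell N (v i))" and "b i = (SOME x. x \<in> cell N (w i))" for i
  have a: "a i \<in> cell N (v i)" and b: "b i \<in> cell N (w i)" if "i \<in> I" for i
    using someI_ex[OF ex[OF v that]] someI_ex[OF ex[OF w that]] by (simp_all add: a_def b_def)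
  have ac: "a i \<in> carrier R" and bc: "b i \<in> carrier R" if "i \<in> I" for i
    using a[OF that] b[OF that] by (simp_all add: cell_def)
  define t where "t = (\<lambda>i\<in>I. b i \<ominus> a i)"
  have t: "t \<in> PiE I (\<lambda>_. carrier R)" using ac bc by (simp add: t_def)
  have "(\<lambda>x. \<lambda>i\<in>I. t i \<oplus> x i) ` cylinder N v = cylinder N w"
  proof
    show "(\<lambda>x. \<lambda>i\<in>I. t i \<oplus> x i) ` cylinder N v \<subseteq> cylinder N w"
    proof
      fix z assume "z \<in> (\<lambda>x. \<lambda>i\<in>I. t i \<oplus> x i) ` cylinder N v"
      then obtain x where x: "x \<in> cylinder N v" "z = (\<lambda>i\<in>I. t i \<oplus> x i)" by blast
      have "t i \<oplus> x i \<in> cell N (w i)" if i: "i \<in> I" for i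
        using cell_translate[OF a[OF i] b[OF i], of "x i"] x(1) i by (simp add: cylinder_def t_def PiE_iff)
      then show "z \<in> cylinder N w" unfolding x(2) cylinder_def by simp
    qed
    show "cylinder N w \<subseteq> (\<lambda>x. \<lambda>i\<in>I. t i \<oplus> x i) ` cylinder N v"
    proof
      fix z assume z: "z \<in> cylinder N w"
      define x where "x = (\<lambda>i\<in>I. z i \<ominus> t i)"
      have e: "x i \<in> cell N (v i) \<and> t i \<oplus> x i = z i" if i: "i \<in> I" for i
      proof -
        have zi: "z i \<in> cell N (w i)" using z i by (simp add: cylinder_def PiE_iff)
        have c: "z i \<in> carrier R" "t i \<in> carrier R" using zi t i by (auto simp: cell_def)
        have xi: "x i = z i \<ominus> t i" using i by (simp add: x_def)
        have "t i \<oplus> x i = z i" unfolding xi using c by algebra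
        moreover have "x i \<in> carrier R" unfolding xi using c by simp
        ultimately show ?thesis
          using cell_translate[OF a[OF i] b[OF i], of "x i"] zi i by (simp add: t_def)
      qed
      have "z = (\<lambda>i\<in>I. t i \<oplus> x i)"
        using z e by (intro PiE_ext[of z I "\<lambda>i. cell N (w i)"]) (auto simp: cylinder_def PiE_iff)
      moreover have "x \<in> cylinder N v" using e by (simp add: cylinder_def x_def)
      ultimately show "z \<in> (\<lambda>x. \<lambda>i\<in>I. t i \<oplus> x i) ` cylinder N v" by blast
    qed
  qed
  then show ?thesis using emeasure_translate[OF t cylinder_sets[of N v]] by argo
qed

lemma mem_cylinder_iff:
  assumes "x \<in> PiE I (\<lambda>_. carrier R)" "w \<in> PiE I (\<lambda>_. words D N)"
  shows "x \<in> cylinder N w \<longleftrightarrow> w = (\<lambda>i\<in>I. digits N (x i))"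
proof
  assume "x \<in> cylinder N w"
  then show "w = (\<lambda>i\<in>I. digits N (x i))"
    using assms(2) by (intro PiE_ext[OF assms(2)]) (auto simp: cylinder_def cell_def PiE_iff digits_words)
next
  assume "w = (\<lambda>i\<in>I. digits N (x i))"
  then show "x \<in> cylinder N w" using assms(1) by (auto simp: cylinder_def cell_def PiE_iff)
qed

lemma sum_indicator_cylinders:
  fixes F :: "('i \<Rightarrow> 'a list) \<Rightarrow> 'c::semiring_1"
  assumes x: "x \<in> PiE I (\<lambda>_. carrier R)"
  shows "(\<Sum>w\<in>PiE I (\<lambda>_. words D N). F w * indicator (cylinder N w) x) = F (\<lambda>i\<in>I. digits N (x i))"
proof -
  have fin: "finite (PiE I (\<lambda>_. words D N))" by (intro finite_PiE finite_I finite_words finite_D)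
  have mem: "(\<lambda>i\<in>I. digits N (x i)) \<in> PiE I (\<lambda>_. words D N)"
    using x digits_words by (auto simp: PiE_iff)
  have "(\<Sum>w\<in>PiE I (\<lambda>_. words D N). F w * indicator (cylinder N w) x) =
      (\<Sum>w\<in>PiE I (\<lambda>_. words D N). if w = (\<lambda>i\<in>I. digits N (x i)) then F w else 0)"
    by (intro sum.cong refl) (simp add: indicator_def mem_cylinder_iff[OF x])
  also have "\<dots> = F (\<lambda>i\<in>I. digits N (x i))" by (simp only: sum.delta[OF fin] mem if_True)
  finally show ?thesis .
qed

lemma integral_sum_cylinders:
  fixes F :: "('i \<Rightarrow> 'a list) \<Rightarrow> complex"
  shows "(\<integral>x. (\<Sum>w\<in>W. F w * indicator (cylinder N w) x) \<partial>M) = (\<Sum>w\<in>W. F w * of_real (measure M (cylinder N w)))"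
proof (rule has_bochner_integral_integral_eq, rule has_bochner_integral_sum)
  interpret finite_measure M by (rule finite_measure_M)
  fix w
  have "has_bochner_integral M (\<lambda>x. indicator (cylinder N w) x *\<^sub>R F w) (measure M (cylinder N w) *\<^sub>R F w)"
    by (rule has_bochner_integral_indicator[OF cylinder_sets]) (simp add: emeasure_eq_measure)
  moreover have "indicator (cylinder N w) x *\<^sub>R F w = F w * indicator (cylinder N w) x" for x
    by (simp split: split_indicator)
  moreover have "measure M (cylinder N w) *\<^sub>R F w = F w * of_real (measure M (cylinder N w))"
    by (simp add: scaleR_conv_of_real mult.commute)
  ultimately show "has_bochner_integral M (\<lambda>x. F w * indicator (cylinder N w) x) (F w * of_real (measure M (cylinder N w)))"
    by (simp only:)
qed

text \<open>
  The cylinders of level \<open>N\<close> partition the space into sets of equal measure.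
\<close>

lemma measure_cylinder:
  assumes w: "w \<in> PiE I (\<lambda>_. words D N)"
  shows "measure M (cylinder N w) = 1 / real (card D) ^ (N * card I)"
proof -
  let ?W = "PiE I (\<lambda>_. words D N)"
  have "complex_of_real 1 = (\<integral>x. 1 \<partial>M)" by (simp add: measure_def emeasure_space_M)
  also have "\<dots> = (\<integral>x. (\<Sum>v\<in>?W. 1 * indicator (cylinder N v) x) \<partial>M)"
    by (intro Bochner_Integration.integral_cong refl)
      (subst sum_indicator_cylinders[where F = "\<lambda>_. 1 :: complex"], simp_all add: space_M)
  also have "\<dots> = (\<Sum>v\<in>?W. 1 * of_real (measure M (cylinder N v)))"
    by (rule integral_sum_cylinders[where F = "\<lambda>_. 1"])
  also have "\<dots> = (\<Sum>v\<in>?W. of_real (measure M (cylinder N w)))"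
    by (intro sum.cong refl) (simp add: measure_def emeasure_cylinder_eq[OF _ w])
  also have "\<dots> = of_real (real (card ?W) * measure M (cylinder N w))" by simp
  finally have "1 = real (card ?W) * measure M (cylinder N w)" by (simp only: of_real_eq_iff)
  moreover have "card ?W = card D ^ (N * card I)"
    by (simp add: card_PiE finite_I card_words finite_D power_mult)
  ultimately have "1 = real (card D) ^ (N * card I) * measure M (cylinder N w)" by simp
  then show ?thesis by (metis mult_zero_left nonzero_mult_div_cancel_left zero_neq_one)
qed

text \<open>
  The integrand with every coordinate truncated after \<open>N\<close> digits; a pair that still agrees at this
  precision contributes 0.
\<close>

definition digit_approx :: "complex \<Rightarrow> nat \<Rightarrow> ('i \<Rightarrow> 'a) \<Rightarrow> complex" where
  "digit_approx u N x = (\<Prod>(i, j)\<in>pairs I. word_dist u (digits N (x i)) (digits N (x j)))"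

lemma digit_approx_eq:
  assumes "x \<in> space M"
  shows "digit_approx u N x = (\<Sum>w\<in>PiE I (\<lambda>_. words D N).
    (\<Prod>(i, j)\<in>pairs I. word_dist u (w i) (w j)) * indicator (cylinder N w) x)"
proof -
  have "(\<Sum>w\<in>PiE I (\<lambda>_. words D N). (\<Prod>(i, j)\<in>pairs I. word_dist u (w i) (w j)) * indicator (cylinder N w) x) =
    (\<Prod>(i, j)\<in>pairs I. word_dist u ((\<lambda>i\<in>I. digits N (x i)) i) ((\<lambda>i\<in>I. digits N (x i)) j))"
    using assms by (intro sum_indicator_cylinders) (simp add: space_M)
  also have "\<dots> = digit_approx u N x"
    unfolding digit_approx_def by (intro prod.cong refl) (auto simp: pairs_def)
  finally show ?thesis by simp
qed

lemma digit_approx_measurable: "digit_approx u N \<in> borel_measurable M"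
proof -
  have "(\<lambda>x. \<Sum>w\<in>PiE I (\<lambda>_. words D N).
    (\<Prod>(i, j)\<in>pairs I. word_dist u (w i) (w j)) * (indicator (cylinder N w) x :: complex)) \<in> borel_measurable M"
    using cylinder_sets by (intro borel_measurable_sum borel_measurable_times borel_measurable_indicator) auto
  then show ?thesis
    by (rule measurable_cong[THEN iffD1, rotated]) (simp add: digit_approx_eq)
qed

lemma integral_digit_approx: "(\<integral>x. digit_approx u N x \<partial>M) = word_mean D u N I"
proof -
  interpret finite_measure M by (rule finite_measure_M)
  let ?W = "PiE I (\<lambda>_. words D N)" and ?K = "\<lambda>w. \<Prod>(i, j)\<in>pairs I. word_dist u (w i) (w j)"
  have "(\<integral>x. digit_approx u N x \<partial>M) = (\<integral>x. (\<Sum>w\<in>?W. ?K w * indicator (cylinder N w) x) \<partial>M)"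
    by (intro Bochner_Integration.integral_cong refl digit_approx_eq)
  also have "\<dots> = (\<Sum>w\<in>?W. ?K w * of_real (measure M (cylinder N w)))"
    by (rule integral_sum_cylinders)
  also have "\<dots> = (\<Sum>w\<in>?W. ?K w * (1 / of_nat (card D) ^ (N * card I)))"
    by (rule sum.cong[OF refl]) (simp add: measure_cylinder)
  also have "\<dots> = word_mean D u N I"
    by (simp add: word_mean_def word_sum_def sum_divide_distrib)
  finally show ?thesis .
qed

text \<open>
  The truncations converge at every point: for distinct coordinates a pair is resolved after finitely
  many digits, and for equal coordinates both sides are 0. As \<open>\<bar>u\<bar> \<le> 1\<close>, the constant 1 dominates.
  This covers \<open>Re s = 0\<close> too, where \<open>\<bar>x\<bar>\<^sup>s\<close> has no limit at 0.
\<close>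

theorem integral_eq_limit:
  fixes \<phi> :: "'a \<Rightarrow> complex"
  assumes u: "norm u \<le> 1"
    and \<phi>0: "\<phi> \<zero> = 0" and \<phi>1: "\<And>x. x \<in> carrier R \<Longrightarrow> x \<notin> P (Suc 0) \<Longrightarrow> \<phi> x = 1"
    and \<phi>p: "\<And>x. x \<in> carrier R \<Longrightarrow> \<phi> (p \<otimes> x) = u * \<phi> x"
  shows "(\<lambda>N. word_mean D u N I) \<longlonglongrightarrow> (\<integral>x. (\<Prod>(i, j)\<in>pairs I. \<phi> (x i \<ominus> x j)) \<partial>M)"
proof -
  interpret finite_measure M by (rule finite_measure_M)
  let ?F = "\<lambda>x. \<Prod>(i, j)\<in>pairs I. \<phi> (x i \<ominus> x j)"
  have lim: "(\<lambda>N. digit_approx u N x) \<longlonglongrightarrow> ?F x" if x: "x \<in> space M" for x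
  proof -
    have "(\<lambda>N. word_dist u (digits N (x i)) (digits N (x j))) \<longlonglongrightarrow> \<phi> (x i \<ominus> x j)"
      if ij: "(i, j) \<in> pairs I" for i j
    proof -
      have c: "x i \<in> carrier R" "x j \<in> carrier R" using x ij by (auto simp: space_M pairs_def)
      note wd = word_dist_digits[of \<phi> u, OF \<phi>1 \<phi>p c]
      show ?thesis
      proof (cases "x i \<ominus> x j = \<zero>")
        case True
        then show ?thesis using P_zero \<phi>0 by (simp add: wd)
      next
        case False
        then obtain k where k: "x i \<ominus> x j \<notin> P k" using ex_notin_P[OF minus_closed[OF c] False] by blast
        have "x i \<ominus> x j \<notin> P N" if "N \<ge> k" for N using P_antimono[OF that] k by blast
        then have "\<forall>\<^sub>F N in sequentially. word_dist u (digits N (x i)) (digits N (x j)) = \<phi> (x i \<ominus> x j)"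
          by (intro eventually_sequentiallyI[of k]) (simp add: wd)
        then show ?thesis by (rule tendsto_eventually)
      qed
    qed
    then show ?thesis unfolding digit_approx_def by (intro tendsto_prod) auto
  qed
  have "(\<lambda>N. \<integral>x. digit_approx u N x \<partial>M) \<longlonglongrightarrow> (\<integral>x. ?F x \<partial>M)"
  proof (rule integral_dominated_convergence[where w = "\<lambda>_. 1"])
    show "?F \<in> borel_measurable M"
      by (rule borel_measurable_LIMSEQ_metric[OF digit_approx_measurable lim])
    show "AE x in M. norm (digit_approx u N x) \<le> 1" for N
    proof (rule AE_I2)
      fix x
      have "norm (digit_approx u N x) = (\<Prod>(i, j)\<in>pairs I. norm (word_dist u (digits N (x i)) (digits N (x j))))"
        unfolding digit_approx_def by (simp add: prod_norm[symmetric] case_prod_beta)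
      also have "\<dots> \<le> 1" using norm_word_dist_le_1[OF u] by (intro prod_le_1) auto
      finally show "norm (digit_approx u N x) \<le> 1" .
    qed
  qed (use lim digit_approx_measurable in auto)
  then show ?thesis by (simp only: integral_digit_approx)
qed

end



section \<open>The Igusa zeta function\<close>

lemma powr_prod_of_real:
  assumes "finite S" "\<And>x. x \<in> S \<Longrightarrow> 0 \<le> a x"
  shows "complex_of_real (\<Prod>x\<in>S. a x) powr s = (\<Prod>x\<in>S. complex_of_real (a x) powr s)"
  using assms
proof (induction S rule: finite_induct)
  case (insert x S)
  have nn: "0 \<le> (\<Prod>x\<in>S. a x)" using insert.prems by (intro prod_nonneg) auto
  have "complex_of_real (a x * (\<Prod>x\<in>S. a x)) powr s =
      complex_of_real (a x) powr s * complex_of_real (\<Prod>x\<in>S. a x) powr s"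
    unfolding of_real_mult
    by (rule powr_times_real) (use nn insert.prems in \<open>simp_all del: of_real_prod\<close>)
  then show ?case using insert by (simp del: of_real_prod of_real_mult)
qed simp

lemma (in dvr) dvr_abs_finprod:
  assumes "finite S" "f \<in> S \<rightarrow> carrier R"
  shows "dvr_abs R (finprod R f S) = (\<Prod>x\<in>S. dvr_abs R (f x))"
  using assms
proof (induction S rule: finite_induct)
  case empty
  then show ?case by (simp add: dvr_abs_unit one_notin_P_1)
next
  case (insert x S)
  then have "f \<in> S \<rightarrow> carrier R" "f x \<in> carrier R" by auto
  then show ?case using insert by (simp add: finprod_insert dvr_abs_mult finprod_closed)
qed

lemma (in dvr) dvr_abs_f_A:
  assumes "x \<in> PiE {1..n + 1} (\<lambda>_. carrier R)"
  shows "dvr_abs R (f_A R n x) = (\<Prod>(i, j)\<in>pairs {1..n + 1}. dvr_abs R (x i \<ominus> x j))"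
proof -
  have eq: "{(i, j). 1 \<le> i \<and> i < j \<and> j \<le> n + 1} = pairs {1..n + 1}" by (auto simp: pairs_def)
  have "(\<lambda>(i, j). x i \<ominus> x j) \<in> pairs {1..n + 1} \<rightarrow> carrier R"
    using assms by (auto simp: pairs_def PiE_iff)
  then show ?thesis
    unfolding f_A_def eq by (simp add: dvr_abs_finprod finite_pairs case_prod_beta)
qed

lemma powr_eq_cluster_factor:
  assumes q: "q > 0" and k: "k \<ge> 1"
  shows "of_nat q powr (1 - of_nat k - of_nat (k choose 2) * s) =
    cluster_factor q (complex_of_real (1 / real q) powr s) k"
proof -
  define l where "l = complex_of_real (ln (real q))"
  have lnq: "Ln (of_nat q) = l" using q by (simp add: l_def Ln_of_nat)
  have "Ln (complex_of_real (1 / real q)) = complex_of_real (ln (1 / real q))"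
    using q by (intro Ln_of_real) simp
  also have "\<dots> = - l" using q by (simp add: l_def ln_div)
  finally have u: "complex_of_real (1 / real q) powr s = exp (- (s * l))"
    using q by (simp add: powr_def)
  have expl: "exp l = of_nat q" using q lnq by (metis exp_Ln of_nat_eq_0_iff less_irrefl)
  have "of_nat q powr (1 - of_nat k - of_nat (k choose 2) * s) =
      exp (of_nat (k choose 2) * (- (s * l)) - of_nat (k - 1) * l)"
    using q k by (simp add: powr_def lnq of_nat_diff algebra_simps)
  also have "\<dots> = exp (- (s * l)) ^ (k choose 2) / exp l ^ (k - 1)"
    by (simp only: exp_diff exp_of_nat_mult)
  finally show ?thesis by (simp only: cluster_factor_def u expl)
qed

text \<open>
  The root is split off because its factor in the zeta function is \<open>1/(1 - t)\<close> and not \<open>t/(1 - t)\<close>; the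
  additional \<open>t\<close> cancels against the factor in front of the averages in \<open>word_mean_tendsto\<close>.
\<close>

lemma prod_node_factor:
  assumes T: "T \<in> branching_trees m" and m: "m \<ge> 2"
  shows "(\<Prod>u\<in>parents T. node_factor q z (num_children T u) (dl T u)) =
    cluster_factor q z m / (1 - cluster_factor q z m) * (pi_poly T (- inverse (of_nat q)) *
      (\<Prod>u\<in>nonroot_parents T. cluster_factor q z (dl T u) / (1 - cluster_factor q z (dl T u))))"
proof -
  interpret branching_tree T by (rule branching_treesD(1)[OF T])
  have dlr: "dl T (rt_root T) = m"
    using branching_treesD(2)[OF T] by (simp add: dl_eq_card_leaf_set leaves_root)
  then have "rt_root T \<notin> leaves T"
    using leaf_iff_card[OF root_V] m by (simp add: dl_eq_card_leaf_set)
  then have root: "rt_root T \<in> parents T" using root_V by (simp add: parents_def)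
  have fin: "finite (parents T)" using finite_V by (simp add: parents_def)
  have "distinct_prob q c = (\<Prod>i = 1..c - 1. 1 + of_nat i * (- inverse (of_nat q)))" if "2 \<le> c" for c
  proof -
    have "{..<c} = insert 0 {1..c - 1}" using that by auto
    then show ?thesis by (simp add: distinct_prob_def divide_inverse)
  qed
  then have "(\<Prod>u\<in>parents T. distinct_prob q (num_children T u)) = pi_poly T (- inverse (of_nat q))"
    unfolding pi_poly_def by (intro prod.cong refl) (simp add: branching)
  then show ?thesis
    unfolding node_factor_def prod.distrib nonroot_parents_def
    by (subst (2) prod.remove[OF fin root]) (simp add: dlr mult_ac)
qed

theorem corollary5p7:
  fixes R :: "('a, 'b) ring_scheme"
    and M :: "(nat \<Rightarrow> 'a) measure"
    and n q :: nat
    and s :: complex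
  assumes "n \<ge> 1"
    and "compact_dvr R"
    and "q = residue_card R"
    and "power_haar_measure R {1..n + 1} M"
    and "Re s \<ge> 0"
  shows "igusa_zeta R M (f_A R n) s =
    1 / (1 - of_nat q powr (- of_nat n - of_nat ((n + 1) choose 2) * s)) *
    (\<Sum>\<tau>\<in>UTP (n + 1).
       fact (n + 1) / of_nat (card (rt_Aut (rep \<tau>))) *
       pi_poly (rep \<tau>) (- inverse (of_nat q)) *
       (\<Prod>u\<in>nonroot_parents (rep \<tau>).
          of_nat q powr (1 - of_nat (dl (rep \<tau>) u) - of_nat (dl (rep \<tau>) u choose 2) * s) /
          (1 - of_nat q powr (1 - of_nat (dl (rep \<tau>) u) - of_nat (dl (rep \<tau>) u choose 2) * s))))"
proof -
  have "discrete_valuation_ring R" and compact: "compact_space (adic_topology R)"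
    using assms(2) by (simp_all add: compact_dvr_def)
  then obtain p where "dvr R p" by (blast elim: discrete_valuation_ring_dvr)
  then interpret dvr R p .
  let ?I = "{1..n + 1}"
  interpret dvr_power R p ?I M
    using finite_D[OF compact] assms(4) by unfold_locales auto
  have q: "card D = q" "q \<ge> 2" using card_D card_D_ge_2[OF finite_D] assms(3) by auto
  define u where "u = complex_of_real (1 / real q) powr s"
  define \<phi> where "\<phi> x = complex_of_real (dvr_abs R x) powr s" for x
  let ?t = "cluster_factor q u"
  have "norm u = (1 / real q) powr Re s"
    unfolding u_def using q(2) by (subst norm_powr_real_powr) auto
  also have "\<dots> \<le> 1" using q(2) assms(5) by (intro powr_le1) auto
  finally have u: "norm u \<le> 1" .
  have "(\<lambda>N. word_mean D u N ?I) \<longlonglongrightarrow> (\<integral>x. (\<Prod>(i, j)\<in>pairs ?I. \<phi> (x i \<ominus>\<^bsub>R\<^esub> x j)) \<partial>M)"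
  proof (rule integral_eq_limit[OF u])
    show "\<phi> \<zero>\<^bsub>R\<^esub> = 0" by (simp add: \<phi>_def dvr_abs_zero)
    show "\<phi> x = 1" if "x \<in> carrier R" "x \<notin> P (Suc 0)" for x
      using dvr_abs_unit[OF that] by (simp add: \<phi>_def)
    show "\<phi> (p \<otimes>\<^bsub>R\<^esub> x) = u * \<phi> x" if "x \<in> carrier R" for x
    proof -
      have "dvr_abs R (p \<otimes>\<^bsub>R\<^esub> x) = 1 / real q * dvr_abs R x"
        using dvr_abs_p_mult[OF that] assms(3) by simp
      then have "\<phi> (p \<otimes>\<^bsub>R\<^esub> x) = (complex_of_real (1 / real q) * complex_of_real (dvr_abs R x)) powr s"
        by (simp only: \<phi>_def of_real_mult)
      also have "\<dots> = u * \<phi> x"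
        unfolding u_def \<phi>_def by (rule powr_times_real) (auto simp: dvr_abs_nonneg)
      finally show ?thesis .
    qed
  qed
  also have "(\<integral>x. (\<Prod>(i, j)\<in>pairs ?I. \<phi> (x i \<ominus>\<^bsub>R\<^esub> x j)) \<partial>M) = igusa_zeta R M (f_A R n) s"
    unfolding igusa_zeta_def
  proof (rule Bochner_Integration.integral_cong[OF refl])
    fix x assume "x \<in> space M"
    then have eq: "dvr_abs R (f_A R n x) = (\<Prod>z\<in>pairs ?I. dvr_abs R (x (fst z) \<ominus>\<^bsub>R\<^esub> x (snd z)))"
      by (subst dvr_abs_f_A) (simp_all add: space_M case_prod_beta)
    have "complex_of_real (dvr_abs R (f_A R n x)) powr s =
        (\<Prod>z\<in>pairs ?I. complex_of_real (dvr_abs R (x (fst z) \<ominus>\<^bsub>R\<^esub> x (snd z))) powr s)"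
      unfolding eq by (rule powr_prod_of_real[OF finite_pairs[OF finite_I] dvr_abs_nonneg])
    then show "(\<Prod>(i, j)\<in>pairs ?I. \<phi> (x i \<ominus>\<^bsub>R\<^esub> x j)) = complex_of_real (dvr_abs R (f_A R n x)) powr s"
      unfolding \<phi>_def split_def by (rule sym)
  qed
  finally have "(\<lambda>N. ?t (n + 1) * word_mean D u N ?I) \<longlonglongrightarrow> ?t (n + 1) * igusa_zeta R M (f_A R n) s"
    by (rule tendsto_mult_left)
  moreover have "(\<lambda>N. ?t (n + 1) * word_mean D u N ?I) \<longlonglongrightarrow> hierarchy_sum (node_factor q u) ?I"
    using word_mean_tendsto[OF finite_D _ u finite_I] q by simp
  ultimately have "?t (n + 1) * igusa_zeta R M (f_A R n) s = hierarchy_sum (node_factor q u) ?I"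
    by (rule LIMSEQ_unique)
  also have "\<dots> = (\<Sum>\<tau>\<in>UTP (n + 1). fact (n + 1) / of_nat (card (rt_Aut (rep \<tau>))) *
      (\<Prod>v\<in>parents (rep \<tau>). node_factor q u (num_children (rep \<tau>) v) (dl (rep \<tau>) v)))"
    by (rule UTP_sum_eq_hierarchy_sum[symmetric]) auto
  also have "\<dots> = ?t (n + 1) * (1 / (1 - ?t (n + 1)) * (\<Sum>\<tau>\<in>UTP (n + 1).
       fact (n + 1) / of_nat (card (rt_Aut (rep \<tau>))) * pi_poly (rep \<tau>) (- inverse (of_nat q)) *
       (\<Prod>v\<in>nonroot_parents (rep \<tau>). ?t (dl (rep \<tau>) v) / (1 - ?t (dl (rep \<tau>) v)))))"
    unfolding sum_distrib_left
  proof (rule sum.cong[OF refl])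
    fix \<tau> assume "\<tau> \<in> UTP (n + 1)"
    then have "rep \<tau> \<in> branching_trees (n + 1)" by (rule rep_in_class)
    from prod_node_factor[OF this, of q u]
    show "fact (n + 1) / of_nat (card (rt_Aut (rep \<tau>))) *
      (\<Prod>v\<in>parents (rep \<tau>). node_factor q u (num_children (rep \<tau>) v) (dl (rep \<tau>) v)) =
      ?t (n + 1) * (1 / (1 - ?t (n + 1)) * (fact (n + 1) / of_nat (card (rt_Aut (rep \<tau>))) *
        pi_poly (rep \<tau>) (- inverse (of_nat q)) *
       (\<Prod>v\<in>nonroot_parents (rep \<tau>). ?t (dl (rep \<tau>) v) / (1 - ?t (dl (rep \<tau>) v)))))"
      using assms(1) by (simp add: field_simps)
  qed
  finally have scaled: "?t (n + 1) * igusa_zeta R M (f_A R n) s = \<dots>" .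
  have "?t (n + 1) \<noteq> 0" using q(2) by (simp add: cluster_factor_def u_def)
  \<comment> \<open>the limit theorem yields the zeta function times t, and t is nonzero\<close>
  note mult_left_cancel[OF this, THEN iffD1, OF scaled]
  moreover have t: "of_nat q powr (1 - of_nat k - of_nat (k choose 2) * s) = ?t k" if "k \<ge> 1" for k
    unfolding u_def by (rule powr_eq_cluster_factor) (use that q(2) in auto)
  moreover have "of_nat q powr (- of_nat n - of_nat ((n + 1) choose 2) * s) = ?t (n + 1)"
    using t[of "n + 1"] by (simp add: algebra_simps)
  moreover have "(\<Prod>v\<in>nonroot_parents (rep \<tau>).
        of_nat q powr (1 - of_nat (dl (rep \<tau>) v) - of_nat (dl (rep \<tau>) v choose 2) * s) /
          (1 - of_nat q powr (1 - of_nat (dl (rep \<tau>) v) - of_nat (dl (rep \<tau>) v choose 2) * s))) =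
      (\<Prod>v\<in>nonroot_parents (rep \<tau>). ?t (dl (rep \<tau>) v) / (1 - ?t (dl (rep \<tau>) v)))"
    if \<tau>: "\<tau> \<in> UTP (n + 1)" for \<tau>
  proof (rule prod.cong[OF refl])
    interpret T: branching_tree "rep \<tau>" by (rule branching_treesD(1)[OF rep_in_class(2)[OF \<tau>]])
    fix v assume "v \<in> nonroot_parents (rep \<tau>)"
    then have "v \<in> T.V" "v \<notin> leaves (rep \<tau>)" by (auto simp: nonroot_parents_def parents_def)
    then have "dl (rep \<tau>) v \<ge> 1" using T.leaf_iff_card by (simp add: T.dl_eq_card_leaf_set)
    then show "of_nat q powr (1 - of_nat (dl (rep \<tau>) v) - of_nat (dl (rep \<tau>) v choose 2) * s) /
          (1 - of_nat q powr (1 - of_nat (dl (rep \<tau>) v) - of_nat (dl (rep \<tau>) v choose 2) * s)) =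
        ?t (dl (rep \<tau>) v) / (1 - ?t (dl (rep \<tau>) v))"
      by (simp only: t)
  qed
  ultimately show ?thesis by (simp only: cong: sum.cong)
qed


end
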